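(* Let $K/F$ be a cyclic Galois extension of local nonarchimedean fields of degree $m$ with $\mathrm{Gal}(K/F)=\langle\sigma\rangle$, let $0\neq c\in\mathcal{O}_K$, and suppose that the (possibly associative) nonassociative cyclic algebra $A=(K/F,\sigma,c)=K[t;\sigma]/K[t;\sigma](t^m-c)$ is a division algebra. Let $\Lambda=\mathcal{O}_K[t;\sigma]/\mathcal{O}_K[t;\sigma](t^m-c)$ be its natural order, and for $x=x_0+x_1t+\dots+x_{m-1}t^{m-1}\in\Lambda$ put $$M(x)=\begin{bmatrix} x_0 & c\,\sigma(x_{m-1}) & c\,\sigma^2(x_{m-2}) & \cdots & c\,\sigma^{m-1}(x_1)\\ x_1 & \sigma(x_0) & c\,\sigma^2(x_{m-1}) & \cdots & c\,\sigma^{m-1}(x_2)\\ x_2 & \sigma(x_1) & \sigma^2(x_0) & \cdots & c\,\sigma^{m-1}(x_3)\\ \vdots & \vdots & \vdots & \ddots & \vdots\\ x_{m-1} & \sigma(x_{m-2}) & \sigma^2(x_{m-3}) & \cdots & \sigma^{m-1}(x_0)\end{bmatrix}\in M_m(\mathcal{O}_K).$$ Then: (i) $M(x)$ has column rank $m$ for every $0\neq x\in\Lambda$, and $\mathcal{C}=\{M(x) : 0\neq x\in\Lambda\}$ is a linear MRD-code over $\mathcal{O}_K$. (ii) Let $\mathfrak{p}$ be the maximal ideal of $\mathcal{O}_F$ and let $\mathcal{I}$ be a principal left ideal of $\Lambda$ generated by a monic polynomial such that $\mathfrak{p}\subset\mathcal{I}$. Then $\mathcal{C}_{\mathcal{I}}=\{M(x)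 : 0\neq x\in\mathcal{I}\}$ is a linear MRD-code over $\mathcal{O}_K$. (iii) With $\mathcal{I}$ as in (ii), let $\Psi$ be the reduction map from $\Lambda$ to $\overline A=(\mathcal{O}_K/\mathfrak{p}\mathcal{O}_K)[t;\overline\sigma]/(\mathcal{O}_K/\mathfrak{p}\mathcal{O}_K)[t;\overline\sigma](t^m-\overline c)$, also regarded as a map on $\Lambda/\mathfrak{p}\Lambda$, let $\rho:\Lambda\to\Lambda/\mathfrak{p}\Lambda\to\Psi(\Lambda/\mathfrak{p}\Lambda)$ be the canonical projection composed with $\Psi$, and let $L=\rho^{-1}(\Psi(\mathcal{I}/\mathfrak{p}\Lambda))$. Then the set of matrices $\{M(x) : 0\neq x\in L\}$ is the linear MRD-code $\mathcal{C}_{\mathcal{I}}$ over $\mathcal{O}_K$, and $L$ is an $\mathcal{O}_F$-lattice of rank $m[\mathcal{O}_K:\mathcal{O}_F]$. If $F$ is a $p$-adic field (a finite extension of $\mathbb{Q}_p$), then $L$ is a $\mathbb{Z}_p$-lattice of rank $m[\mathcal{O}_K:\mathbb{Z}_p]$; if $F=\mathbb{F}_q(\!(u)\!)$, then $L$ is an $\mathbb{F}_q[\![u]\!]$-lattice of rank $m[\mathcal{O}_K:\mathbb{F}_q[\![u]\!]]$.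
   Context: $\mathcal{O}_E$ denotes the ring of integers of a local nonarchimedean field $E$. Skew polynomials: for a unital associative ring $S$ and an injective ring endomorphism $\sigma$ of $S$, $S[t;\sigma]$ is the ring of polynomials $\sum a_it^i$ with $a_i\in S$, termwise addition, and multiplication determined by $ta=\sigma(a)t$. Petit algebras: let $f\in S[t;\sigma]$ be monic of degree $m$. Every $h\in S[t;\sigma]$ can be written uniquely as $h=qf+r$ with $\deg r<m$; write $r=h\bmod_r f$. The set of skew polynomials of degree less than $m$ with multiplication $g\circ h=(gh)\bmod_r f$ is a unital, in general nonassociative, ring, denoted $S[t;\sigma]/S[t;\sigma]f$. For $K[t;\sigma]/K[t;\sigma](t^m-c)$ one obtains an $F$-algebra $A$, in which $\Lambda=\mathcal{O}_K\oplus\mathcal{O}_Kt\oplus\dots\oplus\mathcal{O}_Kt^{m-1}$ is a subring (the natural order). A finite-dimensional $F$-algebra $A\neq0$ is a division algebra if for every $0\neq a\in A$ left multiplication and right multiplication by $a$ are bijective. A left ideal of a nonassociative ring $\Lambda$ is an additive subgroup $\mathcal{I}$ with $\Lambda\mathcal{I}\subset\mathcal{I}$; a principal left ideal generated by $g\in\Lambda$ is a left ideal of the form $\Lambda g=\{h\circ g:h\in\Lambda\}$. Reduction: $\overline\sigma$ is the automorphism of $\mathcal{O}_K/\mathfrak{p}\mathcal{O}_K$ induced by $\sigma$, and $\overline a=a+\mathfrak{p}\mathcal{O}_K$ for $a\in\mathcal{O}_K$. The map $\Psi:\Lambda\to\overline A$, $\sum a_it^i\mapsto\sum\overline{a_i}t^i$,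 is a surjective ring homomorphism with kernel $\mathfrak{p}\Lambda$; the induced isomorphism on $\Lambda/\mathfrak{p}\Lambda$ is also denoted $\Psi$. Rank metric codes: the distance of two matrices $X,Y$ is the (column) rank of $X-Y$, computed over $K$; the minimum distance $d_{\mathcal{C}}$ of a code is the minimum distance of two distinct elements. For a field extension $K/F$, an $F$-linear code $\mathcal{C}\subset M_{m\times m}(K)$ satisfies $\dim_F(\mathcal{C})\le m(m-d_{\mathcal{C}}+1)[K:F]$ and is called MRD if equality holds. A set $\mathcal{C}$ of nonzero matrices in $M_m(\mathcal{O}_K)$ is called here a linear MRD-code over $\mathcal{O}_K$ if $\mathcal{C}\cup\{0\}$ is an $\mathcal{O}_F$-submodule of $M_m(\mathcal{O}_K)$ which attains this bound, with $\dim_F$ replaced by the rank as an $\mathcal{O}_F$-module and $d_{\mathcal{C}}$ the minimum distance of $\mathcal{C}\cup\{0\}$. Lattices: for an integral domain $R$ with quotient field $E$ and a finite-dimensional $E$-algebra $A$, an $R$-lattice in $A$ is a finitely generated $R$-submodule of $A$ containing an $E$-basis of $A$. In the claim the lattices are in $A$. For rings $R\subset R'$ with $R'$ free of finite rank over $R$, $[R':R]$ denotes that rank. *)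

theory Defs
  imports
    "HOL-Computational_Algebra.Formal_Laurent_Series"
    "HOL-Algebra.QuotRing"
    "HOL-Algebra.UnivPoly"
    "HOL-Algebra.Ideal_Product"
    "HOL-Algebra.Embedded_Algebras"
    "HOL-Algebra.Generated_Groups"
    "Jordan_Normal_Form.DL_Rank"
begin

text \<open>The field \<open>K\<close> is a type \<open>'k\<close> of class \<open>field\<close>; subrings and subfields of \<open>K\<close> are subsets of
  \<open>'k\<close>, turned into rings by the following abbreviation.\<close>

abbreviation sub_of :: "'k::field set \<Rightarrow> 'k ring"
  where "sub_of H \<equiv> class_ring\<lparr>carrier := H\<rparr>"


section \<open>Local nonarchimedean fields\<close>

definition nonarch_abs :: "('k::field \<Rightarrow> real) \<Rightarrow> 'k set \<Rightarrow> bool"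
  where "nonarch_abs nrm E \<longleftrightarrow>
    (\<forall>x\<in>E. 0 \<le> nrm x \<and> (nrm x = 0 \<longleftrightarrow> x = 0)) \<and>
    (\<forall>x\<in>E. \<forall>y\<in>E. nrm (x * y) = nrm x * nrm y) \<and>
    (\<forall>x\<in>E. \<forall>y\<in>E. nrm (x + y) \<le> max (nrm x) (nrm y))"

definition complete_abs :: "('k::field \<Rightarrow> real) \<Rightarrow> 'k set \<Rightarrow> bool"
  where "complete_abs nrm E \<longleftrightarrow>
    (\<forall>X :: nat \<Rightarrow> 'k. (\<forall>n. X n \<in> E) \<longrightarrow>
      (\<forall>e>0. \<exists>N. \<forall>i\<ge>N. \<forall>j\<ge>N. nrm (X i - X j) < e) \<longrightarrow>
      (\<exists>x\<in>E. (\<lambda>n. nrm (X n - x)) \<longlonglongrightarrow> 0))"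

definition val_ring :: "('k::field \<Rightarrow> real) \<Rightarrow> 'k set \<Rightarrow> 'k set"
  where "val_ring nrm E = {x \<in> E. nrm x \<le> 1}"

definition max_ideal :: "('k::field \<Rightarrow> real) \<Rightarrow> 'k set \<Rightarrow> 'k set"
  where "max_ideal nrm E = {x \<in> E. nrm x < 1}"

text \<open>A field that is complete for a (nontrivial) discrete nonarchimedean absolute value and has
  finite residue field. The absolute value need not be normalised, so that the same \<open>nrm\<close>
  serves \<open>K\<close> and all its subfields.\<close>

definition local_nonarch_field :: "('k::field \<Rightarrow> real) \<Rightarrow> 'k set \<Rightarrow> bool"
  where "local_nonarch_field nrm E \<longleftrightarrow>
    subfield E class_ring \<and> nonarch_abs nrm E \<and> complete_abs nrm E \<and>
    (\<exists>\<pi>\<in>E. 0 < nrm \<pi> \<and> nrm \<pi> < 1 \<and>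
       (\<forall>x\<in>E. x \<noteq> 0 \<longrightarrow> (\<exists>n::int. nrm x = nrm \<pi> powi n))) \<and>
    finite (carrier (sub_of (val_ring nrm E) Quot max_ideal nrm E))"

text \<open>\<open>E\<close> is \<open>\<rat>\<^sub>p\<close>, i.e. a completion of the rationals for the \<open>p\<close>-adic absolute value. The base
  \<open>b\<close> takes the role of \<open>1/p\<close>, again because \<open>nrm\<close> need not be normalised; the condition on
  nonzero integers forces characteristic \<open>0\<close>.\<close>

definition padic_numbers :: "('k::field \<Rightarrow> real) \<Rightarrow> nat \<Rightarrow> 'k set \<Rightarrow> bool"
  where "padic_numbers nrm p E \<longleftrightarrow>
    prime p \<and> subfield E class_ring \<and> nonarch_abs nrm E \<and> complete_abs nrm E \<and>
    (\<exists>b. 0 < b \<and> b < 1 \<and>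
       (\<forall>n::int. n \<noteq> 0 \<longrightarrow> nrm (of_int n) = b ^ multiplicity (int p) n)) \<and>
    (\<forall>x\<in>E. \<forall>e>0. \<exists>a d :: int. d \<noteq> 0 \<and> nrm (x - of_int a / of_int d) < e)"

text \<open>\<open>\<phi>\<close> identifies \<open>k((u))\<close>, with the absolute value defined by the order in \<open>u\<close>, with \<open>E\<close>.\<close>

definition laurent_identification ::
    "('k::field \<Rightarrow> real) \<Rightarrow> 'k set \<Rightarrow> ('q::field fls \<Rightarrow> 'k) \<Rightarrow> bool"
  where "laurent_identification nrm E \<phi> \<longleftrightarrow>
    \<phi> \<in> ring_iso class_ring (sub_of E) \<and>
    (\<exists>b. 0 < b \<and> b < 1 \<and> (\<forall>f. f \<noteq> 0 \<longrightarrow> nrm (\<phi> f) = b powi fls_subdegree f))"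


section \<open>Cyclic Galois extensions\<close>

definition gal_group :: "'k::field set \<Rightarrow> ('k \<Rightarrow> 'k) monoid"
  where "gal_group F = \<lparr>carrier = {\<tau> \<in> ring_iso class_ring class_ring. \<forall>x\<in>F. \<tau> x = x},
    mult = (\<circ>), one = id\<rparr>"

definition cyclic_galois :: "'k::field set \<Rightarrow> nat \<Rightarrow> ('k \<Rightarrow> 'k) \<Rightarrow> bool"
  where "cyclic_galois F m \<sigma> \<longleftrightarrow>
    subfield F class_ring \<and> ring.dimension class_ring m F UNIV \<and>
    {x. \<forall>\<tau>\<in>carrier (gal_group F). \<tau> x = x} = F \<and>
    \<sigma> \<in> carrier (gal_group F) \<and> carrier (gal_group F) = generate (gal_group F) {\<sigma>}"

definition ext_degree :: "'k::field set \<Rightarrow> nat"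
  where "ext_degree F = (THE n. ring.dimension class_ring n F UNIV)"


section \<open>Skew polynomials and Petit algebras\<close>

text \<open>As for the ordinary polynomial ring \<open>UP S\<close>, the elements are the finitely supported
  coefficient functions. The product is forced by \<open>(a t\<^sup>i) (b t\<^sup>j) = a \<sigma>\<^sup>i(b) t\<^sup>i\<^sup>+\<^sup>j\<close>.\<close>

definition skew_poly :: "('a, 'b) ring_scheme \<Rightarrow> ('a \<Rightarrow> 'a) \<Rightarrow> (nat \<Rightarrow> 'a) ring"
  where "skew_poly S \<sigma> =
    \<lparr>carrier = up S,
     mult = (\<lambda>p q n. \<Oplus>\<^bsub>S\<^esub>i\<in>{..n}. p i \<otimes>\<^bsub>S\<^esub> (\<sigma> ^^ i) (q (n - i))),
     one = (\<lambda>i. if i = 0 then \<one>\<^bsub>S\<^esub> else \<zero>\<^bsub>S\<^esub>),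
     zero = (\<lambda>i. \<zero>\<^bsub>S\<^esub>),
     add = (\<lambda>p q i. p i \<oplus>\<^bsub>S\<^esub> q i)\<rparr>"

definition const_poly :: "('a, 'b) ring_scheme \<Rightarrow> 'a \<Rightarrow> nat \<Rightarrow> 'a"
  where "const_poly S a = (\<lambda>i. if i = 0 then a else \<zero>\<^bsub>S\<^esub>)"

definition monic_poly :: "('a, 'b) ring_scheme \<Rightarrow> (nat \<Rightarrow> 'a) \<Rightarrow> bool"
  where "monic_poly S g \<longleftrightarrow> (\<exists>d. g d = \<one>\<^bsub>S\<^esub> \<and> (\<forall>i>d. g i = \<zero>\<^bsub>S\<^esub>))"

definition polys_below :: "('a, 'b) ring_scheme \<Rightarrow> nat \<Rightarrow> (nat \<Rightarrow> 'a) set"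
  where "polys_below S m = {g \<in> up S. \<forall>i\<ge>m. g i = \<zero>\<^bsub>S\<^esub>}"

text \<open>Here and in \<open>petit\<close>, \<open>f\<close> is monic of degree \<open>m\<close>.\<close>

definition mod_r ::
    "('a, 'b) ring_scheme \<Rightarrow> ('a \<Rightarrow> 'a) \<Rightarrow> nat \<Rightarrow> (nat \<Rightarrow> 'a) \<Rightarrow> (nat \<Rightarrow> 'a) \<Rightarrow> nat \<Rightarrow> 'a"
  where "mod_r S \<sigma> m f h =
    (THE r. r \<in> polys_below S m \<and>
       (\<exists>q\<in>up S. h = (q \<otimes>\<^bsub>skew_poly S \<sigma>\<^esub> f) \<oplus>\<^bsub>skew_poly S \<sigma>\<^esub> r))"

text \<open>\<open>S[t;\<sigma>]/S[t;\<sigma>]f\<close>, together with its structure of a left \<open>S\<close>-module (and, by restriction of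
  scalars, of a module over every subring of \<open>S\<close>).\<close>

definition petit ::
    "('a, 'b) ring_scheme \<Rightarrow> ('a \<Rightarrow> 'a) \<Rightarrow> nat \<Rightarrow> (nat \<Rightarrow> 'a) \<Rightarrow> ('a, nat \<Rightarrow> 'a) module"
  where "petit S \<sigma> m f =
    \<lparr>carrier = polys_below S m,
     mult = (\<lambda>g h. mod_r S \<sigma> m f (g \<otimes>\<^bsub>skew_poly S \<sigma>\<^esub> h)),
     one = \<one>\<^bsub>skew_poly S \<sigma>\<^esub>,
     zero = \<zero>\<^bsub>skew_poly S \<sigma>\<^esub>,
     add = (\<lambda>g h. g \<oplus>\<^bsub>skew_poly S \<sigma>\<^esub> h),
     smult = (\<lambda>a g i. a \<otimes>\<^bsub>S\<^esub> g i)\<rparr>"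

text \<open>\<open>S[t;\<sigma>]/S[t;\<sigma>](t\<^sup>m - c)\<close> for \<open>m \<ge> 1\<close>.\<close>

definition petit_binom ::
    "('a, 'b) ring_scheme \<Rightarrow> ('a \<Rightarrow> 'a) \<Rightarrow> nat \<Rightarrow> 'a \<Rightarrow> ('a, nat \<Rightarrow> 'a) module"
  where "petit_binom S \<sigma> m c = petit S \<sigma> m
    (\<lambda>i. if i = m then \<one>\<^bsub>S\<^esub> else if i = 0 then \<ominus>\<^bsub>S\<^esub> c else \<zero>\<^bsub>S\<^esub>)"

definition division_alg :: "('a, 'b) ring_scheme \<Rightarrow> bool"
  where "division_alg A \<longleftrightarrow> carrier A \<noteq> {\<zero>\<^bsub>A\<^esub>} \<and>
    (\<forall>a\<in>carrier A - {\<zero>\<^bsub>A\<^esub>}.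
       bij_betw (\<lambda>x. a \<otimes>\<^bsub>A\<^esub> x) (carrier A) (carrier A) \<and>
       bij_betw (\<lambda>x. x \<otimes>\<^bsub>A\<^esub> a) (carrier A) (carrier A))"

definition left_ideal :: "('a, 'b) ring_scheme \<Rightarrow> 'a set \<Rightarrow> bool"
  where "left_ideal \<Lambda> I \<longleftrightarrow> additive_subgroup I \<Lambda> \<and>
    (\<forall>h\<in>carrier \<Lambda>. \<forall>x\<in>I. h \<otimes>\<^bsub>\<Lambda>\<^esub> x \<in> I)"

definition principal_left_ideal :: "('a, 'b) ring_scheme \<Rightarrow> 'a \<Rightarrow> 'a set \<Rightarrow> bool"
  where "principal_left_ideal \<Lambda> g I \<longleftrightarrow>
    g \<in> carrier \<Lambda> \<and> left_ideal \<Lambda> I \<and> I = (\<lambda>h. h \<otimes>\<^bsub>\<Lambda>\<^esub> g) ` carrier \<Lambda>"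


section \<open>Free modules and lattices\<close>

text \<open>A basis is required to lie in the module itself, which matters because \<open>module.span\<close> does
  not confine its argument to the carrier.\<close>

definition basis_of :: "('a, 'b) ring_scheme \<Rightarrow> ('a, 'c, 'd) module_scheme \<Rightarrow> 'c set \<Rightarrow> bool"
  where "basis_of R M B \<longleftrightarrow> B \<subseteq> carrier M \<and> module.lin_indpt R M B \<and> module.span R M B = carrier M"

definition free_of_rank :: "('a, 'b) ring_scheme \<Rightarrow> ('a, 'c, 'd) module_scheme \<Rightarrow> nat \<Rightarrow> bool"
  where "free_of_rank R M n \<longleftrightarrow> (\<exists>B. finite B \<and> card B = n \<and> basis_of R M B)"

definition class_module :: "('k::field, 'k) module"
  where "class_module = \<lparr>carrier = UNIV, mult = (*), one = 1, zero = 0, add = (+), smult = (*)\<rparr>"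

definition lattice_in ::
    "'k::field set \<Rightarrow> 'k set \<Rightarrow> ('k, 'c, 'd) module_scheme \<Rightarrow> 'c set \<Rightarrow> bool"
  where "lattice_in R E A L \<longleftrightarrow>
    submodule (sub_of R) L A \<and>
    (\<exists>S\<subseteq>L. finite S \<and> module.span (sub_of R) A S = L) \<and>
    (\<exists>B\<subseteq>L. basis_of (sub_of E) A B)"

text \<open>\<open>L\<close> is an \<open>R\<close>-lattice in \<open>A\<close> of rank \<open>m [R':R]\<close>, where \<open>E\<close> is the quotient field of \<open>R\<close>.\<close>

definition lattice_of_rank_mult ::
    "'k::field set \<Rightarrow> 'k set \<Rightarrow> ('k, 'c, 'd) module_scheme \<Rightarrow> 'c set \<Rightarrow> nat \<Rightarrow> 'k set \<Rightarrow> bool"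
  where "lattice_of_rank_mult R E A L m R' \<longleftrightarrow>
    lattice_in R E A L \<and>
    (\<exists>d. free_of_rank (sub_of R) (class_module\<lparr>carrier := R'\<rparr>) d \<and>
         free_of_rank (sub_of R) (A\<lparr>carrier := L\<rparr>) (m * d))"


section \<open>Rank metric codes\<close>

definition min_distance :: "nat \<Rightarrow> 'k::field mat set \<Rightarrow> nat"
  where "min_distance m C = (LEAST d. \<exists>X\<in>C. \<exists>Y\<in>C. X \<noteq> Y \<and> d = vec_space.rank m (X - Y))"

text \<open>Nonemptiness is what makes the minimum distance of \<open>C \<union> {0}\<close> meaningful.\<close>

definition linear_MRD :: "('k::field \<Rightarrow> real) \<Rightarrow> 'k set \<Rightarrow> nat \<Rightarrow> 'k mat set \<Rightarrow> bool"
  where "linear_MRD nrm F m C \<longleftrightarrow>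
    (let OF = sub_of (val_ring nrm F);
         OK = val_ring nrm UNIV;
         C0 = C \<union> {0\<^sub>m m m};
         MK = module_mat TYPE('k) m m
     in C \<noteq> {} \<and> 0\<^sub>m m m \<notin> C \<and>
        submodule OF C0 (MK\<lparr>carrier := {X \<in> carrier_mat m m. elements_mat X \<subseteq> OK}\<rparr>) \<and>
        free_of_rank OF (MK\<lparr>carrier := C0\<rparr>)
          (m * (m - min_distance m C0 + 1) * ext_degree F))"

definition code_matrix :: "('k \<Rightarrow> 'k) \<Rightarrow> 'k::field \<Rightarrow> nat \<Rightarrow> (nat \<Rightarrow> 'k) \<Rightarrow> 'k mat"
  where "code_matrix \<sigma> c m x = mat m m (\<lambda>(i, j).
    if j \<le> i then (\<sigma> ^^ j) (x (i - j)) else c * (\<sigma> ^^ j) (x (m + i - j)))"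

definition code_of :: "('k \<Rightarrow> 'k) \<Rightarrow> 'k::field \<Rightarrow> nat \<Rightarrow> (nat \<Rightarrow> 'k) set \<Rightarrow> 'k mat set"
  where "code_of \<sigma> c m X = {code_matrix \<sigma> c m x | x. x \<in> X \<and> x \<noteq> (\<lambda>_. 0)}"


section \<open>Reduction modulo the maximal ideal of the base\<close>

text \<open>\<open>\<pp> \<O>\<^sub>K\<close>, where \<open>\<pp>\<close> is the maximal ideal of \<open>\<O>\<^sub>F\<close>.\<close>

definition pOK :: "('k::field \<Rightarrow> real) \<Rightarrow> 'k set \<Rightarrow> 'k set"
  where "pOK nrm F =
    ideal_prod (sub_of (val_ring nrm UNIV)) (max_ideal nrm F) (val_ring nrm UNIV)"

definition natural_order ::
    "('k::field \<Rightarrow> real) \<Rightarrow> ('k \<Rightarrow> 'k) \<Rightarrow> nat \<Rightarrow> 'k \<Rightarrow> ('k, nat \<Rightarrow> 'k) module"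
  where "natural_order nrm \<sigma> m c = petit_binom (sub_of (val_ring nrm UNIV)) \<sigma> m c"

text \<open>The automorphism induced by \<open>\<sigma>\<close> sends a coset to its image under \<open>\<sigma>\<close>.\<close>

definition reduced_algebra ::
    "('k::field \<Rightarrow> real) \<Rightarrow> 'k set \<Rightarrow> ('k \<Rightarrow> 'k) \<Rightarrow> nat \<Rightarrow> 'k \<Rightarrow> ('k set, nat \<Rightarrow> 'k set) module"
  where "reduced_algebra nrm F \<sigma> m c =
    petit_binom (sub_of (val_ring nrm UNIV) Quot pOK nrm F) (image \<sigma>) m
      (pOK nrm F +>\<^bsub>sub_of (val_ring nrm UNIV)\<^esub> c)"

definition reduction :: "('k::field \<Rightarrow> real) \<Rightarrow> 'k set \<Rightarrow> (nat \<Rightarrow> 'k) \<Rightarrow> nat \<Rightarrow> 'k set"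
  where "reduction nrm F x = (\<lambda>i. pOK nrm F +>\<^bsub>sub_of (val_ring nrm UNIV)\<^esub> x i)"

lemma reduction_in_reduced_algebra:
  assumes "x \<in> carrier (natural_order nrm \<sigma> m c)"
  shows "reduction nrm F x \<in> carrier (reduced_algebra nrm F \<sigma> m c)"
proof -
  let ?O = "sub_of (val_ring nrm UNIV)"
  have x: "x i \<in> carrier ?O" and z: "i \<ge> m \<Longrightarrow> x i = 0" for i
    using assms
    by (auto simp: natural_order_def petit_binom_def petit_def polys_below_def up_def)
  have "reduction nrm F x i \<in> carrier (?O Quot pOK nrm F)" for i
    using x[of i] by (auto simp: reduction_def FactRing_def A_RCOSETS_def' a_r_coset_def')
  moreover have "i \<ge> m \<Longrightarrow> reduction nrm F x i = pOK nrm F" for i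
    using z[of i] by (auto simp: reduction_def a_r_coset_def')
  ultimately show ?thesis
    unfolding reduced_algebra_def petit_binom_def petit_def polys_below_def up_def
    by (auto simp: FactRing_def intro!: exI[of _ m])
qed

definition pLambda ::
    "('k::field \<Rightarrow> real) \<Rightarrow> 'k set \<Rightarrow> ('k \<Rightarrow> 'k) \<Rightarrow> nat \<Rightarrow> 'k \<Rightarrow> (nat \<Rightarrow> 'k) set"
  where "pLambda nrm F \<sigma> m c =
    ideal_prod (natural_order nrm \<sigma> m c)
      (const_poly class_ring ` max_ideal nrm F) (carrier (natural_order nrm \<sigma> m c))"

definition proj_Lambda ::
    "('k::field \<Rightarrow> real) \<Rightarrow> 'k set \<Rightarrow> ('k \<Rightarrow> 'k) \<Rightarrow> nat \<Rightarrow> 'k \<Rightarrow> (nat \<Rightarrow> 'k) \<Rightarrow> (nat \<Rightarrow> 'k) set"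
  where "proj_Lambda nrm F \<sigma> m c x = pLambda nrm F \<sigma> m c +>\<^bsub>natural_order nrm \<sigma> m c\<^esub> x"

text \<open>The map induced by \<open>reduction\<close> on cosets of \<open>\<pp> \<Lambda>\<close>, on each of which \<open>reduction\<close> is constant.\<close>

definition reduction_quot ::
    "('k::field \<Rightarrow> real) \<Rightarrow> 'k set \<Rightarrow> (nat \<Rightarrow> 'k) set \<Rightarrow> nat \<Rightarrow> 'k set"
  where "reduction_quot nrm F X = the_elem (reduction nrm F ` X)"

definition rho ::
    "('k::field \<Rightarrow> real) \<Rightarrow> 'k set \<Rightarrow> ('k \<Rightarrow> 'k) \<Rightarrow> nat \<Rightarrow> 'k \<Rightarrow> (nat \<Rightarrow> 'k) \<Rightarrow> nat \<Rightarrow> 'k set"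
  where "rho nrm F \<sigma> m c x = reduction_quot nrm F (proj_Lambda nrm F \<sigma> m c x)"

definition lift_lattice ::
    "('k::field \<Rightarrow> real) \<Rightarrow> 'k set \<Rightarrow> ('k \<Rightarrow> 'k) \<Rightarrow> nat \<Rightarrow> 'k \<Rightarrow> (nat \<Rightarrow> 'k) set \<Rightarrow> (nat \<Rightarrow> 'k) set"
  where "lift_lattice nrm F \<sigma> m c I =
    {x \<in> carrier (natural_order nrm \<sigma> m c).
       rho nrm F \<sigma> m c x \<in> reduction_quot nrm F ` (proj_Lambda nrm F \<sigma> m c ` I)}"

end

theory Submission
  imports Defs
begin

text \<open>Let \<open>v\<close> be a nonzero vector with \<open>M(x) v = 0\<close> for some \<open>x \<noteq> 0\<close>. Read as skew polynomials of degree
  less than \<open>m\<close>, \<open>v\<close> and \<open>x\<close> then satisfy \<open>v x = (t\<^sup>m - c) q\<close>. Here \<open>\<sigma>\<^sup>m = id\<close> is used, by the theorems of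
  Dedekind and Artin. This common right multiple of \<open>v\<close> and \<open>t\<^sup>m - c\<close> has degree less than
  \<open>deg v + m\<close>, so Euclid's algorithm yields a common left divisor \<open>D\<close> of positive degree, and
  \<open>t\<^sup>m - c = D u\<close> makes \<open>D\<close> and \<open>u\<close> zero divisors of \<open>A\<close>. The detour is needed because \<open>M(x)\<close> is the matrix of
  a left multiplication in \<open>K[t;\<sigma>\<^sup>-\<^sup>1]/K[t;\<sigma>\<^sup>-\<^sup>1](t\<^sup>m - c)\<close> rather than in \<open>A\<close>.

  Every difference of two codewords thus has rank \<open>m\<close>, and only ranks of modules remain. Coordinates
  over a complete subfield \<open>E\<close> with \<open>[K : E]\<close> finite are bounded functions, so \<open>\<O>\<^sub>K\<close>, and every module
  between \<open>\<pp>\<Lambda>\<close> and \<open>\<Lambda>\<close>, is commensurable with a standard lattice and hence free of full rank over the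
  discrete valuation ring of \<open>E\<close>. The ideal \<open>\<I>\<close> contains \<open>\<pp>\<Lambda>\<close>, because \<open>\<pp>\<close> is central, and therefore \<open>L = \<I>\<close>.\<close>


section \<open>Coordinates on free modules\<close>

text \<open>The code matrix detects left multiples of \<open>t^m - c\<close>, whereas
  \<open>A\<close> is built from division on the other side. A factorization
  \<open>t^m - c = D u\<close> has no side, and this is what carries the information from one to the
  other. The claims on ranks concern several modules (\<O>_K, lattices in \<open>A\<close>, sets of
  matrices) over several rings. One device serves them all: a linear injective map on coordinate
  functions. If such a map is linear over \<open>E\<close> and bijective on
  \<open>coords E n\<close>, the images of the unit vectors are at once a basis over
  \<open>E\<close> and a basis of the image of \<open>coords R n\<close> over \<open>R\<close>.
  Coordinate functions vanish from \<open>n\<close> on, so that \<open>coords UNIV m\<close> is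
  exactly the carrier of the Petit algebra. The two analytic inputs have separate roles:
  completeness bounds coordinates and yields the invariance of \<O>_K under \<sigma>, which is not
  assumed; discreteness lets bounded sets attain their maximal norm, from which bases of lattices
  are built.\<close>

definition coords :: "'k::field set \<Rightarrow> nat \<Rightarrow> (nat \<Rightarrow> 'k) set"
  where "coords R n = {a. (\<forall>k<n. a k \<in> R) \<and> (\<forall>k\<ge>n. a k = 0)}"

definition unit_coords :: "nat \<Rightarrow> nat \<Rightarrow> 'k::field"
  where "unit_coords k = (\<lambda>i. if i = k then 1 else 0)"

locale module_coords =
  fixes R :: "'k::field set" and M :: "('k, 'c, 'd) module_scheme" and n and h :: "(nat \<Rightarrow> 'k) \<Rightarrow> 'c"
  assumes module: "module (sub_of R) M"
    and zero: "0 \<in> R" and one: "1 \<in> R"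
    and inj: "inj_on h (coords R n)"
    and closed: "h ` coords R n \<subseteq> carrier M"
    and add: "a \<in> coords R n \<Longrightarrow> b \<in> coords R n \<Longrightarrow> h (\<lambda>k. a k + b k) = h a \<oplus>\<^bsub>M\<^esub> h b"
    and smult: "r \<in> R \<Longrightarrow> a \<in> coords R n \<Longrightarrow> h (\<lambda>k. r * a k) = r \<odot>\<^bsub>M\<^esub> h a"
begin

sublocale module "sub_of R" M by (rule module)

definition basis :: "'c set"
  where "basis = (\<lambda>k. h (unit_coords k)) ` {..<n}"

lemma unit_coords_in: "k < n \<Longrightarrow> unit_coords k \<in> coords R n"
  by (auto simp: coords_def unit_coords_def zero one)

lemma coords_zero: "(\<lambda>_. 0) \<in> coords R n"
  by (auto simp: coords_def zero)

lemma h_zero: "h (\<lambda>_. 0) = \<zero>\<^bsub>M\<^esub>"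
proof -
  have "h (\<lambda>_. 0) \<in> carrier M"
    using closed coords_zero by blast
  moreover have "h (\<lambda>_. 0) = 0 \<odot>\<^bsub>M\<^esub> h (\<lambda>_. 0)"
    using smult[OF zero coords_zero] by simp
  ultimately show ?thesis
    using lmult_0 by simp
qed

lemma basis_inj: "inj_on (\<lambda>k. h (unit_coords k)) {..<n}"
proof (rule inj_onI)
  fix k l assume "k \<in> {..<n}" "l \<in> {..<n}" "h (unit_coords k) = h (unit_coords l)"
  then have "(unit_coords k :: nat \<Rightarrow> 'k) = unit_coords l"
    using inj unit_coords_in by (auto simp: inj_on_def)
  from fun_cong[OF this, of k] show "k = l"
    by (auto simp: unit_coords_def split: if_splits)
qed

lemma basis_carrier: "basis \<subseteq> carrier M"
  using closed unit_coords_in by (auto simp: basis_def)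

lemma finite_basis: "finite basis" and card_basis: "card basis = n"
  by (auto simp: basis_def card_image basis_inj)

lemma lincomb_basis:
  assumes "c \<in> basis \<rightarrow> R"
  shows "lincomb c basis = h (\<lambda>k. if k < n then c (h (unit_coords k)) else 0)"
proof -
  let ?b = "\<lambda>k. h (unit_coords k)"
  \<comment> \<open>Generalized to initial segments of the basis, because
    \<open>lincomb_insert\<close> adds one vector at a time.\<close>
  have "lincomb c (?b ` {..<j}) = h (\<lambda>k. if k < j then c (?b k) else 0)" if "j \<le> n" for j
    using that
  proof (induction j)
    case 0
    then show ?case by (simp add: h_zero lincomb_def)
  next
    case (Suc j)
    have sub: "?b ` {..<j} \<subseteq> carrier M" and bj: "?b j \<in> carrier M"
      using basis_carrier Suc.prems by (auto simp: basis_def)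
    have c: "c (?b k) \<in> R" if "k < Suc j" for k
      using assms that Suc.prems by (auto simp: basis_def)
    have nin: "?b j \<notin> ?b ` {..<j}"
    proof
      assume "?b j \<in> ?b ` {..<j}"
      then obtain k where "k < j" "?b j = ?b k" by auto
      then show False
        using inj_onD[OF basis_inj, of j k] Suc.prems by auto
    qed
    have "?b ` {..<Suc j} = ?b ` {..<j} \<union> {?b j}"
      by (auto simp: lessThan_Suc)
    moreover have "c \<in> ?b ` {..<j} \<union> {?b j} \<rightarrow> carrier (sub_of R)"
      using c by auto
    ultimately have "lincomb c (?b ` {..<Suc j}) = c (?b j) \<odot>\<^bsub>M\<^esub> ?b j \<oplus>\<^bsub>M\<^esub> lincomb c (?b ` {..<j})"
      using lincomb_insert[OF _ sub _ nin bj, of c] by simp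
    also have "\<dots> = h (\<lambda>k. c (?b j) * unit_coords j k) \<oplus>\<^bsub>M\<^esub> h (\<lambda>k. if k < j then c (?b k) else 0)"
      using Suc c[of j] unit_coords_in[of j] smult[of "c (?b j)" "unit_coords j"] by simp
    also have "\<dots> = h (\<lambda>k. c (?b j) * unit_coords j k + (if k < j then c (?b k) else 0))"
      using Suc.prems c by (intro add[symmetric]) (auto simp: coords_def unit_coords_def zero)
    also have "(\<lambda>k. c (?b j) * unit_coords j k + (if k < j then c (?b k) else 0))
        = (\<lambda>k. if k < Suc j then c (?b k) else 0)"
    proof
      fix k
      show "c (?b j) * unit_coords j k + (if k < j then c (?b k) else 0)
          = (if k < Suc j then c (?b k) else 0)"
        by (cases "k = j") (auto simp: unit_coords_def)
    qed
    finally show ?case .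
  qed
  from this[of n] show ?thesis by (simp add: basis_def)
qed

lemma span_basis: "span basis = h ` coords R n"
proof -
  have "span basis = {lincomb c basis | c. c \<in> basis \<rightarrow> R}"
    using finite_span[OF finite_basis basis_carrier] by simp
  also have "\<dots> = h ` coords R n"
  proof (intro equalityI subsetI)
    fix x assume "x \<in> {lincomb c basis | c. c \<in> basis \<rightarrow> R}"
    then obtain c where c: "c \<in> basis \<rightarrow> R" and x: "x = lincomb c basis" by blast
    have "(\<lambda>k. if k < n then c (h (unit_coords k)) else 0) \<in> coords R n"
      using c by (auto simp: coords_def basis_def)
    then show "x \<in> h ` coords R n"
      unfolding x lincomb_basis[OF c] by (rule imageI)
  next
    fix x assume "x \<in> h ` coords R n"
    then obtain a where a: "a \<in> coords R n" and x: "x = h a" by blast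
    \<comment> \<open>Coefficients of \<open>lincomb\<close> are indexed by vectors rather than by
      positions, so the enumeration of the basis has to be inverted.\<close>
    define c where "c v = a (the_inv_into {..<n} (\<lambda>k. h (unit_coords k)) v)" for v
    have ck: "c (h (unit_coords k)) = a k" if "k < n" for k
      using the_inv_into_f_f[OF basis_inj, of k] that by (simp add: c_def)
    then have c: "c \<in> basis \<rightarrow> R"
      using a by (auto simp: basis_def coords_def)
    have "lincomb c basis = h (\<lambda>k. if k < n then c (h (unit_coords k)) else 0)"
      by (rule lincomb_basis[OF c])
    also have "(\<lambda>k. if k < n then c (h (unit_coords k)) else 0) = a"
      using a ck by (auto simp: coords_def fun_eq_iff)
    finally show "x \<in> {lincomb c basis | c. c \<in> basis \<rightarrow> R}"
      using c unfolding x by (metis (mono_tags, lifting) mem_Collect_eq)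
  qed
  finally show ?thesis .
qed

lemma lin_indpt_basis: "lin_indpt basis"
proof (rule finite_lin_indpt2[OF finite_basis basis_carrier])
  fix c assume "c \<in> basis \<rightarrow> carrier (sub_of R)" and 0: "lincomb c basis = \<zero>\<^bsub>M\<^esub>"
  then have c: "c \<in> basis \<rightarrow> R" by simp
  let ?a = "\<lambda>k. if k < n then c (h (unit_coords k)) else 0"
  have "?a \<in> coords R n"
    using c by (auto simp: coords_def basis_def)
  moreover have "h ?a = h (\<lambda>_. 0)"
    using 0 lincomb_basis[OF c] h_zero by simp
  ultimately have "?a = (\<lambda>_. 0)"
    using inj coords_zero by (auto simp: inj_on_def)
  then have "c (h (unit_coords k)) = 0" if "k < n" for k
    using that by (metis (full_types))
  then show "\<forall>v\<in>basis. c v = \<zero>\<^bsub>sub_of R\<^esub>"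
    by (auto simp: basis_def)
qed

lemma basis_of_basis:
  assumes "h ` coords R n = carrier M"
  shows "basis_of (sub_of R) M basis"
  using assms basis_carrier lin_indpt_basis span_basis by (auto simp: basis_of_def)

lemma free_of_rank_coords:
  assumes "h ` coords R n = carrier M"
  shows "free_of_rank (sub_of R) M n"
  using basis_of_basis[OF assms] finite_basis card_basis by (auto simp: free_of_rank_def)

end

section \<open>Subrings of a field, restriction of scalars, lattices in coordinates\<close>

lemma cring_class_ring: "cring (class_ring :: 'k::field ring)"
  using field.axioms(1)[OF class_field] by (rule domain.axioms(1))

lemmas ring_class_ring = cring.axioms(1)[OF cring_class_ring]

lemma cring_sub_of:
  fixes R :: "'k::field set"
  assumes "subring R class_ring"
  shows "cring (sub_of R)"
  using cring.subcringI'[OF cring_class_ring assms] ring.subcring_iff[OF ring_class_ring, of R] by simp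

lemma subringD:
  fixes R :: "'k::field set"
  assumes "subring R class_ring"
  shows "0 \<in> R" "1 \<in> R" "x \<in> R \<Longrightarrow> y \<in> R \<Longrightarrow> x + y \<in> R" "x \<in> R \<Longrightarrow> y \<in> R \<Longrightarrow> x * y \<in> R"
    "x \<in> R \<Longrightarrow> - x \<in> R" "x \<in> R \<Longrightarrow> y \<in> R \<Longrightarrow> x - y \<in> R"
proof -
  note * = subringE[OF assms, simplified class_ring_simps]
  show "0 \<in> R" "1 \<in> R" "x \<in> R \<Longrightarrow> y \<in> R \<Longrightarrow> x + y \<in> R" "x \<in> R \<Longrightarrow> y \<in> R \<Longrightarrow> x * y \<in> R"
    and neg: "x \<in> R \<Longrightarrow> - x \<in> R" for x y
    using * by auto
  show "x \<in> R \<Longrightarrow> y \<in> R \<Longrightarrow> x - y \<in> R"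
    using *(7)[of x "- y"] neg[of y] by simp
qed

lemma module_restrict_scalars:
  fixes R :: "'k::field set"
  assumes "module (sub_of E) A" and "subring R class_ring" and "R \<subseteq> E"
  shows "module (sub_of R) A"
proof -
  interpret module "sub_of E" A by fact
  show ?thesis
    using cring_sub_of[OF assms(2)] assms(3) smult_l_distr smult_r_distr smult_assoc1 smult_one
    by (intro module.intro module_axioms.intro M.abelian_group_axioms)
       (auto simp: subset_iff)
qed

text \<open>Unit vectors have entries in \<open>R\<close>, so their images lie in the lattice. They
  form a basis over \<open>E\<close> by bijectivity of \<open>h\<close>, and the same vectors
  generate the lattice freely over \<open>R\<close>.\<close>

lemma lattice_coords:
  fixes R E :: "'k::field set"
  assumes A: "module (sub_of E) A" and E: "subring E class_ring"
    and R: "subring R class_ring" "R \<subseteq> E"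
    and h: "bij_betw h (coords E n) (carrier A)"
    and add: "\<And>a b. a \<in> coords E n \<Longrightarrow> b \<in> coords E n \<Longrightarrow> h (\<lambda>k. a k + b k) = h a \<oplus>\<^bsub>A\<^esub> h b"
    and smult: "\<And>r a. r \<in> E \<Longrightarrow> a \<in> coords E n \<Longrightarrow> h (\<lambda>k. r * a k) = r \<odot>\<^bsub>A\<^esub> h a"
  shows "lattice_in R E A (h ` coords R n)"
    and "free_of_rank (sub_of R) (A\<lparr>carrier := h ` coords R n\<rparr>) n"
proof -
  have RE: "coords R n \<subseteq> coords E n"
    using R(2) by (auto simp: coords_def)
  interpret AE: module_coords E A n h
    using h by (intro module_coords.intro A subringD[OF E] add smult) (auto simp: bij_betw_def)
  interpret AR: module_coords R A n h
  proof (intro module_coords.intro module_restrict_scalars[OF A R] subringD[OF R(1)])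
    show "inj_on h (coords R n)" "h ` coords R n \<subseteq> carrier A"
      using h RE by (auto simp: bij_betw_def intro: inj_on_subset)
  qed (use RE R(2) add smult in \<open>blast+\<close>)
  have sub: "submodule (sub_of R) (h ` coords R n) A"
    using AR.span_is_submodule[OF AR.basis_carrier] AR.span_basis by simp
  have basis: "AR.basis \<subseteq> h ` coords R n"
    using AR.unit_coords_in by (auto simp: AR.basis_def)
  have "basis_of (sub_of E) A AR.basis"
    using AE.basis_of_basis h by (simp add: AE.basis_def AR.basis_def bij_betw_def)
  then show "lattice_in R E A (h ` coords R n)"
    using sub basis AR.finite_basis AR.span_basis unfolding lattice_in_def by blast
  \<comment> \<open>Freeness concerns the record whose carrier is the lattice itself, with its own
    span and independence; hence a second instance of the locale.\<close>
  interpret ARL: module_coords R "A\<lparr>carrier := h ` coords R n\<rparr>" n h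
    using AR.submodule_is_module[OF sub] AR.zero AR.one AR.inj AR.add AR.smult
    by (intro module_coords.intro) auto
  show "free_of_rank (sub_of R) (A\<lparr>carrier := h ` coords R n\<rparr>) n"
    by (rule ARL.free_of_rank_coords) simp
qed


section \<open>Norms on finite extensions of complete fields\<close>

locale nonarch =
  fixes nrm :: "'k::field \<Rightarrow> real"
  assumes nonarch: "nonarch_abs nrm UNIV"
begin

lemma nrm_nonneg [simp]: "0 \<le> nrm x"
  and nrm_eq_0 [simp]: "nrm x = 0 \<longleftrightarrow> x = 0"
  and nrm_mult: "nrm (x * y) = nrm x * nrm y"
  and nrm_add: "nrm (x + y) \<le> max (nrm x) (nrm y)"
  using nonarch by (auto simp: nonarch_abs_def)

lemma nrm_0 [simp]: "nrm 0 = 0"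
  by simp

lemma nrm_pos [simp]: "0 < nrm x \<longleftrightarrow> x \<noteq> 0"
  using nrm_nonneg[of x] nrm_eq_0[of x] by linarith

lemma nrm_1 [simp]: "nrm 1 = 1"
  using nrm_mult[of 1 1] by simp

lemma nrm_power: "nrm (x ^ n) = nrm x ^ n"
  by (induction n) (auto simp: nrm_mult)

lemma nrm_uminus [simp]: "nrm (- x) = nrm x"
proof -
  have "nrm (- 1) ^ 2 = 1"
    using nrm_power[of "- 1" 2] by simp
  then have "nrm (- 1) = 1"
    using nrm_nonneg[of "- 1"] power2_eq_1_iff[of "nrm (- 1)"] by auto
  then show ?thesis
    using nrm_mult[of "- 1" x] by simp
qed

lemma nrm_diff: "nrm (x - y) \<le> max (nrm x) (nrm y)"
  using nrm_add[of x "- y"] by simp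

lemma nrm_inverse: "nrm (inverse x) = inverse (nrm x)"
proof (cases "x = 0")
  case False
  then have "nrm x * nrm (inverse x) = 1"
    by (simp flip: nrm_mult)
  then show ?thesis
    using inverse_unique[of "nrm x" "nrm (inverse x)"] by simp
qed simp

lemma nrm_divide: "nrm (x / y) = nrm x / nrm y"
  by (simp add: divide_inverse nrm_mult nrm_inverse)

lemma nrm_sum_le:
  assumes "0 \<le> B" and "\<And>i. i \<in> I \<Longrightarrow> nrm (f i) \<le> B"
  shows "nrm (sum f I) \<le> B"
  using assms(2)
proof (induction I rule: infinite_finite_induct)
  case (insert i I)
  then have "nrm (f i) \<le> B" "nrm (sum f I) \<le> B" by auto
  then show ?case
    using insert.hyps nrm_add[of "f i" "sum f I"] by simp
qed (use assms(1) in auto)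

lemma subring_val_ring:
  assumes "subring E class_ring"
  shows "subring (val_ring nrm E) class_ring"
proof (rule ring.subringI[OF ring_class_ring])
  note E = subringD[OF assms]
  show "val_ring nrm E \<subseteq> carrier class_ring" "\<one>\<^bsub>class_ring\<^esub> \<in> val_ring nrm E"
    using E by (auto simp: val_ring_def)
  fix x y assume *: "x \<in> val_ring nrm E" "y \<in> val_ring nrm E"
  show "\<ominus>\<^bsub>class_ring\<^esub> x \<in> val_ring nrm E"
    using * E by (auto simp: val_ring_def class_ring_simps)
  show "x \<otimes>\<^bsub>class_ring\<^esub> y \<in> val_ring nrm E"
    using * E by (auto simp: val_ring_def nrm_mult intro: mult_le_one)
  show "x \<oplus>\<^bsub>class_ring\<^esub> y \<in> val_ring nrm E"
    using * E nrm_add[of x y] by (auto simp: val_ring_def)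
qed

end

lemma subfield_inverse:
  fixes E :: "'k::field set"
  assumes "subfield E class_ring" and "x \<in> E"
  shows "inverse x \<in> E"
proof (cases "x = 0")
  case True
  then show ?thesis using assms(2) by simp
next
  case False
  then have "inv\<^bsub>class_ring\<^esub> x \<in> E"
    using ring.subfield_m_inv(1)[OF ring_class_ring assms(1), of x] assms(2) by simp
  then show ?thesis
    using False by (simp add: class_ring_simps)
qed

text \<open>The norm lives on all of \<open>K\<close>, while completeness and discreteness are
  imposed on the subfield \<open>E\<close>. The locale is used both for \<open>F\<close> and for
  \<rat>_p inside \<open>F\<close>, always with the norm of \<open>K\<close>.\<close>

locale complete_subfield = nonarch nrm for nrm :: "'k::field \<Rightarrow> real" +
  fixes E :: "'k set" and \<pi> :: 'k
  assumes subfield: "subfield E class_ring"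
    and complete: "complete_abs nrm E"
    and uniformizer: "\<pi> \<in> E" "0 < nrm \<pi>" "nrm \<pi> < 1"
    and discrete: "x \<in> E \<Longrightarrow> x \<noteq> 0 \<Longrightarrow> \<exists>n::int. nrm x = nrm \<pi> powi n"
begin

abbreviation R where "R \<equiv> val_ring nrm E"

lemma subring: "subring E class_ring"
  using subfield by (rule subfieldE(1))

lemmas E_simps [simp, intro] = subringD[OF subring]
lemmas R_simps [simp, intro] = subringD[OF subring_val_ring[OF subring]]

lemma E_inverse [simp, intro]: "x \<in> E \<Longrightarrow> inverse x \<in> E"
  by (rule subfield_inverse[OF subfield])

lemma E_divide [simp, intro]: "x \<in> E \<Longrightarrow> y \<in> E \<Longrightarrow> x / y \<in> E"
  by (auto simp: divide_inverse)

lemma R_subset: "R \<subseteq> E"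
  by (auto simp: val_ring_def)

text \<open>Nonzero norms are integral powers of \<open>nrm \<pi>\<close>, so an upper bound on
  norms is a lower bound on exponents, and a least exponent exists. This is where discreteness
  enters the construction of bases.\<close>

lemma attains_max:
  assumes "T \<subseteq> E" and "t \<in> T" "t \<noteq> 0" and B: "\<And>x. x \<in> T \<Longrightarrow> nrm x \<le> B"
  shows "\<exists>v\<in>T. v \<noteq> 0 \<and> (\<forall>x\<in>T. nrm x \<le> nrm v)"
proof -
  let ?r = "nrm \<pi>"
  have r: "0 < ?r" "?r < 1" using uniformizer by auto
  have B0: "0 < B" using B[OF assms(2)] assms(3) nrm_pos[of t] by linarith
  \<comment> \<open>All exponents exceed \<open>- N\<close>; adding \<open>N\<close> makes them
    natural numbers, which can be minimized.\<close>
  obtain N where N: "?r ^ N < 1 / B"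
    using real_arch_pow_inv[of "1 / B" ?r] r B0 by auto
  have "\<exists>n. x \<in> T \<longrightarrow> x \<noteq> 0 \<longrightarrow> nrm x = ?r powi n" for x
    using discrete assms(1) by blast
  then obtain v where v: "\<And>x. x \<in> T \<Longrightarrow> x \<noteq> 0 \<Longrightarrow> nrm x = ?r powi (v x)"
    by metis
  have lower: "- int N < v x" if "x \<in> T" "x \<noteq> 0" for x
  proof (rule ccontr)
    assume "\<not> - int N < v x"
    then have "?r powi (- int N) \<le> ?r powi (v x)"
      using r by (intro power_int_decreasing) auto
    also have "\<dots> \<le> B" using v[OF that] B[OF that(1)] by simp
    finally have "1 \<le> B * ?r ^ N"
      using r by (simp add: power_int_minus field_simps)
    then show False using N B0 by (simp add: field_simps)
  qed
  obtain w where w: "w \<in> T \<and> w \<noteq> 0"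
    and min: "\<And>x. x \<in> T \<and> x \<noteq> 0 \<Longrightarrow> nat (v w + int N) \<le> nat (v x + int N)"
    using ex_has_least_nat[of "\<lambda>x. x \<in> T \<and> x \<noteq> 0" t "\<lambda>x. nat (v x + int N)"] assms(2,3) by blast
  have "nrm x \<le> nrm w" if "x \<in> T" for x
  proof (cases "x = 0")
    case False
    then have "v w \<le> v x"
      using min[of x] lower[of x] lower[of w] w that by auto
    then show ?thesis
      using v w that False r power_int_decreasing[of "v w" "v x" ?r] by auto
  qed simp
  then show ?thesis using w by blast
qed

text \<open>Equivalence of norms in finite dimension. The vectors need not span \<open>K\<close>,
  since the induction passes to the first \<open>d\<close> of them. If the last vector has distance
  at least \<delta> from their span, its coefficient is bounded by \<open>1 / \<delta>\<close> times
  the norm of the sum; the other coefficients follow by subtracting the last term.\<close>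

lemma coordinates_bounded:
  assumes "\<And>a. a \<in> coords E d \<Longrightarrow> (\<Sum>k<d. a k * e k) = 0 \<Longrightarrow> \<forall>k<d. a k = 0"
  shows "\<exists>C>0. \<forall>a\<in>coords E d. \<forall>k<d. nrm (a k) \<le> C * nrm (\<Sum>k<d. a k * e k)"
  using assms
proof (induction d)
  case 0
  show ?case by (intro exI[of _ 1]) auto
next
  case (Suc d)
  define S where "S a = (\<Sum>k<d. a k * e k)" for a :: "nat \<Rightarrow> 'k"
  have S_diff: "S (\<lambda>k. a k - b k) = S a - S b" for a b
    by (simp add: S_def algebra_simps sum_subtractf)
  have S_bound: "nrm (S a) \<le> B" if "0 \<le> B" "\<And>k. k < d \<Longrightarrow> nrm (a k) * nrm (e k) \<le> B" for a B
    unfolding S_def using that by (intro nrm_sum_le) (auto simp: nrm_mult)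
  have "\<forall>k<d. a k = 0" if a: "a \<in> coords E d" "S a = 0" for a
  proof -
    have "a \<in> coords E (Suc d)" using a(1) by (auto simp: coords_def less_Suc_eq)
    moreover have "(\<Sum>k<Suc d. a k * e k) = 0" using a by (simp add: S_def coords_def)
    ultimately show ?thesis using Suc.prems less_SucI by blast
  qed
  then have "\<exists>C>0. \<forall>a\<in>coords E d. \<forall>k<d. nrm (a k) \<le> C * nrm (S a)"
    unfolding S_def by (rule Suc.IH)
  then obtain C where C: "0 < C" "\<And>a k. a \<in> coords E d \<Longrightarrow> k < d \<Longrightarrow> nrm (a k) \<le> C * nrm (S a)"
    by blast
  \<comment> \<open>By completeness the span of the first \<open>d\<close> vectors is closed, hence at positive distance
    from the last one.\<close>
  have "\<exists>\<delta>>0. \<forall>w\<in>coords E d. \<delta> \<le> nrm (e d + S w)"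
  proof (rule ccontr)
    assume "\<not> ?thesis"
    then have "\<exists>w\<in>coords E d. nrm (e d + S w) < \<delta>" if "0 < \<delta>" for \<delta>
      using that by (auto simp: not_le)
    from this[of "inverse (real (Suc _))"]
    have "\<forall>n::nat. \<exists>w\<in>coords E d. nrm (e d + S w) < inverse (real (Suc n))"
      by simp
    then obtain w where w: "\<And>n. w n \<in> coords E d" "\<And>n. nrm (e d + S (w n)) < inverse (real (Suc n))"
      by metis
    \<comment> \<open>The vectors \<open>e d + S (w n)\<close> tend to 0, and the induction
      hypothesis transfers the Cauchy property of \<open>S (w n)\<close> to each coordinate.\<close>
    have wdiff: "nrm (w i k - w j k) \<le> C * max (inverse (real (Suc i))) (inverse (real (Suc j)))"
      if "k < d" for i j k
    proof -
      have "(\<lambda>k. w i k - w j k) \<in> coords E d"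
        using w(1)[of i] w(1)[of j] by (auto simp: coords_def)
      then have "nrm (w i k - w j k) \<le> C * nrm (S (\<lambda>k. w i k - w j k))"
        using C(2) that by blast
      also have "S (\<lambda>k. w i k - w j k) = (e d + S (w i)) - (e d + S (w j))"
        by (simp add: S_diff)
      also have "nrm \<dots> \<le> max (inverse (real (Suc i))) (inverse (real (Suc j)))"
        using nrm_diff[of "e d + S (w i)" "e d + S (w j)"] w(2)[of i] w(2)[of j] by linarith
      finally show ?thesis using C(1) by simp
    qed
    have "\<exists>l\<in>E. (\<lambda>n. nrm (w n k - l)) \<longlonglongrightarrow> 0" if k: "k < d" for k
    proof -
      have "\<exists>N. \<forall>i\<ge>N. \<forall>j\<ge>N. nrm (w i k - w j k) < r" if "0 < r" for r
      proof -
        have "0 < r / C" using that C(1) by simp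
        then obtain N where N: "inverse (real (Suc N)) < r / C"
          using reals_Archimedean[of "r / C"] by blast
        have "nrm (w i k - w j k) < r" if "i \<ge> N" "j \<ge> N" for i j
        proof -
          have "inverse (real (Suc i)) \<le> inverse (real (Suc N))" "inverse (real (Suc j)) \<le> inverse (real (Suc N))"
            using that by (auto intro!: le_imp_inverse_le)
          then have "max (inverse (real (Suc i))) (inverse (real (Suc j))) < r / C"
            using N by linarith
          then have "C * max (inverse (real (Suc i))) (inverse (real (Suc j))) < r"
            using C(1) by (simp only: pos_less_divide_eq mult.commute)
          then show ?thesis using wdiff[OF k, of i j] by linarith
        qed
        then show ?thesis by blast
      qed
      moreover have "\<forall>n. w n k \<in> E" using w(1) k by (auto simp: coords_def)
      ultimately show ?thesis
        using complete[unfolded complete_abs_def, rule_format, of "\<lambda>n. w n k"] by blast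
    qed
    then obtain l where l: "\<And>k. k < d \<Longrightarrow> l k \<in> E" "\<And>k. k < d \<Longrightarrow> (\<lambda>n. nrm (w n k - l k)) \<longlonglongrightarrow> 0"
      by metis
    have "nrm (e d + S l) \<le> r" if r: "0 < r" for r
    proof -
      \<comment> \<open>The summand 1 keeps \<open>M\<close> positive, so that \<open>r / M\<close>
        is a legitimate tolerance even if the sum is empty or zero.\<close>
      define M where "M = 1 + (\<Sum>k<d. nrm (e k))"
      have M0: "0 < M"
        unfolding M_def by (intro add_pos_nonneg sum_nonneg) auto
      have M: "nrm (e k) \<le> M" if "k < d" for k
      proof -
        have "nrm (e k) \<le> (\<Sum>k<d. nrm (e k))"
          using that by (intro member_le_sum) auto
        then show "nrm (e k) \<le> M" by (simp add: M_def)
      qed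
      have "\<forall>\<^sub>F n in sequentially. nrm (w n k - l k) < r / M" if "k < d" for k
        using l(2)[OF that] r M0 by (intro order_tendstoD(2)) auto
      then have "\<forall>\<^sub>F n in sequentially. \<forall>k\<in>{..<d}. nrm (w n k - l k) < r / M"
        by (intro eventually_ball_finite) auto
      moreover have "\<forall>\<^sub>F n in sequentially. inverse (real (Suc n)) < r"
        using LIMSEQ_inverse_real_of_nat r by (intro order_tendstoD(2)) auto
      ultimately have "\<forall>\<^sub>F n in sequentially. (\<forall>k\<in>{..<d}. nrm (w n k - l k) < r / M) \<and> inverse (real (Suc n)) < r"
        by eventually_elim auto
      then obtain n where n: "\<And>k. k < d \<Longrightarrow> nrm (w n k - l k) < r / M" "inverse (real (Suc n)) < r"
        by (auto simp: eventually_sequentially)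
      have "nrm (S (\<lambda>k. w n k - l k)) \<le> r"
      proof (rule S_bound)
        fix k assume k: "k < d"
        have "nrm (w n k - l k) * nrm (e k) \<le> r / M * M"
          using n(1)[OF k] M[OF k] M0 r by (intro mult_mono) auto
        then show "nrm (w n k - l k) * nrm (e k) \<le> r" using M0 by simp
      qed (use r in auto)
      moreover have eq: "e d + S l = (e d + S (w n)) - S (\<lambda>k. w n k - l k)"
        by (simp add: S_diff)
      ultimately show ?thesis
        unfolding eq using nrm_diff[of "e d + S (w n)" "S (\<lambda>k. w n k - l k)"] w(2)[of n] n(2) by linarith
    qed
    then have small: "nrm (e d + S l) \<le> r" if "0 < r" for r
      using that .
    have 0: "e d + S l = 0"
    proof (rule ccontr)
      assume "e d + S l \<noteq> 0"
      then have "0 < nrm (e d + S l)" by simp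
      with small[of "nrm (e d + S l) / 2"] show False by linarith
    qed
    \<comment> \<open>The limit produces a linear relation in which \<open>e d\<close> has
      coefficient 1, against independence.\<close>
    define a where "a k = (if k < d then l k else if k = d then 1 else 0)" for k
    have "a \<in> coords E (Suc d)" using l(1) by (auto simp: a_def coords_def)
    moreover have "(\<Sum>k<Suc d. a k * e k) = 0"
      using 0 by (simp add: a_def S_def add.commute)
    ultimately have "a d = 0" using Suc.prems by blast
    then show False by (simp add: a_def)
  qed
  then obtain \<delta> where \<delta>: "0 < \<delta>" "\<And>w. w \<in> coords E d \<Longrightarrow> \<delta> \<le> nrm (e d + S w)" by blast
  \<comment> \<open>\<open>D\<close> bounds both terms of \<open>?x - a d * e d\<close> relative to
    \<open>nrm ?x\<close>: the 1 is for \<open>?x\<close>, the quotient for the last term.\<close>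
  define D where "D = max 1 (nrm (e d) / \<delta>)"
  have "nrm (a k) \<le> max (C * D) (1 / \<delta>) * nrm (\<Sum>k<Suc d. a k * e k)"
    if a: "a \<in> coords E (Suc d)" and k: "k < Suc d" for a k
  proof -
    let ?a = "\<lambda>k. if k < d then a k else 0"
    let ?x = "\<Sum>k<Suc d. a k * e k"
    have aE: "a k \<in> E" for k using a by (cases "k < Suc d") (auto simp: coords_def)
    have x: "?x = S ?a + a d * e d" by (simp add: S_def)
    have top: "nrm (a d) \<le> 1 / \<delta> * nrm ?x"
    proof (cases "a d = 0")
      case False
      let ?w = "\<lambda>k. if k < d then a k / a d else 0"
      have "?w \<in> coords E d" using aE by (auto simp: coords_def)
      then have "\<delta> \<le> nrm (e d + S ?w)" by (rule \<delta>(2))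
      moreover have "?x = a d * (e d + S ?w)"
        using False unfolding x S_def by (simp add: distrib_left sum_distrib_left)
      ultimately have "nrm (a d) * \<delta> \<le> nrm ?x"
        using mult_left_mono[of \<delta> "nrm (e d + S ?w)" "nrm (a d)"] by (simp only: nrm_mult nrm_nonneg)
      then show ?thesis using \<delta>(1) by (simp add: field_simps)
    qed (use \<delta>(1) in simp)
    have "nrm (a k) \<le> C * D * nrm ?x" if "k < d"
    proof -
      have "nrm (a d * e d) \<le> D * nrm ?x"
      proof -
        have "nrm (a d * e d) \<le> 1 / \<delta> * nrm ?x * nrm (e d)"
          unfolding nrm_mult using top by (rule mult_right_mono) simp
        also have "\<dots> = nrm (e d) / \<delta> * nrm ?x" by simp
        also have "\<dots> \<le> D * nrm ?x" unfolding D_def by (intro mult_right_mono) auto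
        finally show ?thesis .
      qed
      moreover have "nrm ?x \<le> D * nrm ?x"
        using mult_right_mono[of 1 D "nrm ?x"] unfolding D_def by simp
      moreover have eq: "S ?a = ?x - a d * e d"
        using x by simp
      ultimately have "nrm (S ?a) \<le> D * nrm ?x"
        unfolding eq using nrm_diff[of ?x "a d * e d"] by linarith
      then have "C * nrm (S ?a) \<le> C * (D * nrm ?x)" using C(1) by (intro mult_left_mono) auto
      moreover have "?a \<in> coords E d" using aE by (auto simp: coords_def)
      ultimately show ?thesis using C(2)[of ?a k] that by simp
    qed
    then have "nrm (a k) \<le> C * D * nrm ?x \<or> nrm (a k) \<le> 1 / \<delta> * nrm ?x"
      using top k by (cases "k = d") auto
    moreover have "C * D * nrm ?x \<le> max (C * D) (1 / \<delta>) * nrm ?x"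
      by (intro mult_right_mono max.cobounded1 nrm_nonneg)
    moreover have "1 / \<delta> * nrm ?x \<le> max (C * D) (1 / \<delta>) * nrm ?x"
      by (intro mult_right_mono max.cobounded2 nrm_nonneg)
    ultimately show ?thesis by linarith
  qed
  moreover have "0 < max (C * D) (1 / \<delta>)" using \<delta>(1) by (simp add: less_max_iff_disj)
  ultimately show ?case by blast
qed

end


section \<open>Lattices over a discrete valuation ring\<close>

definition linear_coords :: "'k::field set \<Rightarrow> nat \<Rightarrow> ((nat \<Rightarrow> 'k) \<Rightarrow> nat \<Rightarrow> 'k) \<Rightarrow> bool"
  where "linear_coords E n h \<longleftrightarrow>
    (\<forall>a\<in>coords E n. \<forall>b\<in>coords E n. h (\<lambda>k. a k + b k) = (\<lambda>i. h a i + h b i)) \<and>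
    (\<forall>r\<in>E. \<forall>a\<in>coords E n. h (\<lambda>k. r * a k) = (\<lambda>i. r * h a i))"

lemma linear_coords_comp:
  assumes "linear_coords E n g" and "linear_coords E n h" and "g ` coords E n \<subseteq> coords E n"
  shows "linear_coords E n (\<lambda>a. h (g a))"
proof -
  have g: "g a \<in> coords E n" if "a \<in> coords E n" for a
    using assms(3) that by blast
  show ?thesis
    using assms(1,2) g unfolding linear_coords_def by auto
qed

context complete_subfield
begin

lemma coords_add: "a \<in> coords E n \<Longrightarrow> b \<in> coords E n \<Longrightarrow> (\<lambda>k. a k + b k) \<in> coords E n"
  and coords_diff: "a \<in> coords E n \<Longrightarrow> b \<in> coords E n \<Longrightarrow> (\<lambda>k. a k - b k) \<in> coords E n"
  and coords_smult: "r \<in> E \<Longrightarrow> a \<in> coords E n \<Longrightarrow> (\<lambda>k. r * a k) \<in> coords E n"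
  and coords_sub: "coords R n \<subseteq> coords E n"
  using R_subset by (auto simp: coords_def)

text \<open>The basis \<open>b\<close> is triangular (a Hermite form): \<open>b k\<close> is an element of \<open>L\<close> supported in \<open>{..k}\<close>
  with \<open>k\<close>-th coordinate of maximal absolute value.\<close>

lemma lattice_has_basis:
  fixes L :: "(nat \<Rightarrow> 'k) set"
  assumes LE: "L \<subseteq> coords E n"
    and diff: "\<And>x y. x \<in> L \<Longrightarrow> y \<in> L \<Longrightarrow> (\<lambda>i. x i - y i) \<in> L"
    and add: "\<And>x y. x \<in> L \<Longrightarrow> y \<in> L \<Longrightarrow> (\<lambda>i. x i + y i) \<in> L"
    and smult: "\<And>r x. r \<in> R \<Longrightarrow> x \<in> L \<Longrightarrow> (\<lambda>i. r * x i) \<in> L"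
    and s: "s \<in> E" "s \<noteq> 0" "\<And>a. a \<in> coords R n \<Longrightarrow> (\<lambda>k. s * a k) \<in> L"
    and B: "\<And>x k. x \<in> L \<Longrightarrow> k < n \<Longrightarrow> nrm (x k) \<le> B"
  shows "\<exists>g. bij_betw g (coords E n) (coords E n) \<and> g ` coords R n = L \<and> linear_coords E n g"
proof -
  have "\<exists>v. k < n \<longrightarrow> v \<in> L \<and> (\<forall>i>k. v i = 0) \<and> v k \<noteq> 0 \<and>
      (\<forall>x\<in>L. (\<forall>i>k. x i = 0) \<longrightarrow> nrm (x k) \<le> nrm (v k))" for k
  proof (cases "k < n")
    case k: True
    let ?T = "(\<lambda>x. x k) ` {x \<in> L. \<forall>i>k. x i = 0}"
    \<comment> \<open>A scaled unit vector in \<open>L\<close> shows that the \<open>k\<close>-th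
      coordinates to be maximized are not all zero.\<close>
    have "unit_coords k \<in> coords R n"
      using k by (auto simp: coords_def unit_coords_def)
    then have u: "(\<lambda>i. s * unit_coords k i) \<in> L"
      by (rule s(3))
    have "\<exists>v\<in>?T. v \<noteq> 0 \<and> (\<forall>x\<in>?T. nrm x \<le> nrm v)"
    proof (rule attains_max)
      show "?T \<subseteq> E"
        using LE k by (auto simp: coords_def)
      show "(\<lambda>i. s * unit_coords k i) k \<in> ?T"
        using u by (intro imageI) (auto simp: unit_coords_def)
      show "(\<lambda>i. s * unit_coords k i) k \<noteq> 0"
        using s(2) by (simp add: unit_coords_def)
      show "nrm x \<le> B" if "x \<in> ?T" for x
        using that B k by auto
    qed
    then show ?thesis by auto
  qed auto
  from choice[OF allI, OF this] obtain b where b': "\<forall>k. k < n \<longrightarrow> b k \<in> L \<and>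
      (\<forall>i>k. b k i = 0) \<and> b k k \<noteq> 0 \<and> (\<forall>x\<in>L. (\<forall>i>k. x i = 0) \<longrightarrow> nrm (x k) \<le> nrm (b k k))"
    by (rule exE)
  have b: "b k \<in> L" "k < i \<Longrightarrow> b k i = 0" "b k k \<noteq> 0"
      "x \<in> L \<Longrightarrow> (\<And>i. k < i \<Longrightarrow> x i = 0) \<Longrightarrow> nrm (x k) \<le> nrm (b k k)" if "k < n" for k i x
    using b'[rule_format, OF that] by auto
  have bE: "b k \<in> coords E n" if "k < n" for k
    using b(1)[OF that] LE by blast
  define g where "g a = (\<lambda>i. \<Sum>k<n. a k * b k i)" for a
  \<comment> \<open>Elimination from the top coordinate downwards. If \<open>x\<close> lies in
    \<open>L\<close>, maximality of \<open>b j j\<close> makes the multiplier \<alpha> integral, so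
    the remainder stays in \<open>L\<close> and all coefficients end up in \<open>R\<close>.\<close>
  have expand: "\<exists>a\<in>coords E j. x = (\<lambda>i. \<Sum>k<j. a k * b k i) \<and> (x \<in> L \<longrightarrow> a \<in> coords R j)"
    if "j \<le> n" "x \<in> coords E n" "\<And>i. j \<le> i \<Longrightarrow> x i = 0" for j x
    using that
  proof (induction j arbitrary: x)
    case 0
    then show ?case
      by (intro bexI[of _ "\<lambda>_. 0"]) (auto simp: coords_def)
  next
    case (Suc j)
    define \<alpha> where "\<alpha> = x j / b j j"
    let ?x = "\<lambda>i. x i - \<alpha> * b j i"
    have j: "j < n" using Suc.prems by simp
    have \<alpha>: "\<alpha> \<in> E"
      using Suc.prems(2) bE[OF j] j by (auto simp: \<alpha>_def coords_def)
    have x'E: "?x \<in> coords E n"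
      using Suc.prems(2) bE[OF j] \<alpha> by (intro coords_diff coords_smult)
    have x'0: "?x i = 0" if "j \<le> i" for i
      using that Suc.prems(3)[of i] b(2)[OF j, of i] b(3)[OF j]
      by (cases "i = j") (auto simp: \<alpha>_def)
    have "j \<le> n" using j by simp
    from Suc.IH[OF this x'E x'0] obtain a where a: "a \<in> coords E j"
      "?x = (\<lambda>i. \<Sum>k<j. a k * b k i)" "?x \<in> L \<longrightarrow> a \<in> coords R j"
      by blast
    let ?a = "a(j := \<alpha>)"
    have "x \<in> L \<longrightarrow> ?a \<in> coords R (Suc j)"
    proof
      assume x: "x \<in> L"
      have "nrm (x j) \<le> nrm (b j j)"
        using b(4)[OF j x] Suc.prems(3) by auto
      then have "\<alpha> \<in> R"
        using \<alpha> b(3)[OF j] by (simp add: val_ring_def \<alpha>_def nrm_divide)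
      then have "a \<in> coords R j"
        using a(3) x b(1)[OF j] diff smult by blast
      then show "?a \<in> coords R (Suc j)"
        using \<open>\<alpha> \<in> R\<close> by (auto simp: coords_def)
    qed
    moreover have "x = (\<lambda>i. \<Sum>k<Suc j. ?a k * b k i)"
    proof
      fix i
      show "x i = (\<Sum>k<Suc j. ?a k * b k i)"
        using fun_cong[OF a(2), of i] by (simp add: diff_eq_eq)
    qed
    moreover have "?a \<in> coords E (Suc j)"
      using a(1) \<alpha> by (auto simp: coords_def)
    ultimately show ?case by blast
  qed
  have gE: "g a \<in> coords E n" if "a \<in> coords E n" for a
  proof -
    have "(\<lambda>i. \<Sum>k<j. a k * b k i) \<in> coords E n" if "j \<le> n" for j
      using that
    proof (induction j)
      case (Suc j)
      have "a j \<in> E"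
        using Suc.prems \<open>a \<in> coords E n\<close> by (auto simp: coords_def)
      then have "(\<lambda>i. (\<Sum>k<j. a k * b k i) + a j * b j i) \<in> coords E n"
        using Suc bE[of j] by (intro coords_add coords_smult) auto
      then show ?case by simp
    qed (auto simp: coords_def)
    then show ?thesis by (simp add: g_def)
  qed
  have gL: "g a \<in> L" if "a \<in> coords R n" for a
  proof -
    have 0: "(\<lambda>i. 0) \<in> L"
      using s(3)[of "\<lambda>_. 0"] by (auto simp: coords_def)
    have "(\<lambda>i. \<Sum>k<j. a k * b k i) \<in> L" if "j \<le> n" for j
      using that
    proof (induction j)
      case (Suc j)
      have "a j \<in> R"
        using Suc.prems \<open>a \<in> coords R n\<close> by (auto simp: coords_def)
      then have "(\<lambda>i. (\<Sum>k<j. a k * b k i) + a j * b j i) \<in> L"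
        using Suc b(1)[of j] by (intro add smult) auto
      then show ?case by simp
    qed (use 0 in simp)
    then show ?thesis by (simp add: g_def)
  qed
  have surj: "\<exists>a\<in>coords E n. x = g a \<and> (x \<in> L \<longrightarrow> a \<in> coords R n)" if "x \<in> coords E n" for x
    using expand[of n x] that by (auto simp: g_def coords_def)
  have zero: "a = (\<lambda>_. 0)" if a: "a \<in> coords E n" and ga: "g a = (\<lambda>_. 0)" for a
  proof (rule ccontr)
    assume "a \<noteq> (\<lambda>_. 0)"
    then obtain k0 where "a k0 \<noteq> 0" by auto
    moreover from this have "k0 < n" using a by (auto simp: coords_def not_le[symmetric])
    ultimately have ne: "{k. k < n \<and> a k \<noteq> 0} \<noteq> {}" by blast
    \<comment> \<open>At the largest index with a nonzero coefficient, triangularity leaves the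
      single term \<open>a k * b k k\<close> in coordinate \<open>k\<close>.\<close>
    define k where "k = Max {k. k < n \<and> a k \<noteq> 0}"
    have "k \<in> {k. k < n \<and> a k \<noteq> 0}"
      unfolding k_def using ne by (intro Max_in) auto
    then have k: "k < n" "a k \<noteq> 0" by auto
    have "a l = 0" if "k < l" for l
    proof (rule ccontr)
      assume "a l \<noteq> 0"
      moreover from this have "l < n" using a by (auto simp: coords_def not_le[symmetric])
      ultimately have "l \<le> k" unfolding k_def by (intro Max_ge) auto
      then show False using that by simp
    qed
    then have "a l * b l k = 0" if "l < n" "l \<noteq> k" for l
      using that b(2)[of l k] by (cases "l < k") auto
    then have "g a k = a k * b k k"
      unfolding g_def using k(1) sum.neutral[of "{..<n} - {k}" "\<lambda>l. a l * b l k"]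
      by (simp add: sum.remove[of _ k])
    then show False
      using k b(3) fun_cong[OF ga, of k] by simp
  qed
  have lin: "linear_coords E n g"
    by (auto simp: linear_coords_def g_def fun_eq_iff algebra_simps sum.distrib sum_distrib_left)
  have "inj_on g (coords E n)"
  proof (rule inj_onI)
    fix x y assume xy: "x \<in> coords E n" "y \<in> coords E n" "g x = g y"
    have "g (\<lambda>k. x k - y k) = (\<lambda>i. g x i - g y i)"
      by (auto simp: g_def fun_eq_iff algebra_simps sum_subtractf)
    then have "(\<lambda>k. x k - y k) = (\<lambda>_. 0)"
      using zero[of "\<lambda>k. x k - y k"] coords_diff[OF xy(1,2)] xy(3) by simp
    then have "x k - y k = 0" for k
      by (rule fun_cong)
    then show "x = y" by auto
  qed
  moreover have "g ` coords E n = coords E n"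
  proof (intro equalityI subsetI)
    fix x assume "x \<in> coords E n"
    then show "x \<in> g ` coords E n" using surj[of x] by blast
  qed (use gE in auto)
  ultimately have "bij_betw g (coords E n) (coords E n)"
    by (simp add: bij_betw_def)
  moreover have "g ` coords R n = L"
  proof (intro equalityI subsetI)
    fix x assume "x \<in> L"
    moreover have "x \<in> coords E n" using LE \<open>x \<in> L\<close> by blast
    ultimately show "x \<in> g ` coords R n" using surj[of x] by blast
  qed (use gL in auto)
  ultimately show ?thesis using lin by blast
qed

end

section \<open>Bases of K over a complete subfield\<close>

lemma combine_class_ring:
  fixes Us :: "'k::field list"
  assumes "length Ks = length Us"
  shows "ring.combine class_ring Ks Us = (\<Sum>k<length Us. Ks ! k * Us ! k)"
  using assms
proof (induction Ks Us rule: list_induct2)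
  case (Cons x xs y ys)
  then show ?case
    by (simp add: ring.combine.simps[OF ring_class_ring] sum.lessThan_Suc_shift del: sum.lessThan_Suc)
qed (simp add: ring.combine.simps[OF ring_class_ring])

text \<open>Bridge from the list-based bases behind \<open>ring.dimension\<close> to coordinate
  functions.\<close>

lemma dimension_coords:
  fixes E :: "'k::field set"
  assumes E: "subfield E class_ring" and dim: "ring.dimension class_ring d E UNIV"
  shows "\<exists>e. bij_betw (\<lambda>a. \<Sum>k<d. a k * e k) (coords E d) UNIV"
proof -
  note r = ring_class_ring[where 'k = 'k]
  obtain Us :: "'k list" where Us: "ring.independent class_ring E Us" "length Us = d" "ring.Span class_ring E Us = UNIV"
    using ring.exists_base[OF r E dim] by blast
  let ?h = "\<lambda>a. \<Sum>k<d. a k * Us ! k"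
  have E0: "0 \<in> E"
    using subringD(1)[OF subfieldE(1)[OF E]] .
  have trivial: "a = (\<lambda>_. 0)" if a: "a \<in> coords E d" "?h a = 0" for a
  proof -
    have "ring.combine class_ring (map a [0..<d]) Us = 0"
      using a(2) Us(2) by (subst combine_class_ring) auto
    moreover have "set (map a [0..<d]) \<subseteq> E"
      using a(1) by (auto simp: coords_def)
    ultimately have "set (take (length Us) (map a [0..<d])) \<subseteq> {0}"
      using ring.independent_imp_trivial_combine[OF r E Us(1), of "map a [0..<d]"] by simp
    then have "a ` {0..<d} \<subseteq> {0}"
      using Us(2) by simp
    then have "a k = 0" for k
      using a(1) by (cases "k < d") (auto simp: coords_def image_subset_iff)
    then show ?thesis by (rule ext)
  qed
  have "inj_on ?h (coords E d)"
  proof (rule inj_onI)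
    fix x y assume xy: "x \<in> coords E d" "y \<in> coords E d" "?h x = ?h y"
    have "(\<lambda>k. x k - y k) \<in> coords E d"
      using xy(1,2) subringD(6)[OF subfieldE(1)[OF E]] by (auto simp: coords_def)
    moreover have "?h (\<lambda>k. x k - y k) = 0"
      using xy(3) by (simp add: left_diff_distrib sum_subtractf)
    ultimately have "(\<lambda>k. x k - y k) = (\<lambda>_. 0)"
      by (rule trivial)
    then have "x k - y k = 0" for k
      by (rule fun_cong)
    then show "x = y" by auto
  qed
  moreover have "x \<in> ?h ` coords E d" for x
  proof -
    have "x \<in> ring.Span class_ring E Us"
      using Us(3) by simp
    then obtain Ks where Ks: "set Ks \<subseteq> E" "length Ks = d" "x = ring.combine class_ring Ks Us"
      using ring.Span_mem_iff_length_version[OF r E, of Us x] Us(2) by auto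
    let ?a = "\<lambda>k. if k < d then Ks ! k else 0"
    have "?a \<in> coords E d"
      using Ks(1,2) by (auto simp: coords_def subset_iff)
    moreover have "x = ?h ?a"
      using Ks Us(2) combine_class_ring[of Ks Us] by simp
    ultimately show ?thesis
      using image_eqI[of x ?h ?a "coords E d"] by blast
  qed
  ultimately show ?thesis
    by (intro exI[of _ "\<lambda>k. Us ! k"]) (auto simp: bij_betw_def)
qed

context complete_subfield
begin

lemma basis_bounded:
  assumes h: "bij_betw (\<lambda>a. \<Sum>k<d. a k * e k) (coords E d) UNIV"
  obtains C where "0 < C"
    "\<And>a k. a \<in> coords E d \<Longrightarrow> k < d \<Longrightarrow> nrm (a k) \<le> C * nrm (\<Sum>k<d. a k * e k)"
proof -
  have "\<forall>k<d. a k = 0" if a: "a \<in> coords E d" "(\<Sum>k<d. a k * e k) = 0" for a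
  proof -
    have "(\<lambda>_. 0) \<in> coords E d"
      by (auto simp: coords_def)
    then have "a = (\<lambda>_. 0)"
      using h a by (auto simp: bij_betw_def intro: inj_onD)
    then show ?thesis by simp
  qed
  from coordinates_bounded[OF this] show ?thesis
    using that by blast
qed

text \<open>The coordinates of \<open>x\<close> are bounded by a multiple of \<open>nrm x\<close>,
  and the images of the basis vectors by a constant. The map of interest is a field automorphism
  over \<open>E\<close>.\<close>

lemma linear_map_bounded:
  assumes dim: "ring.dimension class_ring d E UNIV"
    and add: "\<And>x y. T (x + y) = T x + T y"
    and smult: "\<And>r x. r \<in> E \<Longrightarrow> T (r * x) = r * T x"
  shows "\<exists>C. \<forall>x. nrm (T x) \<le> C * nrm x"
proof -
  obtain e where e: "bij_betw (\<lambda>a. \<Sum>k<d. a k * e k) (coords E d) UNIV"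
    using dimension_coords[OF subfield dim] by blast
  obtain C where C: "0 < C"
    "\<And>a k. a \<in> coords E d \<Longrightarrow> k < d \<Longrightarrow> nrm (a k) \<le> C * nrm (\<Sum>k<d. a k * e k)"
    using basis_bounded[OF e] by blast
  have T0: "T 0 = 0"
    by (metis add add_cancel_right_right)
  define D where "D = (\<Sum>k<d. nrm (T (e k)))"
  have D: "0 \<le> D" "k < d \<Longrightarrow> nrm (T (e k)) \<le> D" for k
    unfolding D_def by (auto intro!: sum_nonneg member_le_sum)
  have "nrm (T x) \<le> C * D * nrm x" for x
  proof -
    have "x \<in> (\<lambda>a. \<Sum>k<d. a k * e k) ` coords E d"
      using e by (simp add: bij_betw_def)
    then obtain a where a: "a \<in> coords E d" "x = (\<Sum>k<d. a k * e k)"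
      by blast
    have "T (\<Sum>k<j. a k * e k) = (\<Sum>k<j. a k * T (e k))" if "j \<le> d" for j
      using that
    proof (induction j)
      case (Suc j)
      then have "a j \<in> E" using a(1) by (auto simp: coords_def)
      then show ?case using Suc by (simp add: add smult)
    qed (simp add: T0)
    then have "T x = (\<Sum>k<d. a k * T (e k))"
      unfolding a(2) by simp
    also have "nrm \<dots> \<le> C * D * nrm x"
    proof (rule nrm_sum_le)
      fix k assume "k \<in> {..<d}"
      then have "nrm (a k) * nrm (T (e k)) \<le> (C * nrm x) * D"
        using C D a by (intro mult_mono) auto
      then show "nrm (a k * T (e k)) \<le> C * D * nrm x"
        by (simp add: nrm_mult mult_ac)
    qed (use C D in simp)
    finally show ?thesis .
  qed
  then show ?thesis by blast
qed

text \<open>The constant in the bound for \<open>T\<close> disappears when the bound is applied to the powers of \<open>x\<close>.\<close>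

lemma nrm_hom_le:
  assumes dim: "ring.dimension class_ring d E UNIV"
    and add: "\<And>x y. T (x + y) = T x + T y"
    and mult: "\<And>x y. T (x * y) = T x * T y"
    and fixes_E: "\<And>x. x \<in> E \<Longrightarrow> T x = x"
  shows "nrm (T x) \<le> nrm x"
proof (rule ccontr)
  assume less: "\<not> nrm (T x) \<le> nrm x"
  obtain C where C: "\<And>x. nrm (T x) \<le> C * nrm x"
    using linear_map_bounded[OF dim add] mult fixes_E by metis
  have T0: "T 0 = 0"
    by (metis add add_cancel_right_right)
  have x: "0 < nrm x"
    using less T0 by (cases "x = 0") auto
  have pow: "T (x ^ n) = T x ^ n" for n
    using fixes_E[of 1] by (induction n) (auto simp: mult)
  have "(nrm (T x) / nrm x) ^ n \<le> C" for n
    using C[of "x ^ n"] x by (simp add: pow nrm_power power_divide field_simps)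
  moreover have "1 < nrm (T x) / nrm x"
    using less x by (simp add: field_simps)
  ultimately show False
    using real_arch_pow[of "nrm (T x) / nrm x" C] by (meson not_le)
qed

text \<open>In coordinates with respect to any basis of \<open>K\<close> over \<open>E\<close>, the
  ring \<O>_K contains a multiple of the standard lattice and is bounded. The change of basis from
  \<open>lattice_has_basis\<close> then turns the given basis into one that is also a basis of
  \<O>_K over \<open>R\<close>.\<close>

lemma val_ring_basis:
  assumes dim: "ring.dimension class_ring d E UNIV"
  shows "\<exists>h. bij_betw h (coords E d) UNIV \<and> h ` coords R d = val_ring nrm UNIV \<and>
    (\<forall>a\<in>coords E d. \<forall>b\<in>coords E d. h (\<lambda>k. a k + b k) = h a + h b) \<and>
    (\<forall>r\<in>E. \<forall>a\<in>coords E d. h (\<lambda>k. r * a k) = r * h a)"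
proof -
  obtain e where e: "bij_betw (\<lambda>a. \<Sum>k<d. a k * e k) (coords E d) UNIV"
    using dimension_coords[OF subfield dim] by blast
  obtain C where C: "0 < C"
    "\<And>a k. a \<in> coords E d \<Longrightarrow> k < d \<Longrightarrow> nrm (a k) \<le> C * nrm (\<Sum>k<d. a k * e k)"
    using basis_bounded[OF e] by blast
  define S where "S a = (\<Sum>k<d. a k * e k)" for a
  have S_add: "S (\<lambda>k. a k + b k) = S a + S b" and S_diff: "S (\<lambda>k. a k - b k) = S a - S b"
    and S_smult: "S (\<lambda>k. r * a k) = r * S a" for a b r
    by (simp_all add: S_def distrib_right left_diff_distrib sum.distrib sum_subtractf sum_distrib_left mult.assoc)
  define L where "L = {a \<in> coords E d. S a \<in> val_ring nrm UNIV}"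
  define D where "D = 1 + (\<Sum>k<d. nrm (e k))"
  have D: "0 < D"
    unfolding D_def by (intro add_pos_nonneg sum_nonneg) auto
  have De: "nrm (e k) \<le> D" if "k < d" for k
  proof -
    have "nrm (e k) \<le> (\<Sum>k<d. nrm (e k))"
      using that by (intro member_le_sum) auto
    then show ?thesis by (simp add: D_def)
  qed
  \<comment> \<open>After scaling by \<open>\<pi> ^ N\<close>, every combination of the
    \<open>e k\<close> with integral coefficients is integral, because \<open>D\<close> bounds all
    \<open>nrm (e k)\<close>.\<close>
  obtain N where N: "nrm \<pi> ^ N < 1 / D"
    using real_arch_pow_inv[of "1 / D" "nrm \<pi>"] uniformizer D by auto
  have "\<pi> ^ n \<in> E" for n
    using uniformizer(1) by (induction n) auto
  note O_simps [simp] = subringD[OF subring_val_ring[OF ring.carrier_is_subring[OF ring_class_ring]], simplified]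
  have RO: "R \<subseteq> val_ring nrm UNIV"
    by (auto simp: val_ring_def)
  have "\<exists>g. bij_betw g (coords E d) (coords E d) \<and> g ` coords R d = L \<and> linear_coords E d g"
  proof (rule lattice_has_basis)
    show "(\<lambda>i. x i - y i) \<in> L" if "x \<in> L" "y \<in> L" for x y
      using that coords_diff by (simp add: L_def S_diff)
    show "(\<lambda>i. x i + y i) \<in> L" if "x \<in> L" "y \<in> L" for x y
      using that coords_add by (simp add: L_def S_add)
    show "(\<lambda>i. r * x i) \<in> L" if "r \<in> R" "x \<in> L" for r x
      using that coords_smult[of r x d] RO R_subset by (auto simp: L_def S_smult)
    show "\<pi> ^ N \<in> E" by fact
    show "\<pi> ^ N \<noteq> 0" using uniformizer by auto
    show "(\<lambda>k. \<pi> ^ N * a k) \<in> L" if "a \<in> coords R d" for a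
    proof -
      have "nrm (S a) \<le> D"
        unfolding S_def
      proof (rule nrm_sum_le)
        fix k assume k: "k \<in> {..<d}"
        then have "nrm (a k) \<le> 1"
          using that by (auto simp: coords_def val_ring_def)
        then have "nrm (a k) * nrm (e k) \<le> 1 * D"
          using De[of k] k by (intro mult_mono) auto
        then show "nrm (a k * e k) \<le> D"
          by (simp add: nrm_mult)
      qed (use D in simp)
      then have "nrm \<pi> ^ N * nrm (S a) \<le> 1 / D * D"
        using N D by (intro mult_mono) auto
      then have "\<pi> ^ N * S a \<in> val_ring nrm UNIV"
        using D by (simp add: val_ring_def nrm_mult nrm_power)
      moreover have "(\<lambda>k. \<pi> ^ N * a k) \<in> coords E d"
        using coords_smult[OF \<open>\<pi> ^ N \<in> E\<close>, of a d] that coords_sub by blast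
      ultimately show ?thesis
        by (simp add: L_def S_smult)
    qed
    show "nrm (x k) \<le> C" if "x \<in> L" "k < d" for x k
    proof -
      have "nrm (x k) \<le> C * nrm (S x)"
        using C(2)[of x k] that by (simp add: L_def S_def)
      also have "\<dots> \<le> C * 1"
        using that C(1) by (intro mult_left_mono) (auto simp: L_def val_ring_def)
      finally show ?thesis by simp
    qed
  qed (auto simp: L_def)
  then obtain g where g: "bij_betw g (coords E d) (coords E d)" "g ` coords R d = L" "linear_coords E d g"
    by blast
  have gE: "g a \<in> coords E d" if "a \<in> coords E d" for a
    using g(1) that by (auto simp: bij_betw_def)
  have "bij_betw (\<lambda>a. S (g a)) (coords E d) UNIV"
    using bij_betw_trans[OF g(1), of S UNIV] e by (simp add: S_def[abs_def] comp_def)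
  moreover have "(\<lambda>a. S (g a)) ` coords R d = val_ring nrm UNIV"
  proof -
    have "(\<lambda>a. S (g a)) ` coords R d = S ` L"
      by (simp add: g(2)[symmetric] image_image)
    also have "\<dots> = val_ring nrm UNIV"
    proof (intro equalityI subsetI)
      fix x assume x: "x \<in> val_ring nrm UNIV"
      have "x \<in> S ` coords E d"
        using e by (simp add: S_def[abs_def] bij_betw_def)
      then show "x \<in> S ` L"
        using x by (auto simp: L_def)
    qed (auto simp: L_def)
    finally show ?thesis .
  qed
  moreover have "S (g (\<lambda>k. a k + b k)) = S (g a) + S (g b)" if "a \<in> coords E d" "b \<in> coords E d" for a b
    using g(3) that S_add[of "g a" "g b"] by (simp add: linear_coords_def)
  moreover have "S (g (\<lambda>k. r * a k)) = r * S (g a)" if "r \<in> E" "a \<in> coords E d" for r a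
    using g(3) that S_smult[of r "g a"] by (simp add: linear_coords_def)
  ultimately show ?thesis by blast
qed


text \<open>The \<open>m\<close>-fold sum of \<O>_K is first identified with a standard lattice of
  rank \<open>m * d\<close>. Pulled back along this identification, \<open>L\<close> lies in that
  lattice and contains its multiple by \<open>s\<close>, so \<open>lattice_has_basis\<close> applies
  with the bound 1.\<close>

lemma order_lattice_basis:
  assumes dim: "ring.dimension class_ring d E UNIV"
    and L: "L \<subseteq> coords (val_ring nrm UNIV) m"
    and diff: "\<And>x y. x \<in> L \<Longrightarrow> y \<in> L \<Longrightarrow> (\<lambda>i. x i - y i) \<in> L"
    and add: "\<And>x y. x \<in> L \<Longrightarrow> y \<in> L \<Longrightarrow> (\<lambda>i. x i + y i) \<in> L"
    and smult: "\<And>r x. r \<in> R \<Longrightarrow> x \<in> L \<Longrightarrow> (\<lambda>i. r * x i) \<in> L"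
    and s: "s \<in> E" "s \<noteq> 0" "\<And>x. x \<in> coords (val_ring nrm UNIV) m \<Longrightarrow> (\<lambda>k. s * x k) \<in> L"
  shows "\<exists>g. bij_betw g (coords E (m * d)) (coords UNIV m) \<and> g ` coords R (m * d) = L \<and>
    linear_coords E (m * d) g"
proof -
  let ?O = "val_ring nrm UNIV" and ?n = "m * d"
  obtain h where h: "bij_betw h (coords E d) UNIV" "h ` coords R d = ?O"
    "\<And>a b. a \<in> coords E d \<Longrightarrow> b \<in> coords E d \<Longrightarrow> h (\<lambda>k. a k + b k) = h a + h b"
    "\<And>r a. r \<in> E \<Longrightarrow> a \<in> coords E d \<Longrightarrow> h (\<lambda>k. r * a k) = r * h a"
    using val_ring_basis[OF dim] by metis
  \<comment> \<open>The \<open>i\<close>-th block of length \<open>d\<close>; position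
    \<open>i * d + k\<close> is decoded again by \<open>div\<close> and \<open>mod\<close>.\<close>
  define B where "B a i = (\<lambda>k. if k < d then a (i * d + k) else 0)" for a :: "nat \<Rightarrow> 'k" and i
  define H where "H a = (\<lambda>i. if i < m then h (B a i) else 0)" for a
  have index: "i * d + k < ?n" if "i < m" "k < d" for i k
  proof -
    have "i * d + k < Suc i * d" using that by simp
    also have "\<dots> \<le> m * d" using that by (intro mult_le_mono1) simp
    finally show ?thesis .
  qed
  have B: "B a i \<in> coords X d" if "a \<in> coords X ?n" "i < m" for a i X
    using that index by (auto simp: B_def coords_def)
  have lin: "linear_coords E ?n H"
    unfolding linear_coords_def
  proof (intro conjI ballI ext)
    fix a b i assume ab: "a \<in> coords E ?n" "b \<in> coords E ?n"
    have "B (\<lambda>k. a k + b k) i = (\<lambda>k. B a i k + B b i k)"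
      by (auto simp: B_def)
    then show "H (\<lambda>k. a k + b k) i = H a i + H b i"
      using h(3)[OF B[OF ab(1)] B[OF ab(2)], of i i] by (simp add: H_def)
  next
    fix r a i assume ra: "r \<in> E" "a \<in> coords E ?n"
    have "B (\<lambda>k. r * a k) i = (\<lambda>k. r * B a i k)"
      by (auto simp: B_def)
    then show "H (\<lambda>k. r * a k) i = r * H a i"
      using h(4)[OF ra(1) B[OF ra(2)], of i] by (simp add: H_def)
  qed
  have inj: "inj_on H (coords E ?n)"
  proof (rule inj_onI)
    fix a b assume ab: "a \<in> coords E ?n" "b \<in> coords E ?n" "H a = H b"
    show "a = b"
    proof
      fix l
      show "a l = b l"
      proof (cases "l < ?n")
        case l: True
        then have i: "l div d < m" "l mod d < d"
          by (auto simp: less_mult_imp_div_less intro!: mod_less_divisor gr0I)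
        have "h (B a (l div d)) = h (B b (l div d))"
          using fun_cong[OF ab(3), of "l div d"] i by (simp add: H_def)
        then have "B a (l div d) = B b (l div d)"
          using h(1) B[OF ab(1) i(1)] B[OF ab(2) i(1)] by (auto simp: bij_betw_def dest: inj_onD)
        from fun_cong[OF this, of "l mod d"] show ?thesis
          using i(2) by (simp add: B_def)
      qed (use ab in \<open>auto simp: coords_def\<close>)
    qed
  qed
  \<comment> \<open>Stated for a pair \<open>X\<close>, \<open>Y\<close> because it is used twice:
    for \<open>E\<close> onto \<open>K\<close> and for \<open>R\<close> onto \<O>_K.\<close>
  have surj: "\<exists>a\<in>coords X ?n. x = H a" if x: "x \<in> coords Y m" and XY: "Y \<subseteq> h ` coords X d" for x X Y
  proof -
    have "\<exists>a. i < m \<longrightarrow> a \<in> coords X d \<and> x i = h a" for i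
    proof (cases "i < m")
      case True
      then have "x i \<in> h ` coords X d"
        using x XY by (auto simp: coords_def)
      then show ?thesis by blast
    qed simp
    then obtain a where a: "\<And>i. i < m \<Longrightarrow> a i \<in> coords X d" "\<And>i. i < m \<Longrightarrow> x i = h (a i)"
      by metis
    let ?a = "\<lambda>l. if l < ?n then a (l div d) (l mod d) else 0"
    have "?a \<in> coords X ?n"
    proof -
      have "a (l div d) (l mod d) \<in> X" if "l < ?n" for l
      proof -
        have i: "l div d < m" "l mod d < d"
          using that by (auto simp: less_mult_imp_div_less intro!: mod_less_divisor gr0I)
        then show ?thesis using a(1)[OF i(1)] by (auto simp: coords_def)
      qed
      then show ?thesis by (auto simp: coords_def)
    qed
    moreover have "x i = H ?a i" for i
    proof (cases "i < m")
      case True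
      then have "B ?a i = a i"
        using a(1)[OF True] index[OF True] by (auto simp: B_def coords_def fun_eq_iff)
      then show ?thesis using True a(2) by (simp add: H_def)
    qed (use x in \<open>auto simp: H_def coords_def\<close>)
    ultimately show ?thesis by (intro bexI[of _ ?a]) auto
  qed
  have HR: "H ` coords R ?n = coords ?O m"
  proof (intro equalityI subsetI)
    fix x assume "x \<in> H ` coords R ?n"
    then show "x \<in> coords ?O m"
      using B[of _ R] h(2) by (auto simp: H_def coords_def)
  next
    fix x assume "x \<in> coords ?O m"
    then show "x \<in> H ` coords R ?n"
      using surj[of x ?O R] h(2) by blast
  qed
  have HE: "H ` coords E ?n = coords UNIV m"
  proof (intro equalityI subsetI)
    fix x assume "x \<in> coords (UNIV :: 'k set) m"
    then show "x \<in> H ` coords E ?n"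
      using surj[of x UNIV E] h(1) by (auto simp: bij_betw_def)
  qed (auto simp: H_def coords_def)
  define L' where "L' = {a \<in> coords E ?n. H a \<in> L}"
  have L'R: "L' \<subseteq> coords R ?n"
  proof
    fix a assume a: "a \<in> L'"
    then have "H a \<in> H ` coords R ?n"
      using L HR by (auto simp: L'_def)
    then obtain b where "b \<in> coords R ?n" "H a = H b"
      by blast
    moreover from this have "a = b"
      using inj a coords_sub by (auto simp: L'_def dest!: inj_onD)
    ultimately show "a \<in> coords R ?n" by simp
  qed
  have H_add: "H (\<lambda>k. a k + b k) = (\<lambda>i. H a i + H b i)" if "a \<in> coords E ?n" "b \<in> coords E ?n" for a b
    by (rule lin[unfolded linear_coords_def, THEN conjunct1, rule_format, OF that])
  have H_smult: "H (\<lambda>k. r * a k) = (\<lambda>i. r * H a i)" if "r \<in> E" "a \<in> coords E ?n" for a r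
    by (rule lin[unfolded linear_coords_def, THEN conjunct2, rule_format, OF that])
  have H_diff: "H (\<lambda>k. a k - b k) = (\<lambda>i. H a i - H b i)" if ab: "a \<in> coords E ?n" "b \<in> coords E ?n" for a b
    using H_add[OF coords_diff[OF ab] ab(2)] by simp
  have "\<exists>g. bij_betw g (coords E ?n) (coords E ?n) \<and> g ` coords R ?n = L' \<and> linear_coords E ?n g"
  proof (rule lattice_has_basis)
    show "(\<lambda>i. x i - y i) \<in> L'" if "x \<in> L'" "y \<in> L'" for x y
      using that coords_diff H_diff diff by (simp add: L'_def)
    show "(\<lambda>i. x i + y i) \<in> L'" if "x \<in> L'" "y \<in> L'" for x y
      using that coords_add H_add add by (simp add: L'_def)
    show "(\<lambda>i. r * x i) \<in> L'" if "r \<in> R" "x \<in> L'" for r x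
      using that coords_smult[of r x ?n] H_smult[of r x] smult R_subset by (auto simp: L'_def)
    show "(\<lambda>k. s * a k) \<in> L'" if "a \<in> coords R ?n" for a
    proof -
      have a: "a \<in> coords E ?n" and "H a \<in> coords ?O m"
        using that coords_sub HR by auto
      then show ?thesis
        using s coords_smult[OF s(1) a] H_smult[OF s(1) a] by (simp add: L'_def)
    qed
    show "nrm (x k) \<le> 1" if "x \<in> L'" "k < ?n" for x k
      using that L'R by (auto simp: coords_def val_ring_def)
  qed (use s in \<open>auto simp: L'_def\<close>)
  then obtain g where g: "bij_betw g (coords E ?n) (coords E ?n)" "g ` coords R ?n = L'" "linear_coords E ?n g"
    by blast
  have "bij_betw (\<lambda>a. H (g a)) (coords E ?n) (coords UNIV m)"
    using bij_betw_trans[OF g(1), of H "coords UNIV m"] inj HE by (simp add: bij_betw_def comp_def)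
  moreover have "(\<lambda>a. H (g a)) ` coords R ?n = L"
  proof -
    have "(\<lambda>a. H (g a)) ` coords R ?n = H ` L'"
      by (simp add: g(2)[symmetric] image_image)
    also have "\<dots> = L"
    proof (intro equalityI subsetI)
      fix x assume x: "x \<in> L"
      then obtain a where "a \<in> coords R ?n" "x = H a"
        using L HR by blast
      then show "x \<in> H ` L'"
        using x coords_sub by (auto simp: L'_def)
    qed (auto simp: L'_def)
    finally show ?thesis .
  qed
  moreover have "linear_coords E ?n (\<lambda>a. H (g a))"
    by (rule linear_coords_comp[OF g(3) lin]) (simp add: bij_betw_imp_surj_on[OF g(1)])
  ultimately show ?thesis by (intro exI conjI)
qed

end


section \<open>The Galois group\<close>

text \<open>Zero rows pad the system to a square matrix. Row \<open>r\<close> is one of them, so the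
  transpose kills \<open>unit_vec n r\<close>; the determinant vanishes and a kernel vector
  exists.\<close>

lemma underdetermined_system_solvable:
  fixes A :: "nat \<Rightarrow> nat \<Rightarrow> 'k::field"
  assumes "r < n"
  shows "\<exists>y. (\<exists>j<n. y j \<noteq> 0) \<and> (\<forall>i<r. (\<Sum>j<n. A i j * y j) = 0)"
proof -
  define M where "M = mat n n (\<lambda>(i, j). if i < r then A i j else 0)"
  have M: "M \<in> carrier_mat n n"
    by (simp add: M_def)
  have "transpose_mat M *\<^sub>v unit_vec n r = 0\<^sub>v n"
  proof (rule eq_vecI)
    fix i assume i: "i < dim_vec (0\<^sub>v n :: 'k vec)"
    then have "(transpose_mat M *\<^sub>v unit_vec n r) $ i = col M i \<bullet> unit_vec n r"
      using M by simp
    also have "\<dots> = M $$ (r, i)"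
      using assms i M by simp
    finally show "(transpose_mat M *\<^sub>v unit_vec n r) $ i = 0\<^sub>v n $ i"
      using assms i by (simp add: M_def)
  qed (use M in auto)
  moreover have "unit_vec n r \<noteq> (0\<^sub>v n :: 'k vec)"
    using assms by (metis index_unit_vec(1) index_zero_vec(1) zero_neq_one)
  ultimately have "det (transpose_mat M) = 0"
    using det_0_iff_vec_prod_zero_field[of "transpose_mat M" n] M unit_vec_carrier
    by (metis transpose_carrier_mat)
  then have "det M = 0"
    using det_transpose[OF M] by simp
  then obtain v where v: "v \<in> carrier_vec n" "v \<noteq> 0\<^sub>v n" "M *\<^sub>v v = 0\<^sub>v n"
    using det_0_iff_vec_prod_zero_field[OF M] by auto
  have "\<exists>j<n. v $ j \<noteq> 0"
  proof (rule ccontr)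
    assume "\<not> ?thesis"
    then have "v = 0\<^sub>v n" using v(1) by (intro eq_vecI) auto
    then show False using v(2) by simp
  qed
  moreover have "(\<Sum>j<n. A i j * v $ j) = 0" if "i < r" for i
  proof -
    have "(M *\<^sub>v v) $ i = (\<Sum>j<n. A i j * v $ j)"
      using assms that M v(1) by (simp add: scalar_prod_def M_def atLeast0LessThan)
    then show ?thesis
      using v(3) assms that by simp
  qed
  ultimately show ?thesis by blast
qed

text \<open>Dedekind's independence of characters. Subtracting \<open>f k z\<close> times the
  relation at \<open>x\<close> from the relation at \<open>z * x\<close> removes \<open>f k\<close>,
  and \<open>z\<close> is chosen such that the coefficient of \<open>f j\<close> is multiplied by a
  nonzero factor.\<close>

lemma characters_independent:
  fixes f :: "'i \<Rightarrow> 'k::field \<Rightarrow> 'k"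
  assumes "finite I" and "inj_on f I"
    and mult: "\<And>i x y. f i (x * y) = f i x * f i y" and one: "\<And>i. f i 1 = 1"
    and "\<And>x. (\<Sum>i\<in>I. y i * f i x) = 0"
  shows "\<forall>i\<in>I. y i = 0"
  using assms(1,2,5)
proof (induction I arbitrary: y rule: finite_induct)
  case (insert k I)
  have y0: "y j = 0" if j: "j \<in> I" for j
  proof -
    have "f k \<noteq> f j"
      using insert.hyps insert.prems(1) j by (auto simp: inj_on_def)
    then obtain z where z: "f k z \<noteq> f j z" by blast
    have "(\<Sum>i\<in>I. (y i * (f i z - f k z)) * f i x) = 0" for x
    proof -
      have "(\<Sum>i\<in>insert k I. y i * f i (z * x)) - f k z * (\<Sum>i\<in>insert k I. y i * f i x) = 0"
        using insert.prems(2) by simp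
      moreover have "(\<Sum>i\<in>insert k I. y i * f i (z * x)) - f k z * (\<Sum>i\<in>insert k I. y i * f i x)
          = (\<Sum>i\<in>I. y i * f i (z * x)) - f k z * (\<Sum>i\<in>I. y i * f i x)"
        using insert.hyps by (simp add: mult algebra_simps)
      moreover have "\<dots> = (\<Sum>i\<in>I. (y i * (f i z - f k z)) * f i x)"
        by (simp add: sum_distrib_left mult algebra_simps sum_subtractf)
      ultimately show ?thesis by simp
    qed
    then have "\<forall>i\<in>I. y i * (f i z - f k z) = 0"
      using insert.prems(1) by (intro insert.IH) auto
    then show ?thesis using j z by auto
  qed
  have "(\<Sum>i\<in>I. y i * f i 1) = 0"
    using y0 by (intro sum.neutral) auto
  then have "y k = 0"
    using insert.prems(2)[of 1] insert.hyps one by simp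
  then show ?case using y0 by auto
qed simp

lemma group_gal_group: "group (gal_group F)"
proof (rule groupI)
  show "\<exists>y\<in>carrier (gal_group F). y \<otimes>\<^bsub>gal_group F\<^esub> x = \<one>\<^bsub>gal_group F\<^esub>"
    if "x \<in> carrier (gal_group F)" for x
  proof -
    have x: "x \<in> ring_iso class_ring class_ring" "\<And>a. a \<in> F \<Longrightarrow> x a = a"
      using that by (auto simp: gal_group_def)
    then have bij: "bij x" by (auto simp: ring_iso_def bij_betw_def)
    let ?y = "inv_into UNIV x"
    have "?y \<in> ring_iso class_ring class_ring"
      using ring_iso_set_sym[OF ring_class_ring x(1)] by simp
    moreover have "?y a = a" if "a \<in> F" for a
      using x(2)[OF that] bij by (metis bij_inv_eq_iff)
    ultimately have "?y \<in> carrier (gal_group F)"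
      by (simp add: gal_group_def)
    moreover have "?y \<circ> x = id"
      using bij by (simp add: bij_is_inj)
    ultimately show ?thesis
      by (intro bexI[of _ ?y]) (simp_all add: gal_group_def)
  qed
  show "x \<otimes>\<^bsub>gal_group F\<^esub> y \<in> carrier (gal_group F)"
    if "x \<in> carrier (gal_group F)" "y \<in> carrier (gal_group F)" for x y
    using that ring_iso_set_trans[of y class_ring class_ring x class_ring]
    by (simp add: gal_group_def)
  show "\<one>\<^bsub>gal_group F\<^esub> \<in> carrier (gal_group F)"
    using ring_iso_set_refl[of class_ring] by (simp add: gal_group_def id_def)
qed (simp_all add: gal_group_def comp_assoc)

locale cyclic_extension =
  fixes F :: "'k::field set" and m :: nat and \<sigma> :: "'k \<Rightarrow> 'k"
  assumes cyclic: "cyclic_galois F m \<sigma>"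
begin

lemma subfield_F: "subfield F class_ring"
  and dimension_F: "ring.dimension class_ring m F UNIV"
  using cyclic by (auto simp: cyclic_galois_def)

lemma \<sigma>_add [simp]: "\<sigma> (x + y) = \<sigma> x + \<sigma> y"
  and \<sigma>_mult [simp]: "\<sigma> (x * y) = \<sigma> x * \<sigma> y"
  and \<sigma>_one [simp]: "\<sigma> 1 = 1"
  and \<sigma>_fixes: "x \<in> F \<Longrightarrow> \<sigma> x = x"
  and \<sigma>_bij: "bij \<sigma>"
proof -
  have iso: "\<sigma> \<in> ring_iso class_ring class_ring" and fixes_F: "\<forall>x\<in>F. \<sigma> x = x"
    using cyclic by (auto simp: cyclic_galois_def gal_group_def)
  have hom: "\<sigma> \<in> Ring.ring_hom class_ring class_ring" and bij: "bij \<sigma>"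
    using iso by (auto simp: ring_iso_def)
  show "\<sigma> (x + y) = \<sigma> x + \<sigma> y" "\<sigma> (x * y) = \<sigma> x * \<sigma> y" "\<sigma> 1 = 1" "bij \<sigma>"
    "x \<in> F \<Longrightarrow> \<sigma> x = x"
    using ring_hom_add[OF hom] ring_hom_mult[OF hom] ring_hom_one[OF hom] bij fixes_F by auto
qed

lemma \<sigma>_zero [simp]: "\<sigma> 0 = 0"
  by (metis \<sigma>_add add_cancel_right_right)

lemma \<sigma>_uminus [simp]: "\<sigma> (- x) = - \<sigma> x"
  using \<sigma>_add[of x "- x"] by (simp add: eq_neg_iff_add_eq_0 add.commute)

lemma \<sigma>_diff [simp]: "\<sigma> (x - y) = \<sigma> x - \<sigma> y"
  using \<sigma>_add[of x "- y"] by simp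

lemma \<sigma>_sum: "\<sigma> (sum f I) = (\<Sum>i\<in>I. \<sigma> (f i))"
  by (induction I rule: infinite_finite_induct) auto

lemma \<sigma>_pow_add [simp]: "(\<sigma> ^^ n) (x + y) = (\<sigma> ^^ n) x + (\<sigma> ^^ n) y"
  and \<sigma>_pow_mult [simp]: "(\<sigma> ^^ n) (x * y) = (\<sigma> ^^ n) x * (\<sigma> ^^ n) y"
  and \<sigma>_pow_one [simp]: "(\<sigma> ^^ n) 1 = 1"
  and \<sigma>_pow_zero [simp]: "(\<sigma> ^^ n) 0 = 0"
  and \<sigma>_pow_diff [simp]: "(\<sigma> ^^ n) (x - y) = (\<sigma> ^^ n) x - (\<sigma> ^^ n) y"
  and \<sigma>_pow_fixes: "x \<in> F \<Longrightarrow> (\<sigma> ^^ n) x = x"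
  by (induction n) (auto simp: \<sigma>_fixes)

lemma \<sigma>_pow_sum: "(\<sigma> ^^ n) (sum f I) = (\<Sum>i\<in>I. (\<sigma> ^^ n) (f i))"
  by (induction n) (auto simp: \<sigma>_sum)

lemma \<sigma>_pow_bij: "bij (\<sigma> ^^ n)"
  using \<sigma>_bij by (rule bij_fn)

lemma \<sigma>_pow_eq_0 [simp]: "(\<sigma> ^^ n) x = 0 \<longleftrightarrow> x = 0"
  using \<sigma>_pow_bij[of n] \<sigma>_pow_zero[of n] by (metis bij_pointE)

text \<open>What the generator fixes is fixed by the whole Galois group, whose fixed field is
  \<open>F\<close>.\<close>

lemma fixed_field:
  assumes "\<sigma> x = x"
  shows "x \<in> F"
proof -
  interpret group "gal_group F" by (rule group_gal_group)
  have \<sigma>: "\<sigma> \<in> carrier (gal_group F)"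
    using cyclic unfolding cyclic_galois_def by (elim conjE)
  have "\<tau> x = x" if "\<tau> \<in> generate (gal_group F) {\<sigma>}" for \<tau>
    using that
  proof induction
    case (inv h)
    then have "inv\<^bsub>gal_group F\<^esub> \<sigma> \<circ> \<sigma> = id"
      using l_inv[OF \<sigma>] by (simp add: gal_group_def)
    then have "(inv\<^bsub>gal_group F\<^esub> \<sigma>) (\<sigma> x) = x"
      by (metis comp_apply id_apply)
    then show ?case using inv assms by simp
  qed (use assms in \<open>auto simp: gal_group_def\<close>)
  moreover have "carrier (gal_group F) = generate (gal_group F) {\<sigma>}"
    using cyclic unfolding cyclic_galois_def by (elim conjE)
  moreover have "{x. \<forall>\<tau>\<in>carrier (gal_group F). \<tau> x = x} = F"
    using cyclic unfolding cyclic_galois_def by (elim conjE)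
  ultimately show ?thesis
    by blast
qed

text \<open>The definition of \<open>cyclic_galois\<close> fixes the degree \<open>m\<close> but not
  the order of \<sigma>. Dedekind gives some \<open>r\<close> with \<open>0 < r \<le> m\<close> and
  \<open>\<sigma> ^^ r = id\<close>, and Artin excludes \<open>r < m\<close>.\<close>

lemma \<sigma>_order: "\<sigma> ^^ m = id" and m_pos: "0 < m"
proof -
  obtain e where e: "bij_betw (\<lambda>a. \<Sum>k<m. a k * e k) (coords F m) UNIV"
    using dimension_coords[OF subfield_F dimension_F] by blast
  have span: "\<exists>a\<in>coords F m. x = (\<Sum>k<m. a k * e k)" for x
    using e by (auto simp: bij_betw_def)
  have indep: "a = (\<lambda>_. 0)" if "a \<in> coords F m" "(\<Sum>k<m. a k * e k) = 0" for a
  proof -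
    have "(\<lambda>_. 0) \<in> coords F m"
      using subringD(1)[OF subfieldE(1)[OF subfield_F]] by (simp add: coords_def)
    then show ?thesis
      using inj_onD[OF bij_betw_imp_inj_on[OF e], of a "\<lambda>_. 0"] that by simp
  qed
  show "0 < m"
  proof (rule gr0I)
    assume "m = 0"
    then show False using span[of 1] by simp
  qed
  \<comment> \<open>By Dedekind, \<open>\<sigma>\<^sup>0, \<dots>, \<sigma>\<^sup>m\<close> cannot be pairwise distinct.\<close>
  have "\<not> inj_on (\<lambda>i. \<sigma> ^^ i) {..<Suc m}"
  proof
    assume inj: "inj_on (\<lambda>i. \<sigma> ^^ i) {..<Suc m}"
    \<comment> \<open>There are \<open>m\<close> equations, one for each basis vector, in
      \<open>m + 1\<close> unknowns. The resulting relation between the powers of \<sigma> extends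
      from the basis to \<open>K\<close> by linearity over \<open>F\<close>.\<close>
    obtain y where y: "\<exists>i<Suc m. y i \<noteq> 0" "\<And>j. j < m \<Longrightarrow> (\<Sum>i<Suc m. (\<sigma> ^^ i) (e j) * y i) = 0"
      using underdetermined_system_solvable[of m "Suc m" "\<lambda>j i. (\<sigma> ^^ i) (e j)"] by auto
    have "(\<Sum>i<Suc m. y i * (\<sigma> ^^ i) x) = 0" for x
    proof -
      obtain a where a: "a \<in> coords F m" "x = (\<Sum>k<m. a k * e k)"
        using span by blast
      have "(\<sigma> ^^ i) x = (\<Sum>k<m. a k * (\<sigma> ^^ i) (e k))" for i
        unfolding a(2) \<sigma>_pow_sum
        by (intro sum.cong) (use a(1) in \<open>auto simp: coords_def \<sigma>_pow_fixes\<close>)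
      then have "(\<Sum>i<Suc m. y i * (\<sigma> ^^ i) x) = (\<Sum>i<Suc m. \<Sum>k<m. a k * ((\<sigma> ^^ i) (e k) * y i))"
        by (simp only: sum_distrib_left mult_ac)
      also have "\<dots> = (\<Sum>k<m. a k * (\<Sum>i<Suc m. (\<sigma> ^^ i) (e k) * y i))"
        by (subst sum.swap) (simp only: sum_distrib_left)
      also have "\<dots> = 0"
        using y(2) by (intro sum.neutral) auto
      finally show ?thesis .
    qed
    then have "\<forall>i\<in>{..<Suc m}. y i = 0"
      using inj by (intro characters_independent[of _ "\<lambda>i. \<sigma> ^^ i"]) auto
    then show False using y(1) by auto
  qed
  then obtain a b where ab: "a < Suc m" "b < Suc m" "a \<noteq> b" "\<sigma> ^^ a = \<sigma> ^^ b"
    unfolding inj_on_def by blast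
  obtain i j where ij: "i < j" "j \<le> m" "\<sigma> ^^ i = \<sigma> ^^ j"
    using ab by (cases a b rule: linorder_cases) (auto intro: that)
  define r where "r = j - i"
  have r: "0 < r" "r \<le> m" "\<sigma> ^^ r = id"
  proof -
    show "\<sigma> ^^ r = id"
    proof
      fix x
      have "\<sigma> ^^ j = (\<sigma> ^^ i) \<circ> (\<sigma> ^^ r)"
        using ij(1) by (simp add: r_def flip: funpow_add)
      then have "(\<sigma> ^^ i) ((\<sigma> ^^ r) x) = (\<sigma> ^^ i) x"
        using ij(3) by (metis comp_apply)
      then show "(\<sigma> ^^ r) x = id x"
        using \<sigma>_pow_bij[of i] by (auto simp: bij_def dest: injD)
    qed
  qed (use ij in \<open>auto simp: r_def\<close>)
  \<comment> \<open>Artin's argument: a solution of minimal support, normalised, is fixed by \<open>\<sigma>\<close>.\<close>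
  have "\<not> r < m"
  proof
    assume "r < m"
    define Q where "Q y \<longleftrightarrow> (\<forall>i. (\<Sum>j<m. (\<sigma> ^^ i) (e j) * y j) = 0) \<and> (\<exists>j<m. y j \<noteq> 0)" for y
    obtain y0 where y0: "\<exists>j<m. y0 j \<noteq> 0" "\<And>i. i < r \<Longrightarrow> (\<Sum>j<m. (\<sigma> ^^ i) (e j) * y0 j) = 0"
      using underdetermined_system_solvable[OF \<open>r < m\<close>, of "\<lambda>i j. (\<sigma> ^^ i) (e j)"] by auto
    \<comment> \<open>The first \<open>r\<close> equations imply all others by periodicity, so the
      solution set is stable under \<sigma>.\<close>
    have "(\<Sum>j<m. (\<sigma> ^^ i) (e j) * y0 j) = 0" for i
    proof -
      have "(\<sigma> ^^ i) x = (\<sigma> ^^ (i mod r)) x" for x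
        using funpow_mod_eq[of r \<sigma> x i] r(3) by simp
      then show ?thesis using y0(2)[of "i mod r"] r(1) by simp
    qed
    then have "Q y0" using y0(1) by (simp add: Q_def)
    define N where "N y = card {j. j < m \<and> y j \<noteq> 0}" for y :: "nat \<Rightarrow> 'k"
    obtain y where y: "Q y" "\<And>z. Q z \<Longrightarrow> N y \<le> N z"
      using ex_has_least_nat[of Q y0 N] \<open>Q y0\<close> by blast
    obtain k where k: "k < m" "y k \<noteq> 0" using y(1) by (auto simp: Q_def)
    define z where "z j = y j / y k" for j
    have Qz: "(\<Sum>j<m. (\<sigma> ^^ i) (e j) * z j) = 0" for i
      using y(1) by (simp add: Q_def z_def flip: sum_divide_distrib)
    have Q\<sigma>: "(\<Sum>j<m. (\<sigma> ^^ i) (e j) * \<sigma> (z j)) = 0" for i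
    proof -
      \<comment> \<open>Equation \<open>i\<close> for the conjugated solution is \<sigma> applied to
        the preceding equation; adding the period \<open>r\<close> first avoids a negative index at
        \<open>i = 0\<close>.\<close>
      have step: "(\<sigma> ^^ i) x = \<sigma> ((\<sigma> ^^ (i + r - 1)) x)" for x
      proof -
        have "\<sigma> ((\<sigma> ^^ (i + r - 1)) x) = (\<sigma> ^^ Suc (i + r - 1)) x" by simp
        also have "\<dots> = (\<sigma> ^^ (i + r)) x" using r(1) by simp
        also have "\<dots> = (\<sigma> ^^ i) ((\<sigma> ^^ r) x)" by (simp only: funpow_add comp_apply)
        finally show ?thesis using r(3) by simp
      qed
      have "(\<Sum>j<m. (\<sigma> ^^ i) (e j) * \<sigma> (z j)) = (\<Sum>j<m. \<sigma> ((\<sigma> ^^ (i + r - 1)) (e j)) * \<sigma> (z j))"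
        by (intro sum.cong refl arg_cong2[of _ _ _ _ "(*)"] step)
      also have "\<dots> = \<sigma> (\<Sum>j<m. (\<sigma> ^^ (i + r - 1)) (e j) * z j)"
        by (simp only: \<sigma>_sum \<sigma>_mult)
      also have "\<dots> = 0" unfolding Qz by (rule \<sigma>_zero)
      finally show ?thesis .
    qed
    let ?w = "\<lambda>j. \<sigma> (z j) - z j"
    have zk: "z k = 1" using k by (simp add: z_def)
    have "\<not> Q ?w"
    proof
      assume "Q ?w"
      have "{j. j < m \<and> ?w j \<noteq> 0} \<subset> {j. j < m \<and> y j \<noteq> 0}"
      proof (intro psubsetI subsetI notI)
        fix j assume j: "j \<in> {j. j < m \<and> ?w j \<noteq> 0}"
        then have "z j \<noteq> 0" by (intro notI) simp
        then show "j \<in> {j. j < m \<and> y j \<noteq> 0}" using j by (simp add: z_def)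
      next
        assume "{j. j < m \<and> ?w j \<noteq> 0} = {j. j < m \<and> y j \<noteq> 0}"
        then have "k \<in> {j. j < m \<and> ?w j \<noteq> 0}" using k by simp
        then show False using zk by simp
      qed
      then have "N ?w < N y"
        unfolding N_def by (rule psubset_card_mono[rotated]) simp
      then show False using y(2)[OF \<open>Q ?w\<close>] by simp
    qed
    then have "\<sigma> (z j) = z j" if "j < m" for j
      using that Qz Q\<sigma> by (auto simp: Q_def right_diff_distrib sum_subtractf)
    \<comment> \<open>All entries lie in \<open>F\<close>, so the equation for \<open>i = 0\<close>
      is a linear relation between the basis vectors, nontrivial because
      \<open>z k = 1\<close>.\<close>
    then have "(\<lambda>j. if j < m then z j else 0) \<in> coords F m"
      by (auto simp: coords_def intro: fixed_field)
    moreover have "(\<Sum>j<m. (if j < m then z j else 0) * e j) = 0"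
      using Qz[of 0] by (simp add: mult.commute)
    ultimately have "(\<lambda>j. if j < m then z j else 0) = (\<lambda>_. 0)"
      by (rule indep)
    from fun_cong[OF this, of k] show False using k zk by simp
  qed
  then show "\<sigma> ^^ m = id" using r by (metis nat_less_le)
qed

end


section \<open>Skew polynomials\<close>

text \<open>A relation instead of a function: the zero polynomial simply has no degree.\<close>

definition has_degree :: "(nat \<Rightarrow> 'k::field) \<Rightarrow> nat \<Rightarrow> bool"
  where "has_degree p d \<longleftrightarrow> p d \<noteq> 0 \<and> (\<forall>i>d. p i = 0)"

definition finitely_supported :: "(nat \<Rightarrow> 'k::field) \<Rightarrow> bool"
  where "finitely_supported p \<longleftrightarrow> (\<exists>n. \<forall>i\<ge>n. p i = 0)"

lemma has_degree_unique:
  assumes "has_degree p a" and "has_degree p b"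
  shows "a = b"
  using assms by (metis has_degree_def linorder_neqE_nat)

lemma finitely_supportedI: "(\<And>i. n \<le> i \<Longrightarrow> p i = 0) \<Longrightarrow> finitely_supported p"
  by (auto simp: finitely_supported_def)

lemma has_degree_imp_finitely_supported: "has_degree p d \<Longrightarrow> finitely_supported p"
  by (auto simp: has_degree_def intro: finitely_supportedI[of "Suc d"])

lemma degree_exists:
  assumes "\<And>i. n \<le> i \<Longrightarrow> p i = 0" and "p \<noteq> (\<lambda>_. 0)"
  shows "\<exists>d<n. has_degree p d"
  using assms(1)
proof (induction n)
  case 0
  then show ?case using assms(2) by auto
next
  case (Suc n)
  show ?case
  proof (cases "p n = 0")
    case True
    then have "p i = 0" if "n \<le> i" for i
      using Suc.prems[of i] that by (cases "i = n") auto
    then show ?thesis using Suc.IH less_SucI by blast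
  next
    case False
    then show ?thesis
      using Suc.prems by (intro exI[of _ n]) (auto simp: has_degree_def)
  qed
qed

lemma finitely_supported_degree:
  assumes "finitely_supported p" and "p \<noteq> (\<lambda>_. 0)"
  obtains d where "has_degree p d"
  using assms degree_exists[of _ p] unfolding finitely_supported_def by blast

context cyclic_extension
begin

text \<open>Defined on arbitrary sequences, that is, for skew power series, so that associativity
  and distributivity carry no hypotheses on supports.\<close>

definition skew_mult :: "(nat \<Rightarrow> 'k) \<Rightarrow> (nat \<Rightarrow> 'k) \<Rightarrow> nat \<Rightarrow> 'k"  (infixl "\<star>" 70)
  where "p \<star> q = (\<lambda>n. \<Sum>i\<le>n. p i * (\<sigma> ^^ i) (q (n - i)))"

lemma skew_mult_assoc: "(p \<star> q) \<star> r = p \<star> (q \<star> r)"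
proof
  fix n
  let ?f = "\<lambda>i l t. p i * (\<sigma> ^^ i) (q l) * (\<sigma> ^^ (i + l)) (r t)"
  have "((p \<star> q) \<star> r) n = (\<Sum>j=0..n. \<Sum>i=0..j. ?f i (j - i) (n - j))"
    by (simp add: skew_mult_def sum_distrib_right atMost_atLeast0)
  also have "\<dots> = (\<Sum>j=0..n. \<Sum>i=0..n - j. ?f j i (n - j - i))"
    by (rule fps_mult_assoc_lemma)
  also have "\<dots> = (p \<star> (q \<star> r)) n"
    by (simp add: skew_mult_def sum_distrib_left \<sigma>_pow_sum funpow_add mult.assoc atMost_atLeast0)
  finally show "((p \<star> q) \<star> r) n = (p \<star> (q \<star> r)) n" .
qed

lemma skew_mult_add_left: "(\<lambda>i. p i + q i) \<star> r = (\<lambda>i. (p \<star> r) i + (q \<star> r) i)"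
  and skew_mult_add_right: "r \<star> (\<lambda>i. p i + q i) = (\<lambda>i. (r \<star> p) i + (r \<star> q) i)"
  and skew_mult_diff_left: "(\<lambda>i. p i - q i) \<star> r = (\<lambda>i. (p \<star> r) i - (q \<star> r) i)"
  and skew_mult_diff_right: "r \<star> (\<lambda>i. p i - q i) = (\<lambda>i. (r \<star> p) i - (r \<star> q) i)"
  by (simp_all add: skew_mult_def fun_eq_iff distrib_left distrib_right left_diff_distrib
      right_diff_distrib sum.distrib sum_subtractf)

lemma skew_mult_zero: "(\<lambda>_. 0) \<star> p = (\<lambda>_. 0)" "p \<star> (\<lambda>_. 0) = (\<lambda>_. 0)"
  by (simp_all add: skew_mult_def)

abbreviation const :: "'k \<Rightarrow> nat \<Rightarrow> 'k"
  where "const a \<equiv> const_poly class_ring a"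

lemma const_skew_mult: "const a \<star> p = (\<lambda>i. a * p i)"
proof
  fix n
  have "(const a \<star> p) n = (\<Sum>i\<in>{0}. const a i * (\<sigma> ^^ i) (p (n - i)))"
    unfolding skew_mult_def by (intro sum.mono_neutral_right) (auto simp: const_poly_def)
  then show "(const a \<star> p) n = a * p n" by (simp add: const_poly_def)
qed

lemma skew_mult_const: "p \<star> const a = (\<lambda>i. p i * (\<sigma> ^^ i) a)"
proof
  fix n
  have "(p \<star> const a) n = (\<Sum>i\<in>{n}. p n * (\<sigma> ^^ n) a)"
    unfolding skew_mult_def by (intro sum.mono_neutral_cong_right) (auto simp: const_poly_def)
  then show "(p \<star> const a) n = p n * (\<sigma> ^^ n) a" by simp
qed

lemma skew_mult_bound:
  assumes "\<And>i. a \<le> i \<Longrightarrow> p i = 0" and "\<And>i. b \<le> i \<Longrightarrow> q i = 0" and "a + b \<le> Suc n"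
  shows "(p \<star> q) n = 0"
  unfolding skew_mult_def
proof (intro sum.neutral ballI)
  fix i assume "i \<in> {..n}"
  then have "a \<le> i \<or> b \<le> n - i" using assms(3) by auto
  then show "p i * (\<sigma> ^^ i) (q (n - i)) = 0"
    using assms(1,2) by auto
qed

lemma finitely_supported_skew_mult:
  assumes "finitely_supported p" and "finitely_supported q"
  shows "finitely_supported (p \<star> q)"
proof -
  obtain a b where "\<And>i. a \<le> i \<Longrightarrow> p i = 0" "\<And>i. b \<le> i \<Longrightarrow> q i = 0"
    using assms unfolding finitely_supported_def by blast
  then have "(p \<star> q) i = 0" if "a + b \<le> i" for i
    using skew_mult_bound[of a p b q i] that by simp
  then show ?thesis by (rule finitely_supportedI)
qed

lemma finitely_supported_add:
  fixes p q :: "nat \<Rightarrow> 'a::field"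
  assumes "finitely_supported p" and "finitely_supported q"
  shows "finitely_supported (\<lambda>i. p i + q i)" and "finitely_supported (\<lambda>i. p i - q i)"
proof -
  obtain a b where "\<And>i. a \<le> i \<Longrightarrow> p i = 0" "\<And>i. b \<le> i \<Longrightarrow> q i = 0"
    using assms unfolding finitely_supported_def by blast
  then show "finitely_supported (\<lambda>i. p i + q i)" "finitely_supported (\<lambda>i. p i - q i)"
    by (auto intro!: finitely_supportedI[of "max a b"])
qed

text \<open>The leading coefficient is \<open>p a * (\<sigma> ^^ a) (q b)\<close>, which is nonzero
  because powers of \<sigma> are injective.\<close>

lemma has_degree_skew_mult:
  assumes "has_degree p a" and "has_degree q b"
  shows "has_degree (p \<star> q) (a + b)"
proof -
  have "(p \<star> q) (a + b) = (\<Sum>i\<in>{a}. p i * (\<sigma> ^^ i) (q (a + b - i)))"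
    unfolding skew_mult_def
  proof (intro sum.mono_neutral_right ballI)
    fix i assume "i \<in> {..a + b} - {a}"
    then have "a < i \<or> b < a + b - i" by auto
    then show "p i * (\<sigma> ^^ i) (q (a + b - i)) = 0"
      using assms by (auto simp: has_degree_def)
  qed auto
  then have "(p \<star> q) (a + b) \<noteq> 0"
    using assms by (simp add: has_degree_def)
  moreover have "(p \<star> q) i = 0" if "a + b < i" for i
    using that assms by (intro skew_mult_bound[of "Suc a" _ "Suc b"]) (auto simp: has_degree_def)
  ultimately show ?thesis by (simp add: has_degree_def)
qed

text \<open>Here the divisor stands on the left, opposite to \<open>mod_r\<close>. Cancelling a
  leading term means solving \<open>v b * (\<sigma> ^^ b) a = f n\<close>, which uses that \<sigma>
  is surjective.\<close>

lemma right_quotient_exists: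
  assumes v: "has_degree v b" and f: "\<And>i. n \<le> i \<Longrightarrow> f i = 0"
  shows "\<exists>s r. f = (\<lambda>i. (v \<star> s) i + r i) \<and> finitely_supported s \<and> (\<forall>i\<ge>b. r i = 0)"
  using f
proof (induction n arbitrary: f)
  case 0
  then show ?case
    by (intro exI[of _ "\<lambda>_. 0"]) (auto simp: skew_mult_zero finitely_supported_def)
next
  case (Suc n)
  show ?case
  proof (cases "n < b")
    case True
    then show ?thesis
      using Suc.prems
      by (intro exI[of _ "\<lambda>_. 0"] exI[of _ f]) (auto simp: skew_mult_zero finitely_supported_def)
  next
    case False
    obtain a where a: "(\<sigma> ^^ b) a = f n / v b"
      using \<sigma>_pow_bij[of b] by (metis bij_pointE)
    define s0 where "s0 = (\<lambda>i. if i = n - b then a else 0)"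
    have v0: "v b \<noteq> 0" "\<And>i. b < i \<Longrightarrow> v i = 0" using v by (auto simp: has_degree_def)
    have top: "(v \<star> s0) n = f n"
    proof -
      have "(v \<star> s0) n = (\<Sum>i\<in>{b}. v i * (\<sigma> ^^ i) (s0 (n - i)))"
        unfolding skew_mult_def
      proof (intro sum.mono_neutral_right ballI)
        fix i assume "i \<in> {..n} - {b}"
        then have "b < i \<or> n - i \<noteq> n - b" using False by auto
        then show "v i * (\<sigma> ^^ i) (s0 (n - i)) = 0"
          using v0(2) by (auto simp: s0_def)
      qed (use False in auto)
      then show ?thesis using a v0 by (simp add: s0_def)
    qed
    have "f i - (v \<star> s0) i = 0" if "n \<le> i" for i
    proof (cases "i = n")
      case False
      have "(v \<star> s0) i = 0"
        using \<open>\<not> n < b\<close> that False v0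
        by (intro skew_mult_bound[of "Suc b" _ "Suc (n - b)"]) (auto simp: s0_def)
      then show ?thesis using Suc.prems[of i] that False by simp
    qed (simp add: top)
    from Suc.IH[of "\<lambda>i. f i - (v \<star> s0) i", OF this] obtain s r where
      s: "(\<lambda>i. f i - (v \<star> s0) i) = (\<lambda>i. (v \<star> s) i + r i)" "finitely_supported s" "\<forall>i\<ge>b. r i = 0"
      by blast
    have "f i = (v \<star> (\<lambda>i. s i + s0 i)) i + r i" for i
      using fun_cong[OF s(1), of i] by (simp add: skew_mult_add_right algebra_simps)
    moreover have "finitely_supported (\<lambda>i. s i + s0 i)"
      using s(2) by (intro finitely_supported_add) (auto simp: s0_def intro: finitely_supportedI[of "Suc (n - b)"])
    ultimately show ?thesis using s(3) by blast
  qed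
qed

text \<open>Euclid's algorithm for the pair \<open>(v, f)\<close>. The hypothesis \<open>e < d\<close> says that the common right
  multiple has degree less than \<open>deg v + deg f\<close>.\<close>

lemma common_left_divisor:
  assumes "has_degree v b" and "has_degree f d" and "has_degree x e" and "has_degree q g"
    and "v \<star> x = f \<star> q" and "e < d"
  shows "\<exists>D w u k. v = D \<star> w \<and> f = D \<star> u \<and> has_degree D k \<and> 0 < k \<and>
    finitely_supported w \<and> finitely_supported u"
  using assms
proof (induction b arbitrary: v f d x e q g rule: less_induct)
  case (less b)
  have deg: "b + e = d + g"
    using has_degree_skew_mult[OF less.prems(1,3)] has_degree_skew_mult[OF less.prems(2,4)]
      less.prems(5) has_degree_unique by metis
  obtain s r where sr: "f = (\<lambda>i. (v \<star> s) i + r i)" "finitely_supported s" "\<forall>i\<ge>b. r i = 0"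
    using right_quotient_exists[OF less.prems(1), of "Suc d" f] less.prems(2)
    by (auto simp: has_degree_def)
  show ?case
  proof (cases "r = (\<lambda>_. 0)")
    case True
    have "v = v \<star> const 1"
      by (simp add: skew_mult_const)
    moreover have "f = v \<star> s"
      using sr(1) True by simp
    \<comment> \<open>From \<open>b + e = d + g\<close> and \<open>e < d\<close>: the degree
      hypothesis is what keeps the common divisor from being constant.\<close>
    moreover have "0 < b" using deg less.prems(6) by simp
    moreover have "finitely_supported (const 1)"
      by (rule finitely_supportedI[of 1]) (simp add: const_poly_def)
    ultimately show ?thesis using less.prems(1) sr(2) by blast
  next
    case False
    obtain b' where b': "b' < b" "has_degree r b'"
      using degree_exists[of b r] sr(3) False by auto
    \<comment> \<open>Cancelling \<open>v \<star> s \<star> q\<close> leaves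
      \<open>r \<star> q = v \<star> y\<close>, the same situation for the pair
      \<open>(r, v)\<close> with cofactors \<open>q\<close> and \<open>y\<close>. The degree
      hypothesis becomes \<open>g < b\<close>, again by \<open>b + e = d + g\<close>.\<close>
    define y where "y = (\<lambda>i. x i - (s \<star> q) i)"
    have "v \<star> x = (\<lambda>i. (v \<star> (s \<star> q)) i + (r \<star> q) i)"
      using less.prems(5) sr(1) skew_mult_add_left[of "v \<star> s" r q] by (simp add: skew_mult_assoc)
    then have eq: "r \<star> q = v \<star> y"
      by (simp add: y_def skew_mult_diff_right)
    have "finitely_supported y"
      unfolding y_def
      using sr(2) less.prems(3,4)[THEN has_degree_imp_finitely_supported]
      by (intro finitely_supported_add finitely_supported_skew_mult)
    moreover have "y \<noteq> (\<lambda>_. 0)"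
    proof
      assume "y = (\<lambda>_. 0)"
      then have "r \<star> q = (\<lambda>_. 0)" using eq by (simp add: skew_mult_zero)
      then show False
        using has_degree_skew_mult[OF b'(2) less.prems(4)] by (simp add: has_degree_def)
    qed
    ultimately obtain e' where e': "has_degree y e'"
      by (rule finitely_supported_degree)
    obtain D w u k where D: "r = D \<star> w" "v = D \<star> u" "has_degree D k" "0 < k"
        "finitely_supported w" "finitely_supported u"
      using less.IH[OF b'(1,2) less.prems(1,4) e' eq] deg less.prems(6) by auto
    have "f = D \<star> (\<lambda>i. (u \<star> s) i + w i)"
      using sr(1) by (simp add: D(1,2) skew_mult_add_right skew_mult_assoc)
    moreover have "finitely_supported (\<lambda>i. (u \<star> s) i + w i)"
      using D(5,6) sr(2) by (intro finitely_supported_add finitely_supported_skew_mult)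
    ultimately show ?thesis using D by blast
  qed
qed

section \<open>The polynomial t^m - c and singular code matrices\<close>

definition binomial_poly :: "'k \<Rightarrow> nat \<Rightarrow> 'k"
  where "binomial_poly c = (\<lambda>i. if i = m then 1 else if i = 0 then - c else 0)"

lemma has_degree_binomial: "has_degree (binomial_poly c) m"
  using m_pos by (auto simp: has_degree_def binomial_poly_def)

text \<open>Because \<open>\<sigma> ^^ m = id\<close>, multiplication by \<open>t^m\<close> from the
  left is a mere shift of coefficients.\<close>

lemma binomial_skew_mult:
  "(binomial_poly c \<star> q) n = (if m \<le> n then q (n - m) else 0) - c * q n"
proof -
  have "(binomial_poly c \<star> q) n = (\<Sum>i\<in>{0} \<union> {i. i = m \<and> m \<le> n}. binomial_poly c i * (\<sigma> ^^ i) (q (n - i)))"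
    unfolding skew_mult_def by (intro sum.mono_neutral_right) (auto simp: binomial_poly_def)
  also have "\<dots> = (if m \<le> n then q (n - m) else 0) - c * q n"
    using m_pos \<sigma>_order by (auto simp: binomial_poly_def)
  finally show ?thesis .
qed

text \<open>The entries of \<open>M(x) v\<close> are \<open>(v x)\<^sub>i + c (v x)\<^sub>m\<^sub>+\<^sub>i\<close>, so that \<open>M(x) v = 0\<close> means that
  \<open>t\<^sup>m - c\<close> divides \<open>v x\<close> on the left.\<close>

lemma singular_code_matrix_imp_factorization:
  assumes x: "x \<in> coords UNIV m" "x \<noteq> (\<lambda>_. 0)" and "det (code_matrix \<sigma> c m x) = 0"
  shows "\<exists>D u k l. binomial_poly c = D \<star> u \<and> has_degree D k \<and> has_degree u l \<and> k < m \<and> l < m"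
proof -
  let ?M = "code_matrix \<sigma> c m x"
  have M: "?M \<in> carrier_mat m m"
    by (simp add: code_matrix_def)
  obtain w where w: "w \<in> carrier_vec m" "w \<noteq> 0\<^sub>v m" "?M *\<^sub>v w = 0\<^sub>v m"
    using det_0_iff_vec_prod_zero_field[OF M] assms(3) by auto
  define v where "v j = (if j < m then w $ j else 0)" for j
  have v0: "v i = 0" if "m \<le> i" for i
    using that by (simp add: v_def)
  have x0: "x i = 0" if "m \<le> i" for i
    using x(1) that by (simp add: coords_def)
  have "v \<noteq> (\<lambda>_. 0)"
  proof
    assume "v = (\<lambda>_. 0)"
    then have "w $ j = 0" if "j < m" for j
      using that by (metis v_def)
    then have "w = 0\<^sub>v m"
      using w(1) by (intro eq_vecI) auto
    then show False using w(2) by simp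
  qed
  then obtain b where b: "b < m" "has_degree v b"
    using degree_exists[of m v] v0 by auto
  obtain e where e: "e < m" "has_degree x e"
    using degree_exists[of m x] x0 x(2) by auto
  have entry: "(v \<star> x) i + c * (v \<star> x) (m + i) = 0" if i: "i < m" for i
  proof -
    have low: "(v \<star> x) i = (\<Sum>j\<in>{..i}. (\<sigma> ^^ j) (x (i - j)) * w $ j)"
      unfolding skew_mult_def using i by (intro sum.cong) (auto simp: v_def)
    have "(v \<star> x) (m + i) = (\<Sum>j\<in>{i<..<m}. v j * (\<sigma> ^^ j) (x (m + i - j)))"
      unfolding skew_mult_def
    proof (intro sum.mono_neutral_right ballI)
      fix j assume "j \<in> {..m + i} - {i<..<m}"
      then have "m \<le> j \<or> m \<le> m + i - j" by auto
      then show "v j * (\<sigma> ^^ j) (x (m + i - j)) = 0"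
        using v0 x0 by auto
    qed auto
    also have "\<dots> = (\<Sum>j\<in>{i<..<m}. (\<sigma> ^^ j) (x (m + i - j)) * w $ j)"
      by (intro sum.cong) (auto simp: v_def)
    finally have high: "c * (v \<star> x) (m + i) = (\<Sum>j\<in>{i<..<m}. c * (\<sigma> ^^ j) (x (m + i - j)) * w $ j)"
      by (simp add: sum_distrib_left mult.assoc)
    have "(?M *\<^sub>v w) $ i = (\<Sum>j<m. ?M $$ (i, j) * w $ j)"
      using i M w(1) by (simp add: scalar_prod_def atLeast0LessThan)
    also have "\<dots> = (\<Sum>j\<in>{..i} \<union> {i<..<m}. ?M $$ (i, j) * w $ j)"
      using i by (intro sum.cong) auto
    also have "\<dots> = (\<Sum>j\<in>{..i}. ?M $$ (i, j) * w $ j) + (\<Sum>j\<in>{i<..<m}. ?M $$ (i, j) * w $ j)"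
      by (intro sum.union_disjoint) auto
    also have "\<dots> = (v \<star> x) i + c * (v \<star> x) (m + i)"
      unfolding low high using i by (intro arg_cong2[of _ _ _ _ "(+)"] sum.cong) (auto simp: code_matrix_def)
    finally show ?thesis using w(3) i by simp
  qed
  \<comment> \<open>The quotient can only be the upper half of \<open>v \<star> x\<close>: the
    coefficients of \<open>(t^m - c) q\<close> from \<open>m\<close> on are those of
    \<open>q\<close>, and the lower ones are \<open>- c * q n\<close>, as \<open>entry\<close>
    requires.\<close>
  define q where "q n = (v \<star> x) (n + m)" for n
  have q0: "q n = 0" if "m \<le> n" for n
    unfolding q_def by (rule skew_mult_bound[of m _ m]) (use v0 x0 that in auto)
  have vx: "v \<star> x = binomial_poly c \<star> q"
  proof
    fix n
    show "(v \<star> x) n = (binomial_poly c \<star> q) n"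
    proof (cases "m \<le> n")
      case True
      then show ?thesis using q0[OF True] by (simp add: binomial_skew_mult q_def)
    next
      case False
      then show ?thesis
        using entry[of n] by (simp add: binomial_skew_mult q_def add.commute eq_neg_iff_add_eq_0)
    qed
  qed
  have "q \<noteq> (\<lambda>_. 0)"
    using has_degree_skew_mult[OF b(2) e(2)] vx by (auto simp: skew_mult_zero has_degree_def)
  then obtain g where g: "has_degree q g"
    using degree_exists[of m q] q0 by blast
  obtain D y u k where D: "v = D \<star> y" "binomial_poly c = D \<star> u" "has_degree D k" "0 < k"
      "finitely_supported y" "finitely_supported u"
    using common_left_divisor[OF b(2) has_degree_binomial e(2) g vx e(1)] by blast
  have "y \<noteq> (\<lambda>_. 0)" "u \<noteq> (\<lambda>_. 0)"
    using b(2) D(1,2) has_degree_binomial[of c] by (auto simp: skew_mult_zero has_degree_def)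
  then obtain l l' where l: "has_degree u l" "has_degree y l'"
    using D(5,6) finitely_supported_degree by metis
  \<comment> \<open>The divisor \<open>D\<close> has degree at most that of \<open>v\<close>, hence
    below \<open>m\<close>; since \<open>D\<close> is not constant, the cofactor \<open>u\<close>
    also has degree below \<open>m\<close>.\<close>
  have "k + l' = b"
    using has_degree_skew_mult[OF D(3) l(2)] b(2) D(1) has_degree_unique by metis
  moreover have "k + l = m"
    using has_degree_skew_mult[OF D(3) l(1)] has_degree_binomial D(2) has_degree_unique by metis
  ultimately have "k < m" "l < m" using b(1) D(4) by auto
  then show ?thesis using D l by blast
qed

end


section \<open>Petit algebras\<close>

lemma finsum_sub_of:
  fixes H :: "'k::field set"
  assumes "subring H class_ring" and "\<And>i. i \<in> A \<Longrightarrow> g i \<in> H"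
  shows "finsum (sub_of H) g A = sum g A"
proof -
  interpret H: cring "sub_of H"
    by (rule cring_sub_of[OF assms(1)])
  show ?thesis
    using assms(2)
  proof (induction A rule: infinite_finite_induct)
    case (infinite A)
    then show ?case using H.finsum_infinite by simp
  next
    case empty
    show ?case using H.finsum_empty by simp
  next
    case (insert i A)
    then have "g \<in> A \<rightarrow> H" "g i \<in> H" by auto
    then have "finsum (sub_of H) g (insert i A) = g i + finsum (sub_of H) g A"
      using H.finsum_insert[OF insert.hyps, of g] by simp
    then show ?case using insert by simp
  qed
qed

lemma uminus_sub_of:
  fixes H :: "'k::field set"
  assumes "subring H class_ring" and "a \<in> H"
  shows "\<ominus>\<^bsub>sub_of H\<^esub> a = - a"
proof -
  interpret H: cring "sub_of H"
    by (rule cring_sub_of[OF assms(1)])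
  show ?thesis
    using H.minus_equality[of "- a" a] subringD(5)[OF assms(1)] assms(2) by simp
qed

lemma up_sub_of: "up (sub_of H) = {p. range p \<subseteq> H \<and> finitely_supported p}"
proof (intro equalityI subsetI)
  fix p assume "p \<in> up (sub_of H)"
  then obtain n where "\<And>i. p i \<in> H" "bound 0 n p"
    by (auto simp: up_def)
  moreover from this(2) have "p i = 0" if "Suc n \<le> i" for i
    using that by (simp add: bound.bound)
  ultimately show "p \<in> {p. range p \<subseteq> H \<and> finitely_supported p}"
    using finitely_supportedI[of "Suc n" p] by auto
next
  fix p assume "p \<in> {p. range p \<subseteq> H \<and> finitely_supported p}"
  then obtain n where "range p \<subseteq> H" "\<And>i. n \<le> i \<Longrightarrow> p i = 0"
    by (auto simp: finitely_supported_def)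
  moreover from this(2) have "bound 0 n p"
    by (intro bound.intro) simp
  ultimately show "p \<in> up (sub_of H)"
    by (auto simp: up_def)
qed

lemma polys_below_sub_of:
  assumes "0 \<in> H"
  shows "polys_below (sub_of H) n = coords H n"
proof -
  have "range p \<subseteq> H \<and> finitely_supported p \<and> (\<forall>i\<ge>n. p i = 0) \<longleftrightarrow> p \<in> coords H n" for p
    using assms finitely_supportedI[of n p] by (auto simp: coords_def not_le[symmetric] image_subset_iff)
  then show ?thesis
    unfolding polys_below_def up_sub_of by auto
qed

lemma petit_binom_simps:
  assumes "0 \<in> H"
  shows "carrier (petit_binom (sub_of H) \<sigma> m c) = coords H m"
    and "\<zero>\<^bsub>petit_binom (sub_of H) \<sigma> m c\<^esub> = (\<lambda>_. 0)"
    and "p \<oplus>\<^bsub>petit_binom (sub_of H) \<sigma> m c\<^esub> q = (\<lambda>i. p i + q i)"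
    and "a \<odot>\<^bsub>petit_binom (sub_of H) \<sigma> m c\<^esub> p = (\<lambda>i. a * p i)"
  using polys_below_sub_of[OF assms, of m] by (simp_all add: petit_binom_def petit_def skew_poly_def)

context cyclic_extension
begin

lemma skew_poly_mult:
  assumes H: "subring H class_ring" and \<sigma>H: "\<sigma> ` H \<subseteq> H" and p: "range p \<subseteq> H" and q: "range q \<subseteq> H"
  shows "p \<otimes>\<^bsub>skew_poly (sub_of H) \<sigma>\<^esub> q = p \<star> q" and "range (p \<star> q) \<subseteq> H"
proof -
  have \<sigma>n: "(\<sigma> ^^ n) a \<in> H" if "a \<in> H" for a n
    using that \<sigma>H by (induction n) auto
  have in_H: "p i * (\<sigma> ^^ i) (q j) \<in> H" for i j
    using p q by (intro subringD(4)[OF H] \<sigma>n) auto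
  show "p \<otimes>\<^bsub>skew_poly (sub_of H) \<sigma>\<^esub> q = p \<star> q"
  proof -
    have "finsum (sub_of H) (\<lambda>i. p i * (\<sigma> ^^ i) (q (n - i))) {..n} = (p \<star> q) n" for n
      unfolding skew_mult_def by (rule finsum_sub_of[OF H in_H])
    then show ?thesis by (simp add: skew_poly_def)
  qed
  have "(\<Sum>i\<in>I. p i * (\<sigma> ^^ i) (q (n - i))) \<in> H" for I n
    using subringD(1,3)[OF H] in_H by (induction I rule: infinite_finite_induct) auto
  then show "range (p \<star> q) \<subseteq> H"
    by (auto simp: skew_mult_def)
qed

text \<open>A nonzero difference of quotients, multiplied by \<open>t^m - c\<close>, has degree at
  least \<open>m\<close> and cannot be a difference of remainders. This makes the description in
  \<open>mod_r\<close> definite.\<close>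

lemma binomial_division_unique:
  assumes q: "finitely_supported q" "finitely_supported q'" and r: "\<And>i. m \<le> i \<Longrightarrow> r i = 0" "\<And>i. m \<le> i \<Longrightarrow> r' i = 0"
    and eq: "\<And>i. (q \<star> binomial_poly c) i + r i = (q' \<star> binomial_poly c) i + r' i"
  shows "r = r'"
proof -
  define d where "d = (\<lambda>i. q i - q' i)"
  have d: "(d \<star> binomial_poly c) i = r' i - r i" for i
    using eq[of i] by (simp add: d_def skew_mult_diff_left algebra_simps)
  have "d = (\<lambda>_. 0)"
  proof (rule ccontr)
    assume d0: "d \<noteq> (\<lambda>_. 0)"
    have "finitely_supported d"
      unfolding d_def using q by (rule finitely_supported_add)
    then obtain k where "has_degree d k"
      using d0 by (rule finitely_supported_degree)
    then have "(d \<star> binomial_poly c) (k + m) \<noteq> 0"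
      using has_degree_skew_mult[OF _ has_degree_binomial] by (simp add: has_degree_def)
    then show False using d r by simp
  qed
  then have "r' i - r i = 0" for i
    using d[of i] by (simp add: skew_mult_zero)
  then show ?thesis by auto
qed

lemma mod_r_binomial:
  assumes H: "subring H class_ring" and \<sigma>H: "\<sigma> ` H \<subseteq> H" and c: "c \<in> H"
    and r: "r \<in> coords H m" and q: "range q \<subseteq> H" "finitely_supported q"
    and h: "\<And>i. h i = (q \<star> binomial_poly c) i + r i"
  shows "mod_r (sub_of H) \<sigma> m (binomial_poly c) h = r"
  unfolding mod_r_def
proof (rule the_equality)
  note H0 = subringD[OF H]
  have f: "range (binomial_poly c) \<subseteq> H"
    using H0 c by (auto simp: binomial_poly_def)
  note mult = skew_poly_mult(1)[OF H \<sigma>H _ f]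
  show "r \<in> polys_below (sub_of H) m \<and>
      (\<exists>q\<in>up (sub_of H). h = q \<otimes>\<^bsub>skew_poly (sub_of H) \<sigma>\<^esub> binomial_poly c \<oplus>\<^bsub>skew_poly (sub_of H) \<sigma>\<^esub> r)"
  proof (intro conjI bexI[of _ q])
    show "h = q \<otimes>\<^bsub>skew_poly (sub_of H) \<sigma>\<^esub> binomial_poly c \<oplus>\<^bsub>skew_poly (sub_of H) \<sigma>\<^esub> r"
      unfolding mult[OF q(1)] using h by (simp add: skew_poly_def fun_eq_iff)
    show "r \<in> polys_below (sub_of H) m"
      unfolding polys_below_sub_of[OF H0(1)] by (rule r)
    show "q \<in> up (sub_of H)"
      unfolding up_sub_of using q by simp
  qed
  fix r' assume "r' \<in> polys_below (sub_of H) m \<and>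
      (\<exists>q\<in>up (sub_of H). h = q \<otimes>\<^bsub>skew_poly (sub_of H) \<sigma>\<^esub> binomial_poly c \<oplus>\<^bsub>skew_poly (sub_of H) \<sigma>\<^esub> r')"
  then obtain q' where q': "range q' \<subseteq> H" "finitely_supported q'" and r': "r' \<in> coords H m"
      and "h = q' \<otimes>\<^bsub>skew_poly (sub_of H) \<sigma>\<^esub> binomial_poly c \<oplus>\<^bsub>skew_poly (sub_of H) \<sigma>\<^esub> r'"
    unfolding polys_below_sub_of[OF H0(1)] up_sub_of by blast
  then have "h i = (q' \<star> binomial_poly c) i + r' i" for i
    unfolding mult[OF q'(1)] by (simp add: skew_poly_def)
  then show "r' = r"
    using h q q' r r' by (intro binomial_division_unique[of q' q _ _ c]) (auto simp: coords_def)
qed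

lemma petit_binom_mult:
  assumes H: "subring H class_ring" and \<sigma>H: "\<sigma> ` H \<subseteq> H" and c: "c \<in> H"
    and g: "g \<in> coords H m" and h: "h \<in> coords H m"
  shows "g \<otimes>\<^bsub>petit_binom (sub_of H) \<sigma> m c\<^esub> h = mod_r (sub_of H) \<sigma> m (binomial_poly c) (g \<star> h)"
    and "range (g \<star> h) \<subseteq> H"
proof -
  have range: "range p \<subseteq> H" if "p \<in> coords H m" for p
    using that subringD(1)[OF H] by (auto simp: coords_def image_subset_iff) (metis not_le)
  have "(\<lambda>i. if i = m then \<one>\<^bsub>sub_of H\<^esub> else if i = 0 then \<ominus>\<^bsub>sub_of H\<^esub> c else \<zero>\<^bsub>sub_of H\<^esub>) = binomial_poly c"
    using uminus_sub_of[OF H c] by (auto simp: binomial_poly_def fun_eq_iff)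
  then show "g \<otimes>\<^bsub>petit_binom (sub_of H) \<sigma> m c\<^esub> h = mod_r (sub_of H) \<sigma> m (binomial_poly c) (g \<star> h)"
    unfolding petit_binom_def using skew_poly_mult(1)[OF H \<sigma>H range[OF g] range[OF h]]
    by (simp add: petit_def)
  show "range (g \<star> h) \<subseteq> H"
    using skew_poly_mult(2)[OF H \<sigma>H range[OF g] range[OF h]] .
qed

lemma petit_binom_mult_low_degree:
  assumes H: "subring H class_ring" "\<sigma> ` H \<subseteq> H" "c \<in> H"
    and g: "g \<in> coords H m" and h: "h \<in> coords H m" and "\<And>i. m \<le> i \<Longrightarrow> (g \<star> h) i = 0"
  shows "g \<otimes>\<^bsub>petit_binom (sub_of H) \<sigma> m c\<^esub> h = g \<star> h"
proof -
  have "g \<star> h \<in> coords H m"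
    using petit_binom_mult(2)[OF H g h] assms(6) by (auto simp: coords_def)
  then show ?thesis
    unfolding petit_binom_mult(1)[OF H g h] using subringD(1)[OF H(1)]
    by (intro mod_r_binomial[OF H, of _ "\<lambda>_. 0"]) (auto simp: skew_mult_zero finitely_supported_def)
qed

text \<open>Division of \<open>t^m - c\<close> by itself has quotient 1 and remainder 0, so proper
  factors of it are zero divisors of the Petit algebra.\<close>

lemma petit_binom_mult_factors:
  assumes H: "subring H class_ring" "\<sigma> ` H \<subseteq> H" "c \<in> H"
    and g: "g \<in> coords H m" and h: "h \<in> coords H m" and "g \<star> h = binomial_poly c"
  shows "g \<otimes>\<^bsub>petit_binom (sub_of H) \<sigma> m c\<^esub> h = (\<lambda>_. 0)"
  unfolding petit_binom_mult(1)[OF H g h] assms(6)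
  using subringD(1,2)[OF H(1)] const_skew_mult[of 1 "binomial_poly c"]
  by (intro mod_r_binomial[OF H, of _ "const 1"])
    (auto simp: coords_def const_poly_def intro: finitely_supportedI[of 1])

lemma division_alg_imp_code_matrix_nonsingular:
  assumes A: "division_alg (petit_binom class_ring \<sigma> m c)"
    and x: "x \<in> coords UNIV m" "x \<noteq> (\<lambda>_. 0)"
  shows "det (code_matrix \<sigma> c m x) \<noteq> 0"
proof
  assume "det (code_matrix \<sigma> c m x) = 0"
  then obtain D u k l where D: "binomial_poly c = D \<star> u" "has_degree D k" "has_degree u l" "k < m" "l < m"
    using singular_code_matrix_imp_factorization[OF x] by blast
  let ?A = "petit_binom (sub_of UNIV) \<sigma> m c"
  have UNIV: "subring (UNIV :: 'k set) class_ring"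
    using ring.carrier_is_subring[OF ring_class_ring] by simp
  have carr: "D \<in> coords UNIV m" "u \<in> coords UNIV m" "(\<lambda>_. 0) \<in> coords UNIV m"
    using D by (auto simp: coords_def has_degree_def)
  have ne: "D \<noteq> (\<lambda>_. 0)" "u \<noteq> (\<lambda>_. 0)"
    using D by (auto simp: has_degree_def)
  have A': "division_alg ?A"
    using A by simp
  have "D \<in> carrier ?A - {\<zero>\<^bsub>?A\<^esub>}"
    unfolding petit_binom_simps[OF UNIV_I] using carr ne by simp
  then have "bij_betw (\<lambda>x. D \<otimes>\<^bsub>?A\<^esub> x) (carrier ?A) (carrier ?A)"
    using A' unfolding division_alg_def by blast
  then have "inj_on (\<lambda>x. D \<otimes>\<^bsub>?A\<^esub> x) (coords UNIV m)"
    unfolding petit_binom_simps[OF UNIV_I] by (rule bij_betw_imp_inj_on)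
  moreover have "D \<otimes>\<^bsub>?A\<^esub> u = (\<lambda>_. 0)"
    using D(1) by (intro petit_binom_mult_factors UNIV carr) auto
  moreover have "D \<otimes>\<^bsub>?A\<^esub> (\<lambda>_. 0) = (\<lambda>_. 0)"
    using petit_binom_mult_low_degree[OF UNIV subset_UNIV UNIV_I carr(1,3)] skew_mult_zero
    by metis
  ultimately have "u = (\<lambda>_. 0)"
    using carr by (metis inj_onD)
  then show False using ne by simp
qed

lemma rank_code_matrix:
  assumes "division_alg (petit_binom class_ring \<sigma> m c)"
    and "x \<in> coords UNIV m" "x \<noteq> (\<lambda>_. 0)"
  shows "vec_space.rank m (code_matrix \<sigma> c m x) = m"
  using vec_space.det_rank_iff[of "code_matrix \<sigma> c m x" m]
    division_alg_imp_code_matrix_nonsingular[OF assms] by (simp add: code_matrix_def)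

end


section \<open>The codes\<close>

lemma module_class_ring:
  fixes M :: "('k::field, 'c, 'd) module_scheme"
  assumes "abelian_group M"
    and "\<And>a x. x \<in> carrier M \<Longrightarrow> a \<odot>\<^bsub>M\<^esub> x \<in> carrier M"
    and "\<And>a b x. x \<in> carrier M \<Longrightarrow> (a + b) \<odot>\<^bsub>M\<^esub> x = a \<odot>\<^bsub>M\<^esub> x \<oplus>\<^bsub>M\<^esub> b \<odot>\<^bsub>M\<^esub> x"
    and "\<And>a x y. x \<in> carrier M \<Longrightarrow> y \<in> carrier M \<Longrightarrow> a \<odot>\<^bsub>M\<^esub> (x \<oplus>\<^bsub>M\<^esub> y) = a \<odot>\<^bsub>M\<^esub> x \<oplus>\<^bsub>M\<^esub> a \<odot>\<^bsub>M\<^esub> y"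
    and "\<And>a b x. x \<in> carrier M \<Longrightarrow> (a * b) \<odot>\<^bsub>M\<^esub> x = a \<odot>\<^bsub>M\<^esub> (b \<odot>\<^bsub>M\<^esub> x)"
    and "\<And>x. x \<in> carrier M \<Longrightarrow> 1 \<odot>\<^bsub>M\<^esub> x = x"
  shows "module (sub_of UNIV) M"
  using assms cring_class_ring
  by (intro module.intro module_axioms.intro) auto

lemma module_class_module: "module (sub_of UNIV) (class_module :: ('k::field, 'k) module)"
proof (rule module_class_ring)
  show "abelian_group (class_module :: ('k, 'k) module)"
  proof (rule abelian_groupI)
    show "\<exists>y\<in>carrier class_module. y \<oplus>\<^bsub>class_module\<^esub> x = \<zero>\<^bsub>class_module\<^esub>" for x :: 'k
      by (rule bexI[of _ "- x"]) (simp_all add: class_module_def)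
  qed (simp_all add: class_module_def)
qed (simp_all add: class_module_def distrib_left distrib_right mult.assoc)

lemma module_petit_binom:
  fixes c :: "'k::field"
  shows "module (sub_of UNIV) (petit_binom class_ring \<sigma> m c)"
proof -
  let ?A = "petit_binom (sub_of UNIV) \<sigma> m c"
  note simps = petit_binom_simps[OF UNIV_I, of \<sigma> m c]
  have "module (sub_of UNIV) ?A"
  proof (rule module_class_ring)
    show "abelian_group ?A"
    proof (rule abelian_groupI, unfold simps)
      show "\<exists>y\<in>coords UNIV m. (\<lambda>i. y i + x i) = (\<lambda>_. 0)" if "x \<in> coords UNIV m" for x :: "nat \<Rightarrow> 'k"
        using that by (intro bexI[of _ "\<lambda>i. - x i"]) (auto simp: coords_def)
    qed (auto simp: coords_def add_ac)
  qed (unfold simps, auto simp: coords_def algebra_simps)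
  then show ?thesis by simp
qed

lemma module_mat_over_field: "module (sub_of UNIV) (module_mat TYPE('k::field) n n)"
proof -
  have "module class_ring (module_mat TYPE('k) n n)"
    using matrix_vs[of n n, where 'a = 'k] by (simp add: vectorspace_def)
  then show ?thesis by simp
qed

context cyclic_extension
begin

text \<open>Scalars are restricted to \<open>F\<close> because column \<open>j\<close> carries
  \<open>\<sigma> ^^ j\<close>.\<close>

lemma code_matrix_add: "code_matrix \<sigma> c m (\<lambda>i. x i + y i) = code_matrix \<sigma> c m x + code_matrix \<sigma> c m y"
  and code_matrix_diff: "code_matrix \<sigma> c m (\<lambda>i. x i - y i) = code_matrix \<sigma> c m x - code_matrix \<sigma> c m y"
  and code_matrix_smult: "a \<in> F \<Longrightarrow> code_matrix \<sigma> c m (\<lambda>i. a * x i) = a \<cdot>\<^sub>m code_matrix \<sigma> c m x"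
  and code_matrix_zero: "code_matrix \<sigma> c m (\<lambda>_. 0) = 0\<^sub>m m m"
  by (auto intro!: eq_matI simp: code_matrix_def distrib_left right_diff_distrib \<sigma>_pow_fixes)

text \<open>The first column of \<open>M(x)\<close> consists of the coefficients of
  \<open>x\<close>.\<close>

lemma code_matrix_inj: "inj_on (code_matrix \<sigma> c m) (coords UNIV m)"
proof (rule inj_onI)
  fix x y :: "nat \<Rightarrow> 'k"
  assume xy: "x \<in> coords UNIV m" "y \<in> coords UNIV m" "code_matrix \<sigma> c m x = code_matrix \<sigma> c m y"
  have "x i = y i" if "i < m" for i
  proof -
    have "code_matrix \<sigma> c m x $$ (i, 0) = code_matrix \<sigma> c m y $$ (i, 0)"
      using xy(3) by simp
    then show ?thesis using that m_pos by (simp add: code_matrix_def)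
  qed
  moreover have "x i = y i" if "\<not> i < m" for i
    using xy(1,2) that by (simp add: coords_def)
  ultimately show "x = y" by blast
qed

lemma ext_degree_eq: "ext_degree F = m"
  unfolding ext_degree_def
  using dimension_F ring.dimension_is_inj[OF ring_class_ring subfield_F]
  by (intro the_equality) auto

end

section \<open>Modules between \<pp>\<Lambda> and \<Lambda>, and their codes\<close>

locale integral_code = cyclic_extension F m \<sigma> + complete_subfield nrm F \<pi>
  for F :: "'k::field set" and m \<sigma> and nrm :: "'k \<Rightarrow> real" and \<pi> +
  fixes c :: 'k
  assumes c_integral: "c \<in> val_ring nrm UNIV"
    and division: "division_alg (petit_binom class_ring \<sigma> m c)"
begin

abbreviation OK :: "'k set" where "OK \<equiv> val_ring nrm UNIV"

lemma subring_OK: "subring OK class_ring"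
  using subring_val_ring[OF ring.carrier_is_subring[OF ring_class_ring]] by simp

lemmas OK_closed [simp] = subringD[OF subring_OK]

lemma R_OK: "R \<subseteq> OK"
  by (auto simp: val_ring_def)

text \<open>The norm is not assumed to be invariant under the Galois group; the bound comes from
  \<open>nrm_hom_le\<close> over the complete field \<open>F\<close>.\<close>

lemma \<sigma>_integral: "\<sigma> ` OK \<subseteq> OK"
proof -
  have "nrm (\<sigma> x) \<le> nrm x" for x
    by (rule nrm_hom_le[OF dimension_F]) (simp_all add: \<sigma>_fixes)
  then show ?thesis
    by (auto simp: val_ring_def intro: order_trans)
qed

lemma \<sigma>_pow_integral: "x \<in> OK \<Longrightarrow> (\<sigma> ^^ n) x \<in> OK"
  using \<sigma>_integral by (induction n) auto

lemma natural_order_simps: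
  shows "carrier (natural_order nrm \<sigma> m c) = coords OK m"
    and "\<zero>\<^bsub>natural_order nrm \<sigma> m c\<^esub> = (\<lambda>_. 0)"
    and "p \<oplus>\<^bsub>natural_order nrm \<sigma> m c\<^esub> q = (\<lambda>i. p i + q i)"
  unfolding natural_order_def using petit_binom_simps[of OK \<sigma> m c] by simp_all

lemma natural_order_mult_low_degree:
  assumes "g \<in> coords OK m" and "h \<in> coords OK m" and "\<And>i. m \<le> i \<Longrightarrow> (g \<star> h) i = 0"
  shows "g \<otimes>\<^bsub>natural_order nrm \<sigma> m c\<^esub> h = g \<star> h"
  unfolding natural_order_def
  by (rule petit_binom_mult_low_degree[OF subring_OK \<sigma>_integral c_integral assms])

lemma const_in_order: "a \<in> OK \<Longrightarrow> const a \<in> coords OK m"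
  using m_pos by (auto simp: coords_def const_poly_def)

lemma const_mult:
  assumes "a \<in> OK" and "x \<in> coords OK m"
  shows "const a \<otimes>\<^bsub>natural_order nrm \<sigma> m c\<^esub> x = (\<lambda>i. a * x i)"
  using natural_order_mult_low_degree[OF const_in_order[OF assms(1)] assms(2)] assms(2)
  by (auto simp: const_skew_mult coords_def)

lemma mult_const:
  assumes "a \<in> R" and "x \<in> coords OK m"
  shows "x \<otimes>\<^bsub>natural_order nrm \<sigma> m c\<^esub> const a = (\<lambda>i. a * x i)"
proof -
  have a: "a \<in> OK" "a \<in> F" using assms(1) by (auto simp: val_ring_def)
  have "x \<star> const a = (\<lambda>i. a * x i)"
    by (simp add: skew_mult_const \<sigma>_pow_fixes[OF a(2)] mult.commute)
  moreover have "a * x i = 0" if "m \<le> i" for i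
    using assms(2) that by (simp add: coords_def)
  ultimately show ?thesis
    using natural_order_mult_low_degree[OF assms(2) const_in_order[OF a(1)]] by simp
qed

text \<open>Scalars come from \<open>R\<close> only, since the codes are linear over the valuation
  ring of \<open>F\<close>. The last clause expresses that \<open>L\<close> contains \<pp>\<Lambda>,
  and no clause refers to the multiplication of \<Lambda>.\<close>

definition intermediate_lattice :: "(nat \<Rightarrow> 'k) set \<Rightarrow> bool"
  where "intermediate_lattice L \<longleftrightarrow> L \<subseteq> coords OK m \<and>
    (\<forall>x\<in>L. \<forall>y\<in>L. (\<lambda>i. x i - y i) \<in> L) \<and> (\<forall>x\<in>L. \<forall>y\<in>L. (\<lambda>i. x i + y i) \<in> L) \<and>
    (\<forall>a\<in>R. \<forall>x\<in>L. (\<lambda>i. a * x i) \<in> L) \<and>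
    (\<forall>a\<in>max_ideal nrm F. \<forall>x\<in>coords OK m. (\<lambda>i. a * x i) \<in> L)"

lemma intermediate_lattice_order: "intermediate_lattice (coords OK m)"
proof -
  have "max_ideal nrm F \<subseteq> OK"
    by (auto simp: max_ideal_def val_ring_def)
  then show ?thesis
    using R_OK unfolding intermediate_lattice_def by (auto simp: coords_def)
qed

lemma intermediate_lattice_left_ideal:
  assumes I: "left_ideal (natural_order nrm \<sigma> m c) I"
    and p: "const ` max_ideal nrm F \<subseteq> I"
  shows "intermediate_lattice I"
proof -
  let ?\<Lambda> = "natural_order nrm \<sigma> m c"
  have sub: "additive_subgroup I ?\<Lambda>" and left: "\<And>h x. h \<in> coords OK m \<Longrightarrow> x \<in> I \<Longrightarrow> h \<otimes>\<^bsub>?\<Lambda>\<^esub> x \<in> I"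
    using I natural_order_simps(1) by (auto simp: left_ideal_def)
  have I_OK: "I \<subseteq> coords OK m"
    using additive_subgroup.a_subset[OF sub] natural_order_simps(1) by simp
  have add: "(\<lambda>i. x i + y i) \<in> I" if "x \<in> I" "y \<in> I" for x y
    using additive_subgroup.a_closed[OF sub that] natural_order_simps(3) by simp
  have smult: "(\<lambda>i. a * x i) \<in> I" if "a \<in> OK" "x \<in> I" for a x
  proof -
    have "x \<in> coords OK m" using that(2) I_OK by blast
    then show ?thesis
      using left[OF const_in_order[OF that(1)] that(2)] const_mult[OF that(1)] by simp
  qed
  have diff: "(\<lambda>i. x i - y i) \<in> I" if "x \<in> I" "y \<in> I" for x y
    using add[OF that(1) smult[OF _ that(2), of "- 1"]] by simp
  \<comment> \<open>A left ideal absorbs \<open>x\<close> from the left and so contains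
    \<open>x\<close> times \<open>const a\<close>; \<sigma> fixes \<open>a\<close>, which turns this
    product into \<open>a\<close> times \<open>x\<close>.\<close>
  have low: "(\<lambda>i. a * x i) \<in> I" if "a \<in> max_ideal nrm F" "x \<in> coords OK m" for a x
  proof -
    have "const a \<in> I" using p that(1) by blast
    then have "x \<otimes>\<^bsub>?\<Lambda>\<^esub> const a \<in> I" by (rule left[OF that(2)])
    moreover have "a \<in> R" using that(1) by (simp add: max_ideal_def val_ring_def)
    ultimately show ?thesis using mult_const[OF _ that(2)] by simp
  qed
  show ?thesis
    unfolding intermediate_lattice_def using I_OK add diff smult low R_OK by blast
qed

lemma intermediate_lattice_basis:
  assumes L: "intermediate_lattice L" and "complete_subfield nrm E \<pi>'" and E: "E \<subseteq> F"
    and dim: "ring.dimension class_ring d E UNIV"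
  shows "\<exists>g. bij_betw g (coords E (m * d)) (coords UNIV m) \<and> g ` coords (val_ring nrm E) (m * d) = L \<and>
    linear_coords E (m * d) g"
proof -
  interpret E: complete_subfield nrm E \<pi>' by fact
  have RE: "val_ring nrm E \<subseteq> R" using E by (auto simp: val_ring_def)
  \<comment> \<open>The uniformizer of the smaller field lies in \<pp>, hence \<pi>' \<Lambda> is
    contained in \<open>L\<close>: it is the scaling factor \<open>s\<close> of
    \<open>order_lattice_basis\<close>.\<close>
  have "\<pi>' \<in> max_ideal nrm F"
    using E E.uniformizer by (auto simp: max_ideal_def)
  then show ?thesis
    using L RE E.uniformizer(1,2) unfolding intermediate_lattice_def
    by (intro E.order_lattice_basis[OF dim, of L m \<pi>']) auto
qed

text \<open>Both ranks come from the same number \<open>d = [K : E]\<close>: it is the rank of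
  \<O>_K over the valuation ring of \<open>E\<close>, and \<open>L\<close> has rank
  \<open>m * d\<close>.\<close>

lemma lattice_of_rank_intermediate:
  assumes L: "intermediate_lattice L" and EF: "complete_subfield nrm E \<pi>'" "E \<subseteq> F"
    and dim: "ring.dimension class_ring d E UNIV"
  shows "lattice_of_rank_mult (val_ring nrm E) E (petit_binom class_ring \<sigma> m c) L m OK"
proof -
  interpret E: complete_subfield nrm E \<pi>' by fact
  let ?A = "petit_binom class_ring \<sigma> m c"
  have A_simps: "carrier ?A = coords UNIV m" "x \<oplus>\<^bsub>?A\<^esub> y = (\<lambda>i. x i + y i)" "a \<odot>\<^bsub>?A\<^esub> x = (\<lambda>i. a * x i)" for x y a
    using petit_binom_simps[OF UNIV_I, of \<sigma> m c] by simp_all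
  have RE: "subring (val_ring nrm E) class_ring" "val_ring nrm E \<subseteq> E"
    using subring_val_ring[OF E.subring] by (auto simp: val_ring_def)
  obtain g where g: "bij_betw g (coords E (m * d)) (coords UNIV m)"
      "g ` coords (val_ring nrm E) (m * d) = L" "linear_coords E (m * d) g"
    using intermediate_lattice_basis[OF assms] by blast
  have "lattice_in (val_ring nrm E) E ?A (g ` coords (val_ring nrm E) (m * d))"
    and "free_of_rank (sub_of (val_ring nrm E)) (?A\<lparr>carrier := g ` coords (val_ring nrm E) (m * d)\<rparr>) (m * d)"
    by (rule lattice_coords[OF module_restrict_scalars[OF module_petit_binom E.subring subset_UNIV] E.subring RE];
        use g(1,3) in \<open>simp add: A_simps linear_coords_def\<close>)+
  moreover obtain h where h: "bij_betw h (coords E d) UNIV" "h ` coords (val_ring nrm E) d = OK"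
      "\<And>a b. a \<in> coords E d \<Longrightarrow> b \<in> coords E d \<Longrightarrow> h (\<lambda>k. a k + b k) = h a + h b"
      "\<And>r a. r \<in> E \<Longrightarrow> a \<in> coords E d \<Longrightarrow> h (\<lambda>k. r * a k) = r * h a"
    using E.val_ring_basis[OF dim] by metis
  have "free_of_rank (sub_of (val_ring nrm E)) (class_module\<lparr>carrier := h ` coords (val_ring nrm E) d\<rparr>) d"
    by (rule lattice_coords(2)[OF module_restrict_scalars[OF module_class_module E.subring subset_UNIV] E.subring RE];
        use h in \<open>simp add: class_module_def\<close>)
  ultimately show ?thesis
    unfolding lattice_of_rank_mult_def g(2) h(2) by blast
qed

lemma code_of_intermediate:
  assumes "intermediate_lattice L"
  shows "code_of \<sigma> c m L \<union> {0\<^sub>m m m} = code_matrix \<sigma> c m ` L"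
    and "code_of \<sigma> c m L \<noteq> {}" and "0\<^sub>m m m \<notin> code_of \<sigma> c m L"
proof -
  have L: "L \<subseteq> coords UNIV m"
    using assms by (auto simp: intermediate_lattice_def coords_def)
  have 0: "(\<lambda>_. 0) \<in> L"
  proof -
    have "(\<lambda>i. 0 * (0 :: 'k)) \<in> L"
      using assms unfolding intermediate_lattice_def
      by (elim conjE ballE[of _ _ 0] ballE[of _ _ "\<lambda>_. 0"]) (auto simp: max_ideal_def coords_def)
    then show ?thesis by simp
  qed
  have "0\<^sub>m m m \<in> code_matrix \<sigma> c m ` L"
    using 0 code_matrix_zero[of c] by (metis imageI)
  moreover have "code_matrix \<sigma> c m x \<in> code_of \<sigma> c m L \<union> {0\<^sub>m m m}" if "x \<in> L" for x
    using that by (cases "x = (\<lambda>_. 0)") (auto simp: code_of_def code_matrix_zero)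
  moreover have "code_of \<sigma> c m L \<subseteq> code_matrix \<sigma> c m ` L"
    by (auto simp: code_of_def)
  ultimately show "code_of \<sigma> c m L \<union> {0\<^sub>m m m} = code_matrix \<sigma> c m ` L"
    by blast
  have "\<pi> \<in> max_ideal nrm F"
    using uniformizer by (simp add: max_ideal_def)
  then have "(\<lambda>i. \<pi> * const 1 i) \<in> L"
    using assms const_in_order[of 1] unfolding intermediate_lattice_def by auto
  moreover have "(\<lambda>i. \<pi> * const 1 i) \<noteq> (\<lambda>_. 0)"
    using uniformizer by (auto simp: fun_eq_iff const_poly_def)
  ultimately show "code_of \<sigma> c m L \<noteq> {}"
    by (auto simp: code_of_def)
  show "0\<^sub>m m m \<notin> code_of \<sigma> c m L"
  proof
    assume "0\<^sub>m m m \<in> code_of \<sigma> c m L"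
    then obtain x where "x \<in> L" "x \<noteq> (\<lambda>_. 0)" "code_matrix \<sigma> c m x = code_matrix \<sigma> c m (\<lambda>_. 0)"
      unfolding code_of_def code_matrix_zero by auto
    then show False
      using inj_onD[OF code_matrix_inj, of c x "\<lambda>_. 0"] L 0 by auto
  qed
qed

lemma min_distance_intermediate:
  assumes L: "intermediate_lattice L"
  shows "min_distance m (code_matrix \<sigma> c m ` L) = m"
  unfolding min_distance_def
proof (rule Least_equality)
  have LU: "L \<subseteq> coords UNIV m"
    using L by (auto simp: intermediate_lattice_def coords_def)
  have diff: "vec_space.rank m (code_matrix \<sigma> c m x - code_matrix \<sigma> c m y) = m"
    if "x \<in> L" "y \<in> L" "x \<noteq> y" for x y
  proof -
    have "x \<in> coords UNIV m" "y \<in> coords UNIV m"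
      using that LU by blast+
    then have "(\<lambda>i. x i - y i) \<in> coords UNIV m"
      by (simp add: coords_def)
    moreover have "(\<lambda>i. x i - y i) \<noteq> (\<lambda>_. 0)"
      using that(3) by (auto simp: fun_eq_iff)
    ultimately show ?thesis
      using rank_code_matrix[OF division] by (simp flip: code_matrix_diff)
  qed
  \<comment> \<open>A nonzero codeword guarantees that the set under \<open>LEAST\<close> is not
    empty.\<close>
  obtain X where X: "X \<in> code_of \<sigma> c m L" using code_of_intermediate(2)[OF L] by blast
  have X0: "X \<in> code_matrix \<sigma> c m ` L" "0\<^sub>m m m \<in> code_matrix \<sigma> c m ` L" "X \<noteq> 0\<^sub>m m m"
    using X code_of_intermediate[OF L] by blast+
  have rank: "vec_space.rank m (X - Y) = m"
    if "X \<in> code_matrix \<sigma> c m ` L" "Y \<in> code_matrix \<sigma> c m ` L" "X \<noteq> Y" for X Y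
  proof -
    obtain x y where "x \<in> L" "y \<in> L" "X = code_matrix \<sigma> c m x" "Y = code_matrix \<sigma> c m y"
      using \<open>X \<in> _\<close> \<open>Y \<in> _\<close> by (elim imageE)
    moreover from this have "x \<noteq> y" using \<open>X \<noteq> Y\<close> by metis
    ultimately show ?thesis using diff by simp
  qed
  show "\<exists>X\<in>code_matrix \<sigma> c m ` L. \<exists>Y\<in>code_matrix \<sigma> c m ` L. X \<noteq> Y \<and> m = vec_space.rank m (X - Y)"
    by (rule bexI[OF _ X0(1)], rule bexI[OF _ X0(2)]) (simp add: X0(3) rank[OF X0])
  fix d assume "\<exists>X\<in>code_matrix \<sigma> c m ` L. \<exists>Y\<in>code_matrix \<sigma> c m ` L. X \<noteq> Y \<and> d = vec_space.rank m (X - Y)"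
  then show "m \<le> d" using rank by (elim bexE conjE) simp
qed

text \<open>With minimum distance \<open>m\<close> the bound reads
  \<open>m * (m - m + 1) * [K : F] = m * m\<close>, and this is the rank of \<open>L\<close> over
  \<open>R\<close>. Injectivity and linearity of \<open>code_matrix\<close> carry a basis of
  \<open>L\<close> to one of the code.\<close>

lemma linear_MRD_intermediate:
  assumes L: "intermediate_lattice L"
  shows "linear_MRD nrm F m (code_of \<sigma> c m L)"
proof -
  let ?C = "code_matrix \<sigma> c m ` L" and ?MK = "module_mat TYPE('k) m m"
  let ?int = "{X \<in> carrier_mat m m. elements_mat X \<subseteq> OK}"
  have MK: "module (sub_of R) ?MK"
    by (rule module_restrict_scalars[OF module_mat_over_field subring_val_ring[OF subring] subset_UNIV])
  have int_iff: "X \<in> ?int \<longleftrightarrow> X \<in> carrier_mat m m \<and> (\<forall>i<m. \<forall>j<m. X $$ (i, j) \<in> OK)" for X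
    by (auto simp: elements_mat_def UN_subset_iff image_subset_iff)
  have "submodule (sub_of R) ?int ?MK"
    unfolding LinearCombinations.submodule_def
    using MK R_OK by (auto simp: module_mat_simps int_iff simp del: mem_Collect_eq)
  then have int: "module (sub_of R) (?MK\<lparr>carrier := ?int\<rparr>)"
    by (rule module.submodule_is_module[OF MK])
  have C_int: "?C \<subseteq> ?int"
  proof
    fix X assume "X \<in> ?C"
    then obtain x where x: "x \<in> coords OK m" "X = code_matrix \<sigma> c m x"
      using L by (auto simp: intermediate_lattice_def)
    then have "x i \<in> OK" for i
      by (cases "i < m") (auto simp: coords_def)
    then show "X \<in> ?int"
      unfolding int_iff x(2) using c_integral \<sigma>_pow_integral by (auto simp: code_matrix_def)
  qed
  have add: "(\<lambda>i. x i + y i) \<in> L" and smult: "a \<in> R \<Longrightarrow> (\<lambda>i. a * x i) \<in> L" if "x \<in> L" "y \<in> L" for x y a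
    using L that unfolding intermediate_lattice_def by blast+
  have 0: "0\<^sub>m m m \<in> ?C"
    using code_of_intermediate(1)[OF L] by blast
  have sub: "submodule (sub_of R) ?C (?MK\<lparr>carrier := ?int\<rparr>)"
    unfolding LinearCombinations.submodule_def
  proof (intro conjI allI impI int)
    show "?C \<subseteq> carrier (?MK\<lparr>carrier := ?int\<rparr>)"
      using C_int by simp
    show "\<zero>\<^bsub>?MK\<lparr>carrier := ?int\<rparr>\<^esub> \<in> ?C"
      using 0 by (simp add: module_mat_simps)
    show "v \<oplus>\<^bsub>?MK\<lparr>carrier := ?int\<rparr>\<^esub> w \<in> ?C" if "v \<in> ?C" "w \<in> ?C" for v w
      using that add by (auto simp: module_mat_simps simp flip: code_matrix_add)
    show "a \<odot>\<^bsub>?MK\<lparr>carrier := ?int\<rparr>\<^esub> v \<in> ?C" if a: "a \<in> carrier (sub_of R)" and v: "v \<in> ?C" for a v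
    proof -
      obtain x where x: "x \<in> L" "v = code_matrix \<sigma> c m x" using v by blast
      have "a \<in> F" using a by (simp add: val_ring_def)
      then have "a \<cdot>\<^sub>m v = code_matrix \<sigma> c m (\<lambda>i. a * x i)"
        by (simp add: x(2) code_matrix_smult)
      then show ?thesis
        using smult[OF x(1) x(1)] a by (simp add: module_mat_simps)
    qed
  qed
  obtain g where g: "bij_betw g (coords F (m * m)) (coords UNIV m)" "g ` coords R (m * m) = L"
      "linear_coords F (m * m) g"
    using intermediate_lattice_basis[OF L complete_subfield_axioms subset_refl dimension_F] by blast
  have "free_of_rank (sub_of R) (?MK\<lparr>carrier := ?C\<rparr>) (m * m)"
  proof (rule module_coords.free_of_rank_coords[where h = "\<lambda>a. code_matrix \<sigma> c m (g a)"])
    show "module_coords R (?MK\<lparr>carrier := ?C\<rparr>) (m * m) (\<lambda>a. code_matrix \<sigma> c m (g a))"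
    proof (rule module_coords.intro)
      show "module (sub_of R) (?MK\<lparr>carrier := ?C\<rparr>)"
        using module.submodule_is_module[OF int sub] by simp
      have "L \<subseteq> coords UNIV m"
        using L by (auto simp: intermediate_lattice_def coords_def)
      then have "inj_on (code_matrix \<sigma> c m) (g ` coords R (m * m))"
        unfolding g(2) by (rule inj_on_subset[OF code_matrix_inj])
      moreover have "inj_on g (coords R (m * m))"
        by (rule inj_on_subset[OF bij_betw_imp_inj_on[OF g(1)] coords_sub])
      ultimately show "inj_on (\<lambda>a. code_matrix \<sigma> c m (g a)) (coords R (m * m))"
        using comp_inj_on[of g "coords R (m * m)" "code_matrix \<sigma> c m"] by (simp add: comp_def)
      show "(\<lambda>a. code_matrix \<sigma> c m (g a)) ` coords R (m * m) \<subseteq> carrier (?MK\<lparr>carrier := ?C\<rparr>)"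
        using g(2) by auto
      show "code_matrix \<sigma> c m (g (\<lambda>k. a k + b k)) =
          code_matrix \<sigma> c m (g a) \<oplus>\<^bsub>?MK\<lparr>carrier := ?C\<rparr>\<^esub> code_matrix \<sigma> c m (g b)"
        if "a \<in> coords R (m * m)" "b \<in> coords R (m * m)" for a b
      proof -
        have "a \<in> coords F (m * m)" "b \<in> coords F (m * m)" using that coords_sub by auto
        then have "g (\<lambda>k. a k + b k) = (\<lambda>i. g a i + g b i)"
          using g(3) unfolding linear_coords_def by simp
        then show ?thesis by (simp add: code_matrix_add module_mat_simps)
      qed
      show "code_matrix \<sigma> c m (g (\<lambda>k. r * a k)) = r \<odot>\<^bsub>?MK\<lparr>carrier := ?C\<rparr>\<^esub> code_matrix \<sigma> c m (g a)"
        if "r \<in> R" "a \<in> coords R (m * m)" for r a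
      proof -
        have "a \<in> coords F (m * m)" "r \<in> F" using that coords_sub R_subset by auto
        then have "g (\<lambda>k. r * a k) = (\<lambda>i. r * g a i)"
          using g(3) unfolding linear_coords_def by simp
        then show ?thesis using \<open>r \<in> F\<close> by (simp add: code_matrix_smult module_mat_simps)
      qed
    qed simp_all
    show "(\<lambda>a. code_matrix \<sigma> c m (g a)) ` coords R (m * m) = carrier (?MK\<lparr>carrier := ?C\<rparr>)"
      using g(2) by (auto simp: image_image[symmetric])
  qed
  moreover have "m * (m - min_distance m ?C + 1) * ext_degree F = m * m"
    by (simp add: min_distance_intermediate[OF L] ext_degree_eq)
  ultimately show ?thesis
    unfolding linear_MRD_def Let_def code_of_intermediate(1)[OF L]
    using code_of_intermediate(2,3)[OF L] sub by (simp only: simp_thms not_False_eq_True)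
qed

end


section \<open>Reduction modulo the maximal ideal\<close>

context integral_code
begin

text \<open>By discreteness a norm below 1 has exponent at least 1, so \<pi> divides the element
  integrally.\<close>

lemma max_ideal_eq: "a \<in> max_ideal nrm F \<Longrightarrow> \<exists>b\<in>R. a = \<pi> * b"
proof -
  assume a: "a \<in> max_ideal nrm F"
  have \<pi>: "\<pi> \<noteq> 0" using uniformizer by auto
  have "nrm (a / \<pi>) \<le> 1"
  proof (cases "a = 0")
    case False
    have aF: "a \<in> F" "nrm a < 1" using a by (auto simp: max_ideal_def)
    obtain n where n: "nrm a = nrm \<pi> powi n" using discrete[OF aF(1) False] by blast
    have "1 \<le> n"
    proof (rule ccontr)
      assume "\<not> 1 \<le> n"
      then have "nrm \<pi> powi 0 \<le> nrm \<pi> powi n"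
        using uniformizer by (intro power_int_decreasing) auto
      then show False using n aF(2) by simp
    qed
    then have "nrm \<pi> powi n \<le> nrm \<pi> powi 1"
      using uniformizer by (intro power_int_decreasing) auto
    then show ?thesis using n uniformizer by (simp add: nrm_divide)
  qed simp
  then have "a / \<pi> \<in> R"
    using a uniformizer(1) by (auto simp: val_ring_def max_ideal_def)
  moreover have "a = \<pi> * (a / \<pi>)" using \<pi> by simp
  ultimately show ?thesis by blast
qed

text \<open>An element of \<open>ideal_prod\<close> is a sum of products; as \<pi> generates \<pp>,
  each such sum collapses to one multiple of \<pi>.\<close>

lemma pOK_eq: "pOK nrm F = (\<lambda>b. \<pi> * b) ` OK"
proof (intro equalityI subsetI)
  fix a assume "a \<in> pOK nrm F"
  then show "a \<in> (\<lambda>b. \<pi> * b) ` OK"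
    unfolding pOK_def
  proof induction
    case (prod i j)
    obtain b where b: "b \<in> R" "i = \<pi> * b" using max_ideal_eq[OF prod(1)] by blast
    have "b * j \<in> OK" using b(1) R_OK prod(2) by (intro OK_closed) auto
    then show ?case by (rule rev_image_eqI) (simp add: b(2) mult.assoc)
  next
    case (sum s t)
    then obtain x y where "x \<in> OK" "y \<in> OK" "s = \<pi> * x" "t = \<pi> * y" by blast
    then show ?case by (intro rev_image_eqI[of "x + y"]) (simp_all add: distrib_left)
  qed
next
  fix a assume "a \<in> (\<lambda>b. \<pi> * b) ` OK"
  then obtain b where b: "b \<in> OK" "a = \<pi> * b" by blast
  have "\<pi> \<in> max_ideal nrm F" using uniformizer by (simp add: max_ideal_def)
  from ideal_prod.prod[OF this b(1), of "sub_of OK"] show "a \<in> pOK nrm F"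
    by (simp add: pOK_def b(2))
qed

lemma pOK_closed:
  shows "0 \<in> pOK nrm F" and "a \<in> pOK nrm F \<Longrightarrow> b \<in> pOK nrm F \<Longrightarrow> a + b \<in> pOK nrm F"
    and "a \<in> pOK nrm F \<Longrightarrow> - a \<in> pOK nrm F" and "pOK nrm F \<subseteq> OK"
proof -
  show "0 \<in> pOK nrm F" unfolding pOK_eq by (rule rev_image_eqI[of 0]) auto
  show "a + b \<in> pOK nrm F" if ab: "a \<in> pOK nrm F" "b \<in> pOK nrm F"
  proof -
    obtain x y where "x \<in> OK" "y \<in> OK" "a = \<pi> * x" "b = \<pi> * y" using ab unfolding pOK_eq by blast
    then show ?thesis unfolding pOK_eq by (intro rev_image_eqI[of "x + y"]) (simp_all add: distrib_left)
  qed
  show "- a \<in> pOK nrm F" if a: "a \<in> pOK nrm F"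
  proof -
    obtain x where "x \<in> OK" "a = \<pi> * x" using a unfolding pOK_eq by blast
    then show ?thesis unfolding pOK_eq by (intro rev_image_eqI[of "- x"]) simp_all
  qed
  have "\<pi> \<in> OK" using uniformizer by (simp add: val_ring_def)
  then show "pOK nrm F \<subseteq> OK" unfolding pOK_eq by auto
qed

lemma reduction_eq_iff: "reduction nrm F x = reduction nrm F y \<longleftrightarrow> (\<forall>i. x i - y i \<in> pOK nrm F)"
proof -
  have coset: "pOK nrm F +>\<^bsub>sub_of OK\<^esub> a = {p + a | p. p \<in> pOK nrm F}" for a
    by (auto simp: a_r_coset_def')
  have "pOK nrm F +>\<^bsub>sub_of OK\<^esub> a = pOK nrm F +>\<^bsub>sub_of OK\<^esub> b \<longleftrightarrow> a - b \<in> pOK nrm F" for a b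
  proof
    assume eq: "pOK nrm F +>\<^bsub>sub_of OK\<^esub> a = pOK nrm F +>\<^bsub>sub_of OK\<^esub> b"
    have "0 + a \<in> {p + a | p. p \<in> pOK nrm F}" using pOK_closed(1) by blast
    then have "0 + a \<in> {p + b | p. p \<in> pOK nrm F}" using eq unfolding coset by simp
    then show "a - b \<in> pOK nrm F" by auto
  next
    assume ab: "a - b \<in> pOK nrm F"
    have "p + a \<in> {p + b | p. p \<in> pOK nrm F}" if "p \<in> pOK nrm F" for p
      using pOK_closed(2)[OF that ab] by (intro CollectI exI[of _ "p + (a - b)"]) simp
    moreover have "p + b \<in> {p + a | p. p \<in> pOK nrm F}" if "p \<in> pOK nrm F" for p
      using pOK_closed(2)[OF that pOK_closed(3)[OF ab]] by (intro CollectI exI[of _ "p + - (a - b)"]) simp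
    ultimately show "pOK nrm F +>\<^bsub>sub_of OK\<^esub> a = pOK nrm F +>\<^bsub>sub_of OK\<^esub> b"
      unfolding coset by blast
  qed
  then show ?thesis unfolding reduction_def fun_eq_iff by blast
qed

text \<open>This inclusion makes \<open>reduction\<close> constant on each coset of
  \<pp>\<Lambda>.\<close>

lemma pLambda_coordinates:
  assumes "z \<in> pLambda nrm F \<sigma> m c"
  shows "\<forall>i. z i \<in> pOK nrm F"
  using assms unfolding pLambda_def
proof induction
  case (prod i x)
  obtain a where a: "a \<in> max_ideal nrm F" "i = const a" using prod(1) by blast
  have x: "x \<in> coords OK m" using prod(2) by (simp only: natural_order_simps)
  have "a \<in> OK" using a(1) by (simp add: max_ideal_def val_ring_def)
  moreover have "a * x j \<in> pOK nrm F" for j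
  proof -
    have "x j \<in> OK" using x by (cases "j < m") (auto simp: coords_def)
    from ideal_prod.prod[OF a(1) this, of "sub_of OK"] show ?thesis by (simp add: pOK_def)
  qed
  ultimately show ?case unfolding a(2) using const_mult[OF _ x] by simp
next
  case (sum s t)
  then show ?case using pOK_closed(2) by (simp add: natural_order_simps(3))
qed

lemma zero_in_pLambda: "(\<lambda>_. 0) \<in> pLambda nrm F \<sigma> m c"
proof -
  have z: "(\<lambda>_. 0) \<in> coords OK m" by (auto simp: coords_def)
  have "const 0 \<in> const ` max_ideal nrm F" by (rule imageI) (auto simp: max_ideal_def)
  from ideal_prod.prod[OF this, of "\<lambda>_. 0" "carrier (natural_order nrm \<sigma> m c)" "natural_order nrm \<sigma> m c"]
  show ?thesis unfolding pLambda_def natural_order_simps(1) using z const_mult[OF _ z, of 0] by simp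
qed

text \<open>\<open>the_elem\<close> is meaningful because the image of the coset is a singleton:
  \<open>reduction\<close> is constant on it, and it contains \<open>x\<close>. Hence
  \<open>rho\<close> is just \<open>reduction\<close>.\<close>

lemma reduction_quot_proj: "reduction_quot nrm F (proj_Lambda nrm F \<sigma> m c x) = reduction nrm F x"
proof -
  have proj: "proj_Lambda nrm F \<sigma> m c x = {(\<lambda>i. z i + x i) | z. z \<in> pLambda nrm F \<sigma> m c}"
    unfolding proj_Lambda_def a_r_coset_def' by (auto simp: natural_order_simps(3))
  have red: "reduction nrm F (\<lambda>i. z i + x i) = reduction nrm F x" if "z \<in> pLambda nrm F \<sigma> m c" for z
    using pLambda_coordinates[OF that] by (simp add: reduction_eq_iff)
  have "reduction nrm F ` proj_Lambda nrm F \<sigma> m c x = {reduction nrm F x}"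
  proof (intro equalityI subsetI)
    fix y assume "y \<in> reduction nrm F ` proj_Lambda nrm F \<sigma> m c x"
    then show "y \<in> {reduction nrm F x}" unfolding proj using red by auto
  next
    fix y assume "y \<in> {reduction nrm F x}"
    have "(\<lambda>i. 0 + x i) \<in> proj_Lambda nrm F \<sigma> m c x"
      unfolding proj by (intro CollectI exI[of _ "\<lambda>_. 0"] conjI refl zero_in_pLambda)
    then have "x \<in> proj_Lambda nrm F \<sigma> m c x" by simp
    with \<open>y \<in> _\<close> show "y \<in> reduction nrm F ` proj_Lambda nrm F \<sigma> m c x" by simp
  qed
  then show ?thesis by (simp add: reduction_quot_def)
qed

text \<open>Elements with the same reduction as some \<open>y\<close> in \<open>L\<close> differ
  from \<open>y\<close> by an element of \<pi>\<Lambda>, which lies in \<open>L\<close>.\<close>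

lemma lift_lattice_eq:
  assumes L: "intermediate_lattice L"
  shows "lift_lattice nrm F \<sigma> m c L = L"
proof -
  have "lift_lattice nrm F \<sigma> m c L = {x \<in> coords OK m. \<exists>y\<in>L. reduction nrm F x = reduction nrm F y}"
    unfolding lift_lattice_def rho_def reduction_quot_proj image_image natural_order_simps(1) by auto
  also have "\<dots> = L"
  proof (intro equalityI subsetI)
    fix x assume "x \<in> {x \<in> coords OK m. \<exists>y\<in>L. reduction nrm F x = reduction nrm F y}"
    then obtain y where x: "x \<in> coords OK m" and y: "y \<in> L" and xy: "\<And>i. x i - y i \<in> pOK nrm F"
      by (auto simp: reduction_eq_iff)
    have yO: "y \<in> coords OK m" using L y by (auto simp: intermediate_lattice_def)
    have "\<forall>i. \<exists>b. b \<in> OK \<and> x i - y i = \<pi> * b"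
      using xy unfolding pOK_eq by blast
    \<comment> \<open>The coordinatewise quotient of \<open>x - y\<close> by \<pi>. It belongs to
      \<Lambda> because it vanishes from \<open>m\<close> on, as \<open>x\<close> and
      \<open>y\<close> do.\<close>
    from choice[OF this] obtain w where w: "\<forall>i. w i \<in> OK \<and> x i - y i = \<pi> * w i" by (rule exE)
    have \<pi>: "\<pi> \<in> max_ideal nrm F" "\<pi> \<noteq> 0" using uniformizer by (auto simp: max_ideal_def)
    have "w i = 0" if "m \<le> i" for i
    proof -
      have "x i = 0" "y i = 0" using x yO that by (auto simp: coords_def)
      then have "\<pi> * w i = 0" using w[rule_format, of i] by simp
      then show ?thesis using \<pi>(2) by simp
    qed
    then have "w \<in> coords OK m" using w by (simp add: coords_def)
    then have "(\<lambda>i. \<pi> * w i) \<in> L"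
      by (rule L[unfolded intermediate_lattice_def, THEN conjunct2, THEN conjunct2, THEN conjunct2,
            THEN conjunct2, rule_format, OF \<pi>(1)])
    then have "(\<lambda>i. \<pi> * w i + y i) \<in> L"
      using y by (rule L[unfolded intermediate_lattice_def, THEN conjunct2, THEN conjunct2,
            THEN conjunct1, rule_format])
    moreover have "(\<lambda>i. \<pi> * w i + y i) = x"
    proof
      fix i
      show "\<pi> * w i + y i = x i" using w[rule_format, of i] by (simp add: diff_eq_eq)
    qed
    ultimately show "x \<in> L" by simp
  qed (use L in \<open>auto simp: intermediate_lattice_def\<close>)
  finally show ?thesis .
qed

end

section \<open>The base fields F, Q_p and F_q((u)), and the theorem\<close>

lemma local_nonarch_field_imp_complete_subfield:
  assumes "nonarch_abs nrm UNIV" and "local_nonarch_field nrm E"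
  shows "\<exists>\<pi>. complete_subfield nrm E \<pi>"
  using assms unfolding local_nonarch_field_def complete_subfield_def complete_subfield_axioms_def nonarch_def
  by blast

text \<open>By density of \<open>\<rat>\<close> and the ultrametric inequality, every value on \<open>\<rat>\<^sub>p\<close> is a value on \<open>\<rat>\<close>.\<close>

lemma padic_numbers_imp_complete_subfield:
  assumes "nonarch_abs nrm UNIV" and Qp: "padic_numbers nrm p Qp"
  shows "complete_subfield nrm Qp (of_nat p)"
proof -
  interpret nonarch nrm by (rule nonarch.intro) fact
  obtain b where b: "0 < b" "b < 1"
      "\<And>n::int. n \<noteq> 0 \<Longrightarrow> nrm (of_int n) = b ^ multiplicity (int p) n"
    and dense: "\<And>x e. x \<in> Qp \<Longrightarrow> 0 < e \<Longrightarrow> \<exists>a d :: int. d \<noteq> 0 \<and> nrm (x - of_int a / of_int d) < e"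
    and p: "prime p" and sub: "subfield Qp class_ring" and "complete_abs nrm Qp"
    using Qp unfolding padic_numbers_def by blast
  have np: "nrm (of_nat p) = b"
  proof -
    have "multiplicity (int p) (int p) = 1"
      using p by (intro multiplicity_self) auto
    then show ?thesis using b(3)[of "int p"] p by (auto simp: prime_gt_0_nat)
  qed
  have "of_nat n \<in> Qp" for n
    using subringD[OF subfieldE(1)[OF sub]] by (induction n) auto
  moreover have "\<exists>n::int. nrm x = nrm (of_nat p) powi n" if x: "x \<in> Qp" "x \<noteq> 0" for x
  proof -
    obtain a d :: int where ad: "d \<noteq> 0" "nrm (x - of_int a / of_int d) < nrm x"
      using dense[OF x(1), of "nrm x"] x(2) by auto
    let ?y = "of_int a / of_int d"
    have "nrm x \<le> max (nrm (x - ?y)) (nrm ?y)" using nrm_add[of "x - ?y" ?y] by simp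
    moreover have "nrm ?y \<le> max (nrm x) (nrm (x - ?y))" using nrm_diff[of x "x - ?y"] by simp
    ultimately have eq: "nrm x = nrm ?y" using ad(2) by linarith
    then have "a \<noteq> 0" using x(2) by auto
    then have "nrm x = b powi (int (multiplicity (int p) a) - int (multiplicity (int p) d))"
      unfolding eq nrm_divide using b ad(1) by (simp add: power_int_diff)
    then show ?thesis unfolding np by blast
  qed
  ultimately show ?thesis
    using sub \<open>complete_abs nrm Qp\<close> np b(1,2)
    by (intro complete_subfield.intro nonarch_axioms complete_subfield_axioms.intro) auto
qed

text \<open>Since \<open>0 < b < 1\<close>, nonnegative order in \<open>u\<close> means norm at most
  1. The power series ring is therefore the valuation ring of \<open>F\<close>, and the Laurent case
  of the theorem is the statement over \<open>F\<close> itself.\<close>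

lemma laurent_identification_val_ring:
  fixes \<phi> :: "'q::field fls \<Rightarrow> 'k::field"
  assumes "nonarch_abs nrm UNIV" and \<phi>: "laurent_identification nrm F \<phi>"
  shows "\<phi> ` range fps_to_fls = val_ring nrm F"
proof -
  interpret nonarch nrm by (rule nonarch.intro) fact
  obtain b where b: "0 < b" "b < 1" "\<And>f. f \<noteq> 0 \<Longrightarrow> nrm (\<phi> f) = b powi fls_subdegree f"
    and iso: "\<phi> \<in> ring_iso class_ring (sub_of F)"
    using \<phi> unfolding laurent_identification_def by blast
  have bij: "bij_betw \<phi> UNIV F" and hom: "\<phi> \<in> Ring.ring_hom class_ring (sub_of F)"
    using iso by (auto simp: ring_iso_def)
  have "\<phi> (0 + 0) = \<phi> 0 + \<phi> 0"
    using ring_hom_add[OF hom, of 0 0] by simp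
  then have \<phi>0: "\<phi> 0 = 0" by (metis add_0 add_cancel_right_right)
  have int: "f \<in> range fps_to_fls \<longleftrightarrow> nrm (\<phi> f) \<le> 1" for f
  proof (cases "f = 0")
    case True
    have "f = fps_to_fls 0" using True by simp
    then have "f \<in> range fps_to_fls" by (rule range_eqI)
    then show ?thesis using True \<phi>0 by simp
  next
    case False
    have "f \<in> range fps_to_fls \<longleftrightarrow> 0 \<le> fls_subdegree f"
    proof
      assume "0 \<le> fls_subdegree f"
      then have "f = fps_to_fls (fls_regpart f)" by simp
      then show "f \<in> range fps_to_fls" by (rule range_eqI)
    qed (auto simp: fls_subdegree_fls_to_fps_gt0)
    also have "\<dots> \<longleftrightarrow> b powi fls_subdegree f \<le> 1"
    proof
      assume "0 \<le> fls_subdegree f"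
      then have "b powi fls_subdegree f \<le> b powi 0" using b by (intro power_int_decreasing) auto
      then show "b powi fls_subdegree f \<le> 1" by simp
    next
      assume le: "b powi fls_subdegree f \<le> 1"
      show "0 \<le> fls_subdegree f"
      proof (rule ccontr)
        assume "\<not> 0 \<le> fls_subdegree f"
        then have "b powi (- 1) \<le> b powi fls_subdegree f" using b by (intro power_int_decreasing) auto
        then have "inverse b \<le> 1" using le by (simp add: power_int_minus)
        then show False using b one_less_inverse[of b] by simp
      qed
    qed
    finally show ?thesis using b(3)[OF False] by simp
  qed
  show ?thesis
  proof (intro equalityI subsetI)
    fix x assume "x \<in> \<phi> ` range fps_to_fls"
    then obtain f where "f \<in> range fps_to_fls" "x = \<phi> f" by blast
    then show "x \<in> val_ring nrm F" using int[of f] bij by (auto simp: val_ring_def bij_betw_def)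
  next
    fix x assume x: "x \<in> val_ring nrm F"
    then obtain f where "x = \<phi> f" using bij by (auto simp: val_ring_def bij_betw_def)
    then show "x \<in> \<phi> ` range fps_to_fls" using x int[of f] by (auto simp: val_ring_def)
  qed
qed

theorem mainTheorem3:
  fixes nrm :: "'k::field \<Rightarrow> real" and F :: "'k set" and m :: nat
    and \<sigma> :: "'k \<Rightarrow> 'k" and c :: 'k
  defines "A \<equiv> petit_binom class_ring \<sigma> m c"
    and "\<Lambda> \<equiv> natural_order nrm \<sigma> m c"
    and "OF \<equiv> val_ring nrm F"
    and "OK \<equiv> val_ring nrm UNIV"
    and "\<pp> \<equiv> max_ideal nrm F"
  assumes "local_nonarch_field nrm UNIV"
    and "local_nonarch_field nrm F"
    and "cyclic_galois F m \<sigma>"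
    and "c \<in> OK" and "c \<noteq> 0"
    and "division_alg A"
  shows "(\<forall>x\<in>carrier \<Lambda>. x \<noteq> \<zero>\<^bsub>\<Lambda>\<^esub> \<longrightarrow> vec_space.rank m (code_matrix \<sigma> c m x) = m) \<and>
    linear_MRD nrm F m (code_of \<sigma> c m (carrier \<Lambda>)) \<and>
    (\<forall>I g. principal_left_ideal \<Lambda> g I \<and> monic_poly class_ring g \<and>
           const_poly class_ring ` \<pp> \<subseteq> I \<longrightarrow>
       linear_MRD nrm F m (code_of \<sigma> c m I) \<and>
       (let L = lift_lattice nrm F \<sigma> m c I in
          code_of \<sigma> c m L = code_of \<sigma> c m I \<and>
          linear_MRD nrm F m (code_of \<sigma> c m L) \<and>
          lattice_of_rank_mult OF F A L m OK \<and>
          (\<forall>p Qp. padic_numbers nrm p Qp \<and> Qp \<subseteq> F \<and>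
                  (\<exists>n. ring.dimension class_ring n Qp F) \<longrightarrow>
             lattice_of_rank_mult (val_ring nrm Qp) Qp A L m OK) \<and>
          (\<forall>\<phi> :: 'q::{field,finite} fls \<Rightarrow> 'k. laurent_identification nrm F \<phi> \<longrightarrow>
             lattice_of_rank_mult (\<phi> ` range fps_to_fls) F A L m OK)))"
proof -
  have na: "nonarch_abs nrm UNIV"
    using assms(6) by (simp add: local_nonarch_field_def)
  obtain \<pi> where \<pi>: "complete_subfield nrm F \<pi>"
    using local_nonarch_field_imp_complete_subfield[OF na assms(7)] by blast
  interpret integral_code F m \<sigma> nrm \<pi> c
    using \<pi> assms(8,9,11) unfolding OK_def A_def
    by (intro integral_code.intro cyclic_extension.intro integral_code_axioms.intro)
  have rank: "vec_space.rank m (code_matrix \<sigma> c m x) = m" if "x \<in> carrier \<Lambda>" "x \<noteq> \<zero>\<^bsub>\<Lambda>\<^esub>" for x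
  proof -
    have "x \<in> coords UNIV m" "x \<noteq> (\<lambda>_. 0)"
      using that unfolding \<Lambda>_def natural_order_simps by (auto simp: coords_def)
    then show ?thesis by (rule rank_code_matrix[OF division])
  qed
  have order: "linear_MRD nrm F m (code_of \<sigma> c m (carrier \<Lambda>))"
    unfolding \<Lambda>_def natural_order_simps
    by (rule linear_MRD_intermediate[OF intermediate_lattice_order])
  have "linear_MRD nrm F m (code_of \<sigma> c m I) \<and>
       (let L = lift_lattice nrm F \<sigma> m c I in
          code_of \<sigma> c m L = code_of \<sigma> c m I \<and>
          linear_MRD nrm F m (code_of \<sigma> c m L) \<and>
          lattice_of_rank_mult OF F A L m OK \<and>
          (\<forall>p Qp. padic_numbers nrm p Qp \<and> Qp \<subseteq> F \<and>
                  (\<exists>n. ring.dimension class_ring n Qp F) \<longrightarrow>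
             lattice_of_rank_mult (val_ring nrm Qp) Qp A L m OK) \<and>
          (\<forall>\<phi> :: 'q::{field,finite} fls \<Rightarrow> 'k. laurent_identification nrm F \<phi> \<longrightarrow>
             lattice_of_rank_mult (\<phi> ` range fps_to_fls) F A L m OK))"
    if "principal_left_ideal \<Lambda> g I" "const_poly class_ring ` \<pp> \<subseteq> I" for I g
  proof -
    have I: "intermediate_lattice I"
      using that unfolding \<Lambda>_def \<pp>_def principal_left_ideal_def
      by (intro intermediate_lattice_left_ideal) auto
    have MRD: "linear_MRD nrm F m (code_of \<sigma> c m I)"
      by (rule linear_MRD_intermediate[OF I])
    have lattice_F: "lattice_of_rank_mult OF F A I m OK"
      unfolding OF_def A_def OK_def
      by (rule lattice_of_rank_intermediate[OF I complete_subfield_axioms subset_refl dimension_F])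
    have lattice_Qp: "lattice_of_rank_mult (val_ring nrm Qp) Qp A I m OK"
      if Qp: "padic_numbers nrm p Qp" "Qp \<subseteq> F" "ring.dimension class_ring n Qp F" for p Qp n
    proof -
      have "subfield Qp class_ring" using Qp(1) by (simp add: padic_numbers_def)
      \<comment> \<open>Multiplicativity of degrees in the tower from \<rat>_p through
        \<open>F\<close> to \<open>K\<close>.\<close>
      then have "ring.dimension class_ring (n * m) Qp UNIV"
        using ring.telescopic_base[OF ring_class_ring _ subfield_F Qp(3) dimension_F] by blast
      then show ?thesis
        unfolding A_def OK_def
        by (rule lattice_of_rank_intermediate[OF I padic_numbers_imp_complete_subfield[OF na Qp(1)] Qp(2)])
    qed
    have lattice_fls: "lattice_of_rank_mult (\<phi> ` range fps_to_fls) F A I m OK"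
      if "laurent_identification nrm F \<phi>" for \<phi> :: "'q fls \<Rightarrow> 'k"
      using lattice_F unfolding laurent_identification_val_ring[OF na that] OF_def .
    show ?thesis
      unfolding lift_lattice_eq[OF I] Let_def
      using MRD lattice_F lattice_Qp lattice_fls by blast
  qed
  then show ?thesis
    using rank order by blast
qed

end
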